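(* Let $H$ be a Hopf algebra over a field $\Bbbk$. Every partial $H$-bicomodule algebra $(\bar\lambda, A,\bar\rho)$ has a globalization.
   Context: Algebras are over $\Bbbk$, associative, not necessarily unital; linear means $\Bbbk$-linear; $\otimes=\otimes_\Bbbk$. $\Delta,\varepsilon$ are the comultiplication and counit of $H$; $I$ denotes identity maps. A unital algebra $A$ with a linear map $\bar\rho:A\to A\otimes H$ is a right partial $H$-comodule algebra if, for all $a,b\in A$: $\bar\rho(ab)=\bar\rho(a)\bar\rho(b)$; $(I_A\otimes\varepsilon)\bar\rho(a)=a$; $(\bar\rho\otimes I_H)\bar\rho(a)=(\bar\rho(1_A)\otimes 1_H)[(I_A\otimes\Delta)\bar\rho(a)]$. With a linear map $\bar\lambda:A\to H\otimes A$ it is a left partial $H$-comodule algebra if $(\varepsilon\otimes I_A)\bar\lambda(a)=a$; $\bar\lambda(ab)=\bar\lambda(a)\bar\lambda(b)$; $(I_H\otimes\bar\lambda)\bar\lambda(a)=[(\Delta\otimes I_A)\bar\lambda(a)](1_H\otimes\bar\lambda(1_A))$. A partial $H$-bicomodule algebra $(\bar\lambda,A,\bar\rho)$ is a unital algebra that is both, with $(I_H\otimes\bar\rho)\bar\lambda=(\bar\lambda\otimes I_H)\bar\rho$. A (global) $H$-bicomodule algebra $(\lambda,B,\rho)$ (here $B$ need not be unital) is an algebra $B$ with multiplicative linear maps $\rho:B\to B\otimes H$, $\lambda:B\to H\otimes B$ satisfying $(I_B\otimes\varepsilon)\rho=I_B$, $(\rho\otimes I_H)\rho=(I_B\otimes\Delta)\rho$,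 $(\varepsilon\otimes I_B)\lambda=I_B$, $(I_H\otimes\lambda)\lambda=(\Delta\otimes I_B)\lambda$, and $(I_H\otimes\rho)\lambda=(\lambda\otimes I_H)\rho$. A globalization of a partial $H$-bicomodule algebra $(\bar\lambda,A,\bar\rho)$ is a pair $((\lambda,B,\rho),\theta)$, where $(\lambda,B,\rho)$ is an $H$-bicomodule algebra ($B$ not necessarily unital) and $\theta:A\to B$ is an algebra monomorphism such that: (1) $B$ is the $H$-bicomodule algebra generated by $\theta(A)$, i.e. the smallest $H$-bicomodule algebra containing $\theta(A)$ (the only subalgebra $M\subseteq B$ with $\theta(A)\subseteq M$, $\rho(M)\subseteq M\otimes H$, $\lambda(M)\subseteq H\otimes M$ is $M=B$); (2) $(\lambda(\theta(a))\otimes 1_H)(1_H\otimes\rho(\theta(b)))=(I_H\otimes\theta\otimes I_H)\big((\bar\lambda(a)\otimes 1_H)(1_H\otimes\bar\rho(b))\big)$ for all $a,b\in A$. *)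

theory Defs
  imports Complex_Main "HOL-Library.Function_Algebras"
begin

section \<open>Vector spaces and algebras over a field\<close>

text \<open>
  The base field is the type \<open>'k::field\<close>. A vector space is a linear subspace of an
  ambient vector space in the sense of \<^locale>\<open>vector_space\<close>; taking \<open>carrier = UNIV\<close> gives
  all of the ambient space. Maps between such spaces are only relevant on the carriers.
\<close>

record ('k, 'v) vs =
  carrier :: "'v set"
  scl :: "'k \<Rightarrow> 'v \<Rightarrow> 'v"

record ('k, 'v) alg = "('k, 'v) vs" +
  mult :: "'v \<Rightarrow> 'v \<Rightarrow> 'v"

record ('k, 'v) ualg = "('k, 'v) alg" +
  one :: 'v

definition vspace :: "('k::field, 'v::ab_group_add, 'm) vs_scheme \<Rightarrow> bool" where
  "vspace V \<longleftrightarrow> vector_space (scl V) \<and> module.subspace (scl V) (carrier V)"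

definition linear_map ::
  "('k::field, 'v::ab_group_add, 'm) vs_scheme \<Rightarrow> ('k, 'w::ab_group_add, 'n) vs_scheme
    \<Rightarrow> ('v \<Rightarrow> 'w) \<Rightarrow> bool" where
  "linear_map V W f \<longleftrightarrow>
     (\<forall>x\<in>carrier V. f x \<in> carrier W) \<and>
     (\<forall>x\<in>carrier V. \<forall>y\<in>carrier V. f (x + y) = f x + f y) \<and>
     (\<forall>c. \<forall>x\<in>carrier V. f (scl V c x) = scl W c (f x))"

definition bilinear_map ::
  "('k::field, 'v::ab_group_add, 'm) vs_scheme \<Rightarrow> ('k, 'w::ab_group_add, 'n) vs_scheme
    \<Rightarrow> ('k, 'x::ab_group_add, 'o) vs_scheme \<Rightarrow> ('v \<Rightarrow> 'w \<Rightarrow> 'x) \<Rightarrow> bool" where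
  "bilinear_map V W X f \<longleftrightarrow>
     (\<forall>v\<in>carrier V. linear_map W X (f v)) \<and>
     (\<forall>w\<in>carrier W. linear_map V X (\<lambda>v. f v w))"

text \<open>Associative algebras, not necessarily unital.\<close>

definition algebra :: "('k::field, 'v::ab_group_add, 'm) alg_scheme \<Rightarrow> bool" where
  "algebra A \<longleftrightarrow> vspace A \<and> bilinear_map A A A (mult A) \<and>
     (\<forall>x\<in>carrier A. \<forall>y\<in>carrier A. \<forall>z\<in>carrier A.
        mult A (mult A x y) z = mult A x (mult A y z))"

definition unital_algebra :: "('k::field, 'v::ab_group_add, 'm) ualg_scheme \<Rightarrow> bool" where
  "unital_algebra A \<longleftrightarrow> algebra A \<and> one A \<in> carrier A \<and>
     (\<forall>x\<in>carrier A. mult A (one A) x = x \<and> mult A x (one A) = x)"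

definition subalgebra ::
  "('k::field, 'v::ab_group_add, 'm) alg_scheme \<Rightarrow> 'v set \<Rightarrow> bool" where
  "subalgebra B M \<longleftrightarrow> M \<subseteq> carrier B \<and> module.subspace (scl B) M \<and>
     (\<forall>x\<in>M. \<forall>y\<in>M. mult B x y \<in> M)"

text \<open>Linear multiplicative maps; preservation of units is not included.\<close>

definition alg_hom ::
  "('k::field, 'v::ab_group_add, 'm) alg_scheme \<Rightarrow> ('k, 'w::ab_group_add, 'n) alg_scheme
    \<Rightarrow> ('v \<Rightarrow> 'w) \<Rightarrow> bool" where
  "alg_hom A B f \<longleftrightarrow> linear_map A B f \<and>
     (\<forall>x\<in>carrier A. \<forall>y\<in>carrier A. f (mult A x y) = mult B (f x) (f y))"

definition ground :: "('k::field, 'k) ualg" where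
  "ground = \<lparr>carrier = UNIV, scl = (*), mult = (*), one = 1\<rparr>"


section \<open>Tensor products\<close>

text \<open>
  Over a field, the pure tensor of \<open>v\<close> and \<open>w\<close> can be realised as the evaluation functional
  \<open>\<phi> \<mapsto> \<phi> v w\<close> on bilinear forms, and the tensor product as the linear span of the pure tensors.
  That this is the tensor product, i.e. has its universal property for bilinear maps into
  arbitrary vector spaces, is \<open>tensor_universal\<close> below. The operations on tensor products are
  given by explicit formulas; each is (bi)linear, hence determined (\<open>linear_map_tensor_eqI\<close>) by its
  values on pure tensors, which are computed in the lemmas below.
\<close>

type_synonym ('k, 'v, 'w) tensor = "('v \<Rightarrow> 'w \<Rightarrow> 'k) \<Rightarrow> 'k"

definition tensor ::
  "('k::field, 'v::ab_group_add, 'm) vs_scheme \<Rightarrow> ('k, 'w::ab_group_add, 'n) vs_scheme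
    \<Rightarrow> 'v \<Rightarrow> 'w \<Rightarrow> ('k, 'v, 'w) tensor" where
  "tensor V W v w = (\<lambda>\<phi>. if bilinear_map V W ground \<phi> then \<phi> v w else 0)"

definition tensor_scl :: "'k::field \<Rightarrow> ('k, 'v, 'w) tensor \<Rightarrow> ('k, 'v, 'w) tensor" where
  "tensor_scl c x = (\<lambda>\<phi>. c * x \<phi>)"

text \<open>
  For linear subspaces \<open>S\<close> of \<open>V\<close> and \<open>T\<close> of \<open>W\<close>, this is the image of the canonical
  (injective) map from the tensor product of \<open>S\<close> and \<open>T\<close> to that of \<open>V\<close> and \<open>W\<close>.
\<close>

definition tensor_span ::
  "('k::field, 'v::ab_group_add, 'm) vs_scheme \<Rightarrow> ('k, 'w::ab_group_add, 'n) vs_scheme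
    \<Rightarrow> 'v set \<Rightarrow> 'w set \<Rightarrow> ('k, 'v, 'w) tensor set" where
  "tensor_span V W S T = module.span tensor_scl {tensor V W v w |v w. v \<in> S \<and> w \<in> T}"

definition tensor_mult ::
  "('k::field, 'v::ab_group_add, 'm) alg_scheme \<Rightarrow> ('k, 'w::ab_group_add, 'n) alg_scheme
    \<Rightarrow> ('k, 'v, 'w) tensor \<Rightarrow> ('k, 'v, 'w) tensor \<Rightarrow> ('k, 'v, 'w) tensor" where
  "tensor_mult A B x y = (\<lambda>\<phi>. if bilinear_map A B ground \<phi>
     then x (\<lambda>a b. y (\<lambda>a' b'. \<phi> (mult A a a') (mult B b b'))) else 0)"

definition tensor_alg ::
  "('k::field, 'v::ab_group_add, 'm) alg_scheme \<Rightarrow> ('k, 'w::ab_group_add, 'n) alg_scheme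
    \<Rightarrow> ('k, ('k, 'v, 'w) tensor) alg" (infixr \<open>\<otimes>\<close> 75) where
  "A \<otimes> B = \<lparr>carrier = tensor_span A B (carrier A) (carrier B),
     scl = tensor_scl, mult = tensor_mult A B\<rparr>"

text \<open>The tensor product of two linear maps, with values in the tensor product of \<open>V'\<close> and \<open>W'\<close>.\<close>

definition tensor_map ::
  "('k::field, 'v2::ab_group_add, 'm) vs_scheme \<Rightarrow> ('k, 'w2::ab_group_add, 'n) vs_scheme
    \<Rightarrow> ('v \<Rightarrow> 'v2) \<Rightarrow> ('w \<Rightarrow> 'w2) \<Rightarrow> ('k, 'v, 'w) tensor \<Rightarrow> ('k, 'v2, 'w2) tensor" where
  "tensor_map V' W' f g x = (\<lambda>\<phi>. if bilinear_map V' W' ground \<phi>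
     then x (\<lambda>v w. \<phi> (f v) (g w)) else 0)"

text \<open>The associativity isomorphism from \<open>(U \<otimes> V) \<otimes> W\<close> to \<open>U \<otimes> (V \<otimes> W)\<close>.\<close>

definition tensor_assoc ::
  "('k::field, 'u::ab_group_add, 'm) alg_scheme \<Rightarrow> ('k, 'v::ab_group_add, 'n) alg_scheme
    \<Rightarrow> ('k, 'w::ab_group_add, 'o) alg_scheme
    \<Rightarrow> ('k, ('k, 'u, 'v) tensor, 'w) tensor \<Rightarrow> ('k, 'u, ('k, 'v, 'w) tensor) tensor" where
  "tensor_assoc U V W x = (\<lambda>\<phi>. if bilinear_map U (V \<otimes> W) ground \<phi>
     then x (\<lambda>t w. t (\<lambda>u v. \<phi> u (tensor V W v w))) else 0)"

text \<open>The linear map on the tensor product induced by a bilinear map.\<close>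

definition tensor_lift ::
  "('k::field, 'v::ab_group_add, 'm) alg_scheme \<Rightarrow> ('k, 'w::ab_group_add, 'n) alg_scheme
    \<Rightarrow> ('k, 'x::ab_group_add, 'o) vs_scheme \<Rightarrow> ('v \<Rightarrow> 'w \<Rightarrow> 'x) \<Rightarrow> ('k, 'v, 'w) tensor \<Rightarrow> 'x" where
  "tensor_lift V W X f = (SOME g. linear_map (V \<otimes> W) X g \<and>
     (\<forall>v\<in>carrier V. \<forall>w\<in>carrier W. g (tensor V W v w) = f v w))"

lemma tensor_alg_simps [simp]:
  "carrier (A \<otimes> B) = tensor_span A B (carrier A) (carrier B)"
  "scl (A \<otimes> B) = tensor_scl"
  "mult (A \<otimes> B) = tensor_mult A B"
  by (simp_all add: tensor_alg_def)

lemma ground_simps [simp]: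
  "carrier ground = UNIV" "scl ground = (*)" "mult ground = (*)" "one ground = 1"
  by (simp_all add: ground_def)

lemma vector_space_tensor_scl: "vector_space (tensor_scl :: 'k::field \<Rightarrow> _)"
  by standard (auto simp: tensor_scl_def fun_eq_iff algebra_simps)

interpretation tensor_vs: vector_space "tensor_scl :: 'k::field \<Rightarrow> _"
  by (rule vector_space_tensor_scl)

lemma vspace_tensor: "vspace (A \<otimes> B)"
  by (simp add: vspace_def vector_space_tensor_scl tensor_span_def)

lemma tensor_in_carrier:
  "v \<in> carrier V \<Longrightarrow> w \<in> carrier W \<Longrightarrow> tensor V W v w \<in> carrier (V \<otimes> W)"
  by (auto simp: tensor_span_def intro: tensor_vs.span_base)

lemma bilinear_tensor: "bilinear_map V W (V \<otimes> W) (tensor V W)"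
  unfolding bilinear_map_def linear_map_def
  using tensor_in_carrier[of _ V _ W]
  by (auto simp: tensor_def tensor_scl_def fun_eq_iff bilinear_map_def linear_map_def)

lemma vspace_subspace:
  assumes "vspace V"
  shows "0 \<in> carrier V" "\<And>x y. x \<in> carrier V \<Longrightarrow> y \<in> carrier V \<Longrightarrow> x + y \<in> carrier V"
    "\<And>c x. x \<in> carrier V \<Longrightarrow> scl V c x \<in> carrier V"
proof -
  interpret vector_space "scl V" using assms by (simp add: vspace_def)
  have "subspace (carrier V)" using assms by (simp add: vspace_def)
  then show "0 \<in> carrier V" "\<And>x y. x \<in> carrier V \<Longrightarrow> y \<in> carrier V \<Longrightarrow> x + y \<in> carrier V"
    "\<And>c x. x \<in> carrier V \<Longrightarrow> scl V c x \<in> carrier V"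
    by (auto simp: subspace_def)
qed

lemma tensor_induct [consumes 1, case_names zero step]:
  assumes "x \<in> carrier (V \<otimes> W)"
    and "P 0"
    and "\<And>c v w y. \<lbrakk>v \<in> carrier V; w \<in> carrier W; y \<in> carrier (V \<otimes> W); P y\<rbrakk>
          \<Longrightarrow> P (tensor_scl c (tensor V W v w) + y)"
  shows "P x"
proof -
  have "x \<in> carrier (V \<otimes> W) \<and> P x"
    using assms(1) unfolding tensor_alg_simps tensor_span_def
  proof (induction rule: tensor_vs.span_induct_alt)
    case base
    show ?case using tensor_vs.span_zero assms(2) by (rule conjI)
  next
    case (step c x y)
    then obtain v w where vw: "x = tensor V W v w" "v \<in> carrier V" "w \<in> carrier W" by blast
    have y: "y \<in> carrier (V \<otimes> W)" "P y" using step(2) by (simp_all add: tensor_span_def)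
    have "tensor_scl c x + y \<in> tensor_vs.span {tensor V W v w |v w. v \<in> carrier V \<and> w \<in> carrier W}"
      by (rule tensor_vs.span_add[OF tensor_vs.span_scale[OF tensor_vs.span_base[OF step(1)]] conjunct1[OF step(2)]])
    moreover have "P (tensor_scl c x + y)"
      using assms(3)[OF vw(2,3) y, of c] vw(1) by simp
    ultimately show ?case by (rule conjI)
  qed
  then show ?thesis ..
qed

lemma linear_map_tensor_eqI:
  assumes f: "linear_map (V \<otimes> W) X f" and g: "linear_map (V \<otimes> W) X g" and X: "vspace X"
    and eq: "\<And>v w. v \<in> carrier V \<Longrightarrow> w \<in> carrier W \<Longrightarrow> f (tensor V W v w) = g (tensor V W v w)"
    and x: "x \<in> carrier (V \<otimes> W)"
  shows "f x = g x"
proof -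
  interpret X: vector_space "scl X" using X by (simp add: vspace_def)
  have h0: "h 0 = 0" if h: "linear_map (V \<otimes> W) X h" for h
  proof -
    have "h (tensor_scl 0 0) = scl X 0 (h 0)"
      using h vspace_subspace(1)[OF vspace_tensor[of V W]] unfolding linear_map_def tensor_alg_simps by blast
    then show ?thesis by simp
  qed
  show ?thesis
    using x
  proof (induction rule: tensor_induct)
    case zero
    then show ?case using h0[OF f] h0[OF g] by (simp flip: zero_fun_def)
  next
    case (step c v w y)
    note t = tensor_in_carrier[OF step(1,2)]
    have t': "tensor_scl c (tensor V W v w) \<in> carrier (V \<otimes> W)"
      using vspace_subspace(3)[OF vspace_tensor t, of c] by simp
    have lin: "h (tensor_scl c (tensor V W v w) + y) = scl X c (h (tensor V W v w)) + h y"
      if h: "linear_map (V \<otimes> W) X h" for h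
      using h t t' step(3) unfolding linear_map_def by (metis tensor_alg_simps(2))
    have "f (tensor_scl c (tensor V W v w) + y) = g (tensor_scl c (tensor V W v w) + y)"
      by (simp only: lin[OF f] lin[OF g] step(4) eq[OF step(1,2)])
    then show ?case .
  qed
qed

theorem tensor_universal:
  fixes V :: "('k::field, 'v::ab_group_add, 'm) alg_scheme"
    and W :: "('k, 'w::ab_group_add, 'n) alg_scheme"
    and X :: "('k, 'x::ab_group_add, 'o) vs_scheme"
  assumes X: "vspace X" and f: "bilinear_map V W X f"
  shows "\<exists>g. linear_map (V \<otimes> W) X g \<and>
     (\<forall>v\<in>carrier V. \<forall>w\<in>carrier W. g (tensor V W v w) = f v w)"
proof -
  interpret X: vector_space "scl X" using X by (simp add: vspace_def)
  define lin where "lin \<xi> \<longleftrightarrow> Vector_Spaces.linear (scl X) (*) \<xi>" for \<xi> :: "'x \<Rightarrow> 'k"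
  define sc where "sc = (\<lambda>(c::'k) (y :: ('x \<Rightarrow> 'k) \<Rightarrow> 'k) \<xi>. c * y \<xi>)"
  define E where "E = (\<lambda>y \<xi>. if lin \<xi> then \<xi> y else 0)"
  have sc: "vector_space sc"
    by standard (auto simp: sc_def fun_eq_iff algebra_simps)
  interpret D: vector_space_pair "scl X" sc
    by (intro vector_space_pair.intro sc X.vector_space_axioms)
  interpret K: vector_space "(*) :: 'k \<Rightarrow> 'k \<Rightarrow> 'k"
    by standard (auto simp: algebra_simps)
  interpret P: vector_space_pair "scl X" "(*) :: 'k \<Rightarrow> 'k \<Rightarrow> 'k" ..
  have lin_add: "\<xi> (a + b) = \<xi> a + \<xi> b" and lin_scl: "\<xi> (scl X c a) = c * \<xi> a" if "lin \<xi>" for \<xi> a b c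
  proof -
    interpret L: Vector_Spaces.linear "scl X" "(*)" \<xi> using that by (simp add: lin_def)
    show "\<xi> (a + b) = \<xi> a + \<xi> b" "\<xi> (scl X c a) = c * \<xi> a" by (simp_all add: L.add L.scale)
  qed
  have E: "Vector_Spaces.linear (scl X) sc E"
    by (unfold_locales) (auto simp: E_def sc_def fun_eq_iff lin_add lin_scl)
  have "inj E"
  proof (rule injI, rule ccontr)
    fix y z assume yz: "E y = E z" "y \<noteq> z"
    then have "X.independent {y - z}" by simp
    then obtain \<xi> where \<xi>: "lin \<xi>" "\<xi> (y - z) = 1"
      using P.linear_independent_extend[of "{y - z}" "\<lambda>_. 1"] by (auto simp: lin_def)
    then have "\<xi> y = \<xi> z" using fun_cong[OF yz(1), of \<xi>] by (simp add: E_def)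
    then show False using lin_add[OF \<xi>(1), of "y - z" z] \<xi>(2) by simp
  qed
  then have "inj_on E (carrier X)" by (auto intro: inj_on_subset)
  with D.linear_exists_left_inverse_on[OF E, of "carrier X"] X obtain L where
    L: "range L \<subseteq> carrier X" "Vector_Spaces.linear sc (scl X) L" "\<And>y. y \<in> carrier X \<Longrightarrow> L (E y) = y"
    by (auto simp: vspace_def)
  interpret L: Vector_Spaces.linear sc "scl X" L by (rule L)
  define J where "J = (\<lambda>(x :: ('k, 'v, 'w) tensor) \<xi>. if lin \<xi> then x (\<lambda>v w. \<xi> (f v w)) else 0)"
  have J_add: "J (x + y) = J x + J y" and J_scl: "J (tensor_scl c x) = sc c (J x)" for c x y
    by (auto simp: J_def sc_def tensor_scl_def fun_eq_iff)
  have "linear_map (V \<otimes> W) X (\<lambda>x. L (J x))"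
    using L(1) by (auto simp: linear_map_def J_add J_scl L.add L.scale)
  moreover have "L (J (tensor V W v w)) = f v w" if "v \<in> carrier V" "w \<in> carrier W" for v w
  proof -
    have "bilinear_map V W ground (\<lambda>v w. \<xi> (f v w))" if "lin \<xi>" for \<xi>
      using f that by (auto simp: bilinear_map_def linear_map_def lin_add lin_scl)
    then have "J (tensor V W v w) = E (f v w)"
      by (auto simp: J_def E_def tensor_def fun_eq_iff)
    then show ?thesis using L(3) f that by (auto simp: bilinear_map_def linear_map_def)
  qed
  ultimately show ?thesis by blast
qed

lemma tensor_lift:
  assumes "vspace X" "bilinear_map V W X f"
  shows "linear_map (V \<otimes> W) X (tensor_lift V W X f)"
    and "\<And>v w. v \<in> carrier V \<Longrightarrow> w \<in> carrier W \<Longrightarrow> tensor_lift V W X f (tensor V W v w) = f v w"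
  using someI_ex[OF tensor_universal[OF assms]] unfolding tensor_lift_def by auto

text \<open>A linear map given on the ambient type of tensors is determined by its effect on generators.\<close>

lemma linear_map_tensorI:
  assumes "vspace X"
    and "\<And>x y. x \<in> carrier (V \<otimes> W) \<Longrightarrow> y \<in> carrier (V \<otimes> W) \<Longrightarrow> h (x + y) = h x + h y"
    and "\<And>c x. x \<in> carrier (V \<otimes> W) \<Longrightarrow> h (tensor_scl c x) = scl X c (h x)"
    and "\<And>v w. v \<in> carrier V \<Longrightarrow> w \<in> carrier W \<Longrightarrow> h (tensor V W v w) \<in> carrier X"
  shows "linear_map (V \<otimes> W) X h"
proof -
  interpret X: vector_space "scl X" using assms by (simp add: vspace_def)
  have "h 0 = h (tensor_scl 0 0)" by simp
  also have "\<dots> = scl X 0 (h 0)"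
    by (rule assms(3)) (rule vspace_subspace(1)[OF vspace_tensor])
  finally have h0: "h 0 = 0" by simp
  have "h x \<in> carrier X" if "x \<in> carrier (V \<otimes> W)" for x
    using that
  proof (induction rule: tensor_induct)
    case zero
    then show ?case using h0 vspace_subspace(1)[OF assms(1)] by (simp flip: zero_fun_def)
  next
    case (step c v w y)
    note t = tensor_in_carrier[OF step(1,2)]
    have "tensor_scl c (tensor V W v w) \<in> carrier (V \<otimes> W)"
      using vspace_subspace(3)[OF vspace_tensor t, of c] by simp
    then show ?case
      using step t assms vspace_subspace[OF assms(1)] by metis
  qed
  then show ?thesis using assms(2,3) by (auto simp: linear_map_def)
qed

lemma tensor_map_tensor:
  assumes "linear_map V V' f" "linear_map W W' g" "v \<in> carrier V" "w \<in> carrier W"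
  shows "tensor_map V' W' f g (tensor V W v w) = tensor V' W' (f v) (g w)"
proof -
  have "bilinear_map V W ground (\<lambda>v w. \<phi> (f v) (g w))" if "bilinear_map V' W' ground \<phi>" for \<phi>
    using that assms(1,2) by (auto simp: bilinear_map_def linear_map_def)
  then show ?thesis by (auto simp: tensor_map_def tensor_def fun_eq_iff)
qed

lemma tensor_map_linear:
  assumes "linear_map V V' f" "linear_map W W' g"
  shows "linear_map (V \<otimes> W) (V' \<otimes> W') (tensor_map V' W' f g)"
proof (rule linear_map_tensorI[OF vspace_tensor])
  fix v w assume vw: "v \<in> carrier V" "w \<in> carrier W"
  then have "f v \<in> carrier V'" "g w \<in> carrier W'"
    using assms by (auto simp: linear_map_def)
  then show "tensor_map V' W' f g (tensor V W v w) \<in> carrier (V' \<otimes> W')"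
    using tensor_map_tensor[OF assms vw] tensor_in_carrier by metis
qed (auto simp: tensor_map_def tensor_scl_def fun_eq_iff)

lemma tensor_mult_tensor:
  assumes "algebra A" "algebra B"
    and "a \<in> carrier A" "b \<in> carrier B" "a' \<in> carrier A" "b' \<in> carrier B"
  shows "tensor_mult A B (tensor A B a b) (tensor A B a' b') = tensor A B (mult A a a') (mult B b b')"
proof -
  have inner: "bilinear_map A B ground (\<lambda>a' b'. \<phi> (mult A a a') (mult B b b'))"
    if "bilinear_map A B ground \<phi>" "a \<in> carrier A" "b \<in> carrier B" for \<phi> a b
    using that assms(1,2) by (auto simp: algebra_def bilinear_map_def linear_map_def)
  have outer: "bilinear_map A B ground (\<lambda>a b. tensor A B a' b' (\<lambda>a' b'. \<phi> (mult A a a') (mult B b b')))"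
    if \<phi>: "bilinear_map A B ground \<phi>" for \<phi>
  proof -
    have "bilinear_map A B ground (\<lambda>a b. \<phi> (mult A a a') (mult B b b'))"
      using \<phi> assms by (auto simp: algebra_def bilinear_map_def linear_map_def)
    moreover have "tensor A B a' b' (\<lambda>a' b'. \<phi> (mult A a a') (mult B b b')) = \<phi> (mult A a a') (mult B b b')"
      if "a \<in> carrier A" "b \<in> carrier B" for a b
      using inner[OF \<phi> that] by (simp add: tensor_def)
    moreover have "vspace A" "vspace B" using assms by (simp_all add: algebra_def)
    ultimately show ?thesis
      by (simp add: bilinear_map_def linear_map_def vspace_subspace)
  qed
  show ?thesis
  proof
    fix \<phi>
    show "tensor_mult A B (tensor A B a b) (tensor A B a' b') \<phi> = tensor A B (mult A a a') (mult B b b') \<phi>"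
      using outer[of \<phi>] inner[of \<phi> a b] assms(3-6)
      by (simp add: tensor_mult_def tensor_def)
  qed
qed

lemma tensor_mult_pure_left:
  assumes A: "algebra A" and B: "algebra B"
    and ab: "a \<in> carrier A" "b \<in> carrier B" and y: "y \<in> carrier (A \<otimes> B)"
  shows "tensor_mult A B (tensor A B a b) y = tensor_map A B (mult A a) (mult B b) y"
proof
  fix \<phi>
  have sub: "vspace A" "vspace B" using A B by (simp_all add: algebra_def)
  have "bilinear_map A B ground (\<lambda>a b. y (\<lambda>a' b'. \<phi> (mult A a a') (mult B b b')))"
    if \<phi>: "bilinear_map A B ground \<phi>"
    using y
  proof (induction rule: tensor_induct)
    case zero
    then show ?case by (simp add: bilinear_map_def linear_map_def)
  next
    case (step c a' b' y)
    have inner: "bilinear_map A B ground (\<lambda>a' b'. \<phi> (mult A a a') (mult B b b'))"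
      if "a \<in> carrier A" "b \<in> carrier B" for a b
      using that \<phi> A B by (auto simp: algebra_def bilinear_map_def linear_map_def)
    have outer: "bilinear_map A B ground (\<lambda>a b. \<phi> (mult A a a') (mult B b b'))"
      using \<phi> A B step(1,2) by (auto simp: algebra_def bilinear_map_def linear_map_def)
    have "tensor A B a' b' (\<lambda>a' b'. \<phi> (mult A a a') (mult B b b')) = \<phi> (mult A a a') (mult B b b')"
      if "a \<in> carrier A" "b \<in> carrier B" for a b
      using inner[OF that] by (simp add: tensor_def)
    then have "bilinear_map A B ground
        (\<lambda>a b. tensor A B a' b' (\<lambda>a' b'. \<phi> (mult A a a') (mult B b b')))"
      using sub outer by (simp add: bilinear_map_def linear_map_def vspace_subspace)
    then show ?case
      using step(4) by (auto simp: bilinear_map_def linear_map_def tensor_scl_def algebra_simps)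
  qed
  then show "tensor_mult A B (tensor A B a b) y \<phi> = tensor_map A B (mult A a) (mult B b) y \<phi>"
    using ab by (simp add: tensor_mult_def tensor_map_def tensor_def)
qed

lemma algebra_tensor:
  assumes A: "algebra A" and B: "algebra B"
  shows "algebra (A \<otimes> B)"
proof -
  let ?T = "A \<otimes> B" and ?m = "tensor_mult A B"
  have lA: "linear_map A A (mult A a)" if "a \<in> carrier A" for a
    using A that by (simp add: algebra_def bilinear_map_def)
  have lB: "linear_map B B (mult B b)" if "b \<in> carrier B" for b
    using B that by (simp add: algebra_def bilinear_map_def)
  have mA: "mult A a a' \<in> carrier A" if "a \<in> carrier A" "a' \<in> carrier A" for a a'
    using lA that by (simp add: linear_map_def)
  have mB: "mult B b b' \<in> carrier B" if "b \<in> carrier B" "b' \<in> carrier B" for b b'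
    using lB that by (simp add: linear_map_def)
  have add: "?m (x + x') y = ?m x y + ?m x' y" and scl: "?m (tensor_scl c x) y = tensor_scl c (?m x y)"
    and m0: "?m 0 y = 0" for x x' y c
    by (auto simp: tensor_mult_def tensor_scl_def fun_eq_iff)
  note sub = vspace_subspace[OF vspace_tensor[of A B], unfolded tensor_alg_simps(2)]
  have pure: "linear_map ?T ?T (?m (tensor A B a b))" if ab: "a \<in> carrier A" "b \<in> carrier B" for a b
    using tensor_map_linear[OF lA lB, OF ab] tensor_mult_pure_left[OF A B ab] sub
    by (simp add: linear_map_def)
  have right: "linear_map ?T ?T (?m x)" if "x \<in> carrier ?T" for x
    using that
  proof (induction rule: tensor_induct)
    case zero
    then show ?case using sub(1) by (simp add: linear_map_def m0 flip: zero_fun_def)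
  next
    case (step c a b y)
    have comb: "linear_map ?T ?T (\<lambda>z. tensor_scl c (f z) + g z)"
      if fg: "linear_map ?T ?T f" "linear_map ?T ?T g" for f g
    proof (rule linear_map_tensorI[OF vspace_tensor])
      fix x y assume "x \<in> carrier ?T" "y \<in> carrier ?T"
      then have "f (x + y) = f x + f y" "g (x + y) = g x + g y"
        using fg unfolding linear_map_def by blast+
      then show "tensor_scl c (f (x + y)) + g (x + y)
          = tensor_scl c (f x) + g x + (tensor_scl c (f y) + g y)"
        by (simp only: tensor_vs.scale_right_distrib add.assoc add.left_commute)
    next
      fix d x assume "x \<in> carrier ?T"
      then have "f (tensor_scl d x) = tensor_scl d (f x)" "g (tensor_scl d x) = tensor_scl d (g x)"
        using fg unfolding linear_map_def tensor_alg_simps by blast+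
      then show "tensor_scl c (f (tensor_scl d x)) + g (tensor_scl d x)
          = scl ?T d (tensor_scl c (f x) + g x)"
        by (simp only: tensor_alg_simps tensor_vs.scale_right_distrib tensor_vs.scale_left_commute[of c d])
    next
      fix a b assume "a \<in> carrier A" "b \<in> carrier B"
      then have "f (tensor A B a b) \<in> carrier ?T" "g (tensor A B a b) \<in> carrier ?T"
        using fg tensor_in_carrier unfolding linear_map_def by blast+
      then show "tensor_scl c (f (tensor A B a b)) + g (tensor A B a b) \<in> carrier ?T"
        using sub by blast
    qed
    show ?case
      using comb[OF pure[OF step(1,2)] step(4)] by (simp only: add scl)
  qed
  then have bil: "bilinear_map ?T ?T ?T ?m"
    by (simp add: bilinear_map_def) (simp add: linear_map_def add scl)
  have closed: "?m x y \<in> carrier ?T" if "x \<in> carrier ?T" "y \<in> carrier ?T" for x y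
    using right that by (simp add: linear_map_def)
  have radd: "?m x (y + z) = ?m x y + ?m x z" and rscl: "?m x (tensor_scl c y) = tensor_scl c (?m x y)"
    if "x \<in> carrier ?T" "y \<in> carrier ?T" "z \<in> carrier ?T" for x y z c
    using right that by (simp_all add: linear_map_def)
  have rzero: "?m x 0 = 0" if "x \<in> carrier ?T" for x
    using rscl[OF that sub(1) sub(1), of 0] by simp
  have sc: "tensor_scl c (tensor A B a b) \<in> carrier ?T" if "a \<in> carrier A" "b \<in> carrier B" for a b c
    using sub(3) tensor_in_carrier that by metis
  have tt: "?m (tensor A B a b) (tensor A B a' b') = tensor A B (mult A a a') (mult B b b')"
    if "a \<in> carrier A" "b \<in> carrier B" "a' \<in> carrier A" "b' \<in> carrier B" for a b a' b'
    using tensor_mult_tensor[OF A B that] .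
  have a3: "?m (?m p q) z = ?m p (?m q z)"
    if p: "p = tensor A B a b" "a \<in> carrier A" "b \<in> carrier B"
      and q: "q = tensor A B a' b'" "a' \<in> carrier A" "b' \<in> carrier B" and z: "z \<in> carrier ?T"
    for p q z a b a' b'
    using z
  proof (induction rule: tensor_induct)
    case zero
    have "p \<in> carrier ?T" "q \<in> carrier ?T" using p q tensor_in_carrier by metis+
    then show ?case using closed rzero by (simp flip: zero_fun_def)
  next
    case (step c a'' b'' y)
    have c: "p \<in> carrier ?T" "q \<in> carrier ?T" using p q tensor_in_carrier by metis+
    let ?t = "tensor A B a'' b''"
    have t: "?t \<in> carrier ?T" using step tensor_in_carrier by metis
    have "?m (?m p q) ?t = ?m p (?m q ?t)"
      using p q step(1,2) A B mA mB by (simp add: tt algebra_def)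
    then have "?m (?m p q) (tensor_scl c ?t + y) = ?m p (?m q (tensor_scl c ?t + y))"
      using step(3,4) c t sc[OF step(1,2)] sub(3) closed by (simp only: radd rscl)
    then show ?case .
  qed
  have a2: "?m (?m p y) z = ?m p (?m y z)"
    if p: "p = tensor A B a b" "a \<in> carrier A" "b \<in> carrier B"
      and y: "y \<in> carrier ?T" and z: "z \<in> carrier ?T"
    for p y z a b
    using y
  proof (induction rule: tensor_induct)
    case zero
    have "p \<in> carrier ?T" using p tensor_in_carrier by metis
    then show ?case using rzero by (simp add: m0 flip: zero_fun_def)
  next
    case (step c a' b' y)
    have c: "p \<in> carrier ?T" using p tensor_in_carrier by metis
    let ?t = "tensor A B a' b'"
    have t: "?t \<in> carrier ?T" using step tensor_in_carrier by metis
    have "?m (?m p ?t) z = ?m p (?m ?t z)"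
      using a3[OF p refl step(1,2) z] .
    then have "?m (?m p (tensor_scl c ?t + y)) z = ?m p (?m (tensor_scl c ?t + y) z)"
      using step(3,4) c t z sc[OF step(1,2)] sub(3) closed by (simp only: radd rscl add scl)
    then show ?case .
  qed
  have "?m (?m x y) z = ?m x (?m y z)"
    if x: "x \<in> carrier ?T" and y: "y \<in> carrier ?T" and z: "z \<in> carrier ?T" for x y z
    using x
  proof (induction rule: tensor_induct)
    case zero
    then show ?case by (simp add: m0 flip: zero_fun_def)
  next
    case (step c a b w)
    have "?m (?m (tensor_scl c (tensor A B a b) + w) y) z
        = ?m (tensor_scl c (tensor A B a b) + w) (?m y z)"
      using a2[OF refl step(1,2) y z] step(4) by (simp only: add scl)
    then show ?case .
  qed
  with bil show ?thesis
    by (simp add: algebra_def vspace_tensor)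
qed

lemma tensor_assoc_form:
  assumes W: "vspace W" and \<phi>: "bilinear_map U (V \<otimes> W) ground \<phi>"
  shows "\<And>u v w. \<lbrakk>u \<in> carrier U; v \<in> carrier V; w \<in> carrier W\<rbrakk>
           \<Longrightarrow> tensor U V u v (\<lambda>u v. \<phi> u (tensor V W v w)) = \<phi> u (tensor V W v w)"
    and "bilinear_map (U \<otimes> V) W ground (\<lambda>t w. t (\<lambda>u v. \<phi> u (tensor V W v w)))" (is ?B)
proof -
  have lin: "linear_map V (V \<otimes> W) (\<lambda>v. tensor V W v w)" if "w \<in> carrier W" for w
    using bilinear_tensor[of V W] that by (simp add: bilinear_map_def)
  have lin2: "linear_map W (V \<otimes> W) (tensor V W v)" if "v \<in> carrier V" for v
    using bilinear_tensor[of V W] that by (simp add: bilinear_map_def)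
  have bil: "bilinear_map U V ground (\<lambda>u v. \<phi> u (tensor V W v w))" if "w \<in> carrier W" for w
    using \<phi> lin[OF that] by (auto simp: bilinear_map_def linear_map_def)
  show A: "tensor U V u v (\<lambda>u v. \<phi> u (tensor V W v w)) = \<phi> u (tensor V W v w)"
    if "w \<in> carrier W" for u v w
    using bil[OF that] by (simp add: tensor_def[of U V])
  have "linear_map W ground (\<lambda>w. t (\<lambda>u v. \<phi> u (tensor V W v w)))" if "t \<in> carrier (U \<otimes> V)" for t
    using that
  proof (induction rule: tensor_induct)
    case zero
    then show ?case by (simp add: linear_map_def)
  next
    case (step c u v t)
    have "linear_map W ground (\<lambda>w. \<phi> u (tensor V W v w))"
      using \<phi> step(1) lin2[OF step(2)] by (auto simp: bilinear_map_def linear_map_def)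
    then have "linear_map W ground (\<lambda>w. tensor U V u v (\<lambda>u v. \<phi> u (tensor V W v w)))"
      using A vspace_subspace[OF W] by (simp add: linear_map_def)
    then show ?case using step(4)
      by (auto simp: linear_map_def tensor_scl_def algebra_simps)
  qed
  then show ?B
    unfolding bilinear_map_def by (auto simp: linear_map_def tensor_scl_def)
qed

lemma tensor_assoc_tensor:
  assumes "vspace W" "u \<in> carrier U" "v \<in> carrier V" "w \<in> carrier W"
  shows "tensor_assoc U V W (tensor (U \<otimes> V) W (tensor U V u v) w) = tensor U (V \<otimes> W) u (tensor V W v w)"
proof
  fix \<phi>
  show "tensor_assoc U V W (tensor (U \<otimes> V) W (tensor U V u v) w) \<phi>
      = tensor U (V \<otimes> W) u (tensor V W v w) \<phi>"
    using tensor_assoc_form[OF assms(1), of U V \<phi>] assms(2-)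
    by (simp add: tensor_assoc_def tensor_def[of "U \<otimes> V"] tensor_def[of _ "V \<otimes> W"])
qed

lemma tensor_assoc_linear:
  assumes "vspace W"
  shows "linear_map ((U \<otimes> V) \<otimes> W) (U \<otimes> (V \<otimes> W)) (tensor_assoc U V W)"
proof (rule linear_map_tensorI[OF vspace_tensor])
  have add: "tensor_assoc U V W (x + y) = tensor_assoc U V W x + tensor_assoc U V W y"
    and scl: "tensor_assoc U V W (tensor_scl c x) = tensor_scl c (tensor_assoc U V W x)" for c x y
    by (auto simp: tensor_assoc_def tensor_scl_def fun_eq_iff)
  then show "tensor_assoc U V W (x + y) = tensor_assoc U V W x + tensor_assoc U V W y"
    and "tensor_assoc U V W (tensor_scl c x) = scl (U \<otimes> (V \<otimes> W)) c (tensor_assoc U V W x)" for c x y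
    by simp_all
  fix t w assume t: "t \<in> carrier (U \<otimes> V)" and w: "w \<in> carrier W"
  note sub = vspace_subspace[OF vspace_tensor[of U "V \<otimes> W"], unfolded tensor_alg_simps(2)]
  note bil = bilinear_tensor[of "U \<otimes> V" W]
  have z: "tensor (U \<otimes> V) W 0 w = 0"
    by (auto simp: tensor_def bilinear_map_def linear_map_def fun_eq_iff w)
      (metis (no_types, lifting) w vspace_subspace(1)[OF vspace_tensor] tensor_alg_simps(1) add_cancel_right_right)
  from t show "tensor_assoc U V W (tensor (U \<otimes> V) W t w) \<in> carrier (U \<otimes> (V \<otimes> W))"
  proof (induction rule: tensor_induct)
    case zero
    have "tensor_assoc U V W 0 = 0" by (auto simp: tensor_assoc_def fun_eq_iff)
    then show ?case using sub(1) z by (simp flip: zero_fun_def)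
  next
    case (step c u v y)
    note t = tensor_in_carrier[OF step(1,2)]
    have t': "tensor_scl c (tensor U V u v) \<in> carrier (U \<otimes> V)"
      using vspace_subspace(3)[OF vspace_tensor t, of c] by simp
    have l: "linear_map (U \<otimes> V) ((U \<otimes> V) \<otimes> W) (\<lambda>t. tensor (U \<otimes> V) W t w)"
      using bil w by (simp add: bilinear_map_def)
    have "tensor (U \<otimes> V) W (tensor_scl c (tensor U V u v) + y) w
        = tensor_scl c (tensor (U \<otimes> V) W (tensor U V u v) w) + tensor (U \<otimes> V) W y w"
      using l t t' step(3) unfolding linear_map_def tensor_alg_simps by metis
    then have "tensor_assoc U V W (tensor (U \<otimes> V) W (tensor_scl c (tensor U V u v) + y) w)
        = tensor_scl c (tensor U (V \<otimes> W) u (tensor V W v w)) + tensor_assoc U V W (tensor (U \<otimes> V) W y w)"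
      by (simp only: add scl tensor_assoc_tensor[OF assms step(1,2) w])
    then show ?case
      using sub step tensor_in_carrier w by metis
  qed
qed

section \<open>Hopf algebras\<close>

record ('k, 'h) hopf = "('k, 'h) ualg" +
  comult :: "'h \<Rightarrow> ('k, 'h, 'h) tensor"
  counit :: "'h \<Rightarrow> 'k"
  antipode :: "'h \<Rightarrow> 'h"

text \<open>
  Throughout, the canonical identifications of the tensor product of a space \<open>V\<close> with the base
  field with \<open>V\<close> are made explicit by comparing with \<open>x \<otimes> 1\<close> or \<open>1 \<otimes> x\<close>, and iterated tensor
  products are compared in right-nested form, via \<^const>\<open>tensor_assoc\<close>.
\<close>

definition hopf_algebra :: "('k::field, 'h::ab_group_add) hopf \<Rightarrow> bool" where
  "hopf_algebra H \<longleftrightarrow>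
     unital_algebra H \<and>
     alg_hom H (H \<otimes> H) (comult H) \<and> comult H (one H) = tensor H H (one H) (one H) \<and>
     alg_hom H ground (counit H) \<and> counit H (one H) = 1 \<and>
     (\<forall>h\<in>carrier H.
        tensor_assoc H H H (tensor_map (H \<otimes> H) H (comult H) id (comult H h))
          = tensor_map H (H \<otimes> H) id (comult H) (comult H h)) \<and>
     (\<forall>h\<in>carrier H. tensor_map ground H (counit H) id (comult H h) = tensor ground H 1 h) \<and>
     (\<forall>h\<in>carrier H. tensor_map H ground id (counit H) (comult H h) = tensor H ground h 1) \<and>
     linear_map H H (antipode H) \<and>
     (\<forall>h\<in>carrier H. tensor_lift H H H (mult H) (tensor_map H H (antipode H) id (comult H h))
          = scl H (counit H h) (one H)) \<and>
     (\<forall>h\<in>carrier H. tensor_lift H H H (mult H) (tensor_map H H id (antipode H) (comult H h))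
          = scl H (counit H h) (one H))"


section \<open>Partial and global bicomodule algebras\<close>

definition right_partial_comodule_algebra ::
  "('k::field, 'h::ab_group_add) hopf \<Rightarrow> ('k, 'a::ab_group_add) ualg
    \<Rightarrow> ('a \<Rightarrow> ('k, 'a, 'h) tensor) \<Rightarrow> bool" where
  "right_partial_comodule_algebra H A rho \<longleftrightarrow>
     unital_algebra A \<and> alg_hom A (A \<otimes> H) rho \<and>
     (\<forall>a\<in>carrier A. tensor_map A ground id (counit H) (rho a) = tensor A ground a 1) \<and>
     (\<forall>a\<in>carrier A.
        tensor_assoc A H H (tensor_map (A \<otimes> H) H rho id (rho a))
          = mult (A \<otimes> (H \<otimes> H))
              (tensor_assoc A H H (tensor (A \<otimes> H) H (rho (one A)) (one H)))
              (tensor_map A (H \<otimes> H) id (comult H) (rho a)))"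

definition left_partial_comodule_algebra ::
  "('k::field, 'h::ab_group_add) hopf \<Rightarrow> ('k, 'a::ab_group_add) ualg
    \<Rightarrow> ('a \<Rightarrow> ('k, 'h, 'a) tensor) \<Rightarrow> bool" where
  "left_partial_comodule_algebra H A lam \<longleftrightarrow>
     unital_algebra A \<and> alg_hom A (H \<otimes> A) lam \<and>
     (\<forall>a\<in>carrier A. tensor_map ground A (counit H) id (lam a) = tensor ground A 1 a) \<and>
     (\<forall>a\<in>carrier A.
        tensor_map H (H \<otimes> A) id lam (lam a)
          = mult (H \<otimes> (H \<otimes> A))
              (tensor_assoc H H A (tensor_map (H \<otimes> H) A (comult H) id (lam a)))
              (tensor H (H \<otimes> A) (one H) (lam (one A))))"

definition partial_bicomodule_algebra ::
  "('k::field, 'h::ab_group_add) hopf \<Rightarrow> ('a \<Rightarrow> ('k, 'h, 'a) tensor)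
    \<Rightarrow> ('k, 'a::ab_group_add) ualg \<Rightarrow> ('a \<Rightarrow> ('k, 'a, 'h) tensor) \<Rightarrow> bool" where
  "partial_bicomodule_algebra H lam A rho \<longleftrightarrow>
     left_partial_comodule_algebra H A lam \<and> right_partial_comodule_algebra H A rho \<and>
     (\<forall>a\<in>carrier A.
        tensor_map H (A \<otimes> H) id rho (lam a)
          = tensor_assoc H A H (tensor_map (H \<otimes> A) H lam id (rho a)))"

definition bicomodule_algebra ::
  "('k::field, 'h::ab_group_add) hopf \<Rightarrow> ('b \<Rightarrow> ('k, 'h, 'b) tensor)
    \<Rightarrow> ('k, 'b::ab_group_add) alg \<Rightarrow> ('b \<Rightarrow> ('k, 'b, 'h) tensor) \<Rightarrow> bool" where
  "bicomodule_algebra H lam B rho \<longleftrightarrow>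
     algebra B \<and> alg_hom B (B \<otimes> H) rho \<and> alg_hom B (H \<otimes> B) lam \<and>
     (\<forall>b\<in>carrier B. tensor_map B ground id (counit H) (rho b) = tensor B ground b 1) \<and>
     (\<forall>b\<in>carrier B.
        tensor_assoc B H H (tensor_map (B \<otimes> H) H rho id (rho b))
          = tensor_map B (H \<otimes> H) id (comult H) (rho b)) \<and>
     (\<forall>b\<in>carrier B. tensor_map ground B (counit H) id (lam b) = tensor ground B 1 b) \<and>
     (\<forall>b\<in>carrier B.
        tensor_map H (H \<otimes> B) id lam (lam b)
          = tensor_assoc H H B (tensor_map (H \<otimes> H) B (comult H) id (lam b))) \<and>
     (\<forall>b\<in>carrier B.
        tensor_map H (B \<otimes> H) id rho (lam b)
          = tensor_assoc H B H (tensor_map (H \<otimes> B) H lam id (rho b)))"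

definition globalization ::
  "('k::field, 'h::ab_group_add) hopf \<Rightarrow> ('a \<Rightarrow> ('k, 'h, 'a) tensor)
    \<Rightarrow> ('k, 'a::ab_group_add) ualg \<Rightarrow> ('a \<Rightarrow> ('k, 'a, 'h) tensor)
    \<Rightarrow> ('b \<Rightarrow> ('k, 'h, 'b) tensor) \<Rightarrow> ('k, 'b::ab_group_add) alg
    \<Rightarrow> ('b \<Rightarrow> ('k, 'b, 'h) tensor) \<Rightarrow> ('a \<Rightarrow> 'b) \<Rightarrow> bool" where
  "globalization H lamA A rhoA lamB B rhoB \<theta> \<longleftrightarrow>
     bicomodule_algebra H lamB B rhoB \<and>
     alg_hom A B \<theta> \<and> inj_on \<theta> (carrier A) \<and>
     (\<forall>M. subalgebra B M \<and> \<theta> ` carrier A \<subseteq> M \<and>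
          rhoB ` M \<subseteq> tensor_span B H M (carrier H) \<and>
          lamB ` M \<subseteq> tensor_span H B (carrier H) M \<longrightarrow> M = carrier B) \<and>
     (\<forall>a\<in>carrier A. \<forall>b\<in>carrier A.
        mult (H \<otimes> (B \<otimes> H))
          (tensor_assoc H B H (tensor (H \<otimes> B) H (lamB (\<theta> a)) (one H)))
          (tensor H (B \<otimes> H) (one H) (rhoB (\<theta> b)))
        = tensor_map H (B \<otimes> H) id (tensor_map B H \<theta> id)
            (mult (H \<otimes> (A \<otimes> H))
               (tensor_assoc H A H (tensor (H \<otimes> A) H (lamA a) (one H)))
               (tensor H (A \<otimes> H) (one H) (rhoA b))))"

end

theory Submission
  imports Defs
begin

text \<open>
  Let \<open>F = H \<otimes> A \<otimes> H\<close>. Comultiplication on the left, respectively right, copy of \<open>H\<close> makes \<open>F\<close> a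
  global bicomodule algebra. The two coactions \<open>\<lambda>\<close> and \<open>\<rho>\<close> of \<open>A\<close> give one algebra homomorphism
  \<open>\<theta> = (I \<otimes> \<rho>)\<lambda> = (\<lambda> \<otimes> I)\<rho>\<close> from \<open>A\<close> to \<open>F\<close>, which is injective by the counit axioms. Let \<open>B\<close> be
  the intersection of all subalgebras of \<open>F\<close> that contain \<open>\<theta>(A)\<close> and are stable under both
  coactions. Then \<open>B\<close>, with the restricted coactions, and \<open>\<theta>\<close> form a globalization.

  Two points need an argument. The first is that the intersection is stable. Over a field, a tensor
  \<open>x\<close> in \<open>V \<otimes> W\<close> lies in \<open>M \<otimes> W\<close> if and only if \<open>(I \<otimes> f)x\<close> lies in \<open>M\<close> for every linear functional
  \<open>f\<close> on \<open>W\<close> (\<open>mem_tensor_span_iff_slices\<close>), and a condition of this form passes to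
  intersections. A linear projection of \<open>F\<close> onto \<open>B\<close> shows that tensor products of \<open>B\<close> embed into
  those of \<open>F\<close>, so that all axioms for \<open>B\<close> follow from those for \<open>F\<close>.

  The second is the compatibility condition between \<open>\<theta>\<close> and the coactions (\<open>emb_condition\<close>).
  Write \<open>\<lambda>\<^sub>F\<close> and \<open>\<rho>\<^sub>F\<close> for the coactions of \<open>F\<close>. The partial coassociativity axioms give
  \<open>(I \<otimes> \<theta>)\<lambda>(a) = \<lambda>\<^sub>F(\<theta>(a)) (1 \<otimes> \<theta>(1))\<close> and \<open>(\<theta> \<otimes> I)\<rho>(b) = (\<theta>(1) \<otimes> 1) \<rho>\<^sub>F(\<theta>(b))\<close>. Hence one side of
  the condition is \<open>(\<lambda>\<^sub>F(\<theta>(a)) \<otimes> 1)(1 \<otimes> \<rho>\<^sub>F(\<theta>(b)))\<close> and the other side is the same product with the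
  idempotent \<open>1 \<otimes> \<theta>(1) \<otimes> 1\<close> in the middle. On the other hand \<open>\<lambda>\<^sub>F(\<theta>(a))\<close> is fixed by right
  multiplication with \<open>1 \<otimes> 1 \<otimes> \<rho>(1)\<close> and \<open>\<rho>\<^sub>F(\<theta>(b))\<close> by left multiplication with
  \<open>\<lambda>(1) \<otimes> 1 \<otimes> 1\<close>. So it remains to see that \<open>\<theta>(1) = (1 \<otimes> \<rho>(1))(\<lambda>(1) \<otimes> 1)\<close> (\<open>emb_one\<close>). This is
  where the antipode \<open>S\<close> enters: writing \<open>\<lambda>(b)\<close> as a sum of tensors \<open>b' \<otimes> b''\<close>, partial
  coassociativity yields that \<open>(1 \<otimes> b) \<lambda>(1)\<close> is the sum of the \<open>(S(b') \<otimes> 1) \<lambda>(b'')\<close>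
  (\<open>antipode_mult_lam\<close>), and applying this to the first factors of \<open>\<rho>(1)\<close> and then to \<open>b = 1\<close>
  proves the identity.
\<close>

text \<open>
  The carrier and the multiplication of a tensor product stay folded, so that the rules below see
  the shape \<open>V \<otimes> W\<close>.
\<close>

declare tensor_alg_simps(1,3) [simp del]

section \<open>Linear maps on tensor products\<close>

lemma linear_mapD:
  assumes "linear_map V W f"
  shows "x \<in> carrier V \<Longrightarrow> f x \<in> carrier W"
    and "x \<in> carrier V \<Longrightarrow> y \<in> carrier V \<Longrightarrow> f (x + y) = f x + f y"
    and "x \<in> carrier V \<Longrightarrow> f (scl V c x) = scl W c (f x)"
  using assms by (auto simp: linear_map_def)

lemma linear_map_cong:
  assumes "\<And>x. x \<in> carrier V \<Longrightarrow> f x = g x" "vspace V"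
  shows "linear_map V W f \<longleftrightarrow> linear_map V W g"
  using assms vspace_subspace[OF assms(2)] by (simp add: linear_map_def)

lemma algebra_vspace: "algebra V \<Longrightarrow> vspace V"
  by (simp add: algebra_def)

lemma algebra_mult_assoc:
  assumes "algebra V" "x \<in> carrier V" "y \<in> carrier V" "z \<in> carrier V"
  shows "mult V (mult V x y) z = mult V x (mult V y z)"
  using assms by (simp add: algebra_def)

lemma vspace_ground: "vspace (ground :: ('k::field, 'k) ualg)"
proof -
  interpret vector_space "(*) :: 'k \<Rightarrow> 'k \<Rightarrow> 'k" by standard (auto simp: algebra_simps)
  show ?thesis by (simp add: vspace_def) (rule vector_space_axioms)
qed

text \<open>
  Membership in carriers and linearity in an argument are decided by the shape of a term. The
  collection \<open>lin\<close> has the introduction rules for this, to be used by resolution since some of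
  their premises mention spaces that are absent from the conclusion. The collection \<open>wf\<close> has facts
  of this kind that are suitable as conditional rewrite rules, and \<open>pure\<close> the values of the various
  maps on pure tensors.
\<close>

named_theorems lin
named_theorems wf
named_theorems pure

declare vspace_tensor [lin, wf] algebra_vspace [lin, wf] algebra_tensor [lin, wf]
  vspace_ground [lin, wf] tensor_in_carrier [lin, wf] tensor_map_linear [wf]
  tensor_assoc_linear [wf]

lemma lin_ident [lin, wf]: "linear_map V V (\<lambda>x. x)"
  by (simp add: linear_map_def)

lemma lin_id [lin, wf]: "linear_map V V id"
  by (simp add: linear_map_def)

lemma lin_comp: "linear_map V W g \<Longrightarrow> linear_map U V f \<Longrightarrow> linear_map U W (\<lambda>u. g (f u))"
  by (auto simp: linear_map_def)

lemma tensor_linear: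
  "w \<in> carrier W \<Longrightarrow> linear_map V (V \<otimes> W) (\<lambda>v. tensor V W v w)"
  "v \<in> carrier V \<Longrightarrow> linear_map W (V \<otimes> W) (tensor V W v)"
  using bilinear_tensor[of V W] by (simp_all add: bilinear_map_def)

lemma lin_tensor_left [lin]:
  "linear_map U V f \<Longrightarrow> w \<in> carrier W \<Longrightarrow> linear_map U (V \<otimes> W) (\<lambda>u. tensor V W (f u) w)"
  by (rule lin_comp[OF tensor_linear(1)])

lemma lin_tensor_right [lin]:
  "linear_map U W f \<Longrightarrow> v \<in> carrier V \<Longrightarrow> linear_map U (V \<otimes> W) (\<lambda>u. tensor V W v (f u))"
  by (rule lin_comp[OF tensor_linear(2)])

lemma lin_tensor_map [lin]:
  "linear_map U (V \<otimes> W) h \<Longrightarrow> linear_map V V' f \<Longrightarrow> linear_map W W' g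
    \<Longrightarrow> linear_map U (V' \<otimes> W') (\<lambda>u. tensor_map V' W' f g (h u))"
  by (rule lin_comp[OF tensor_map_linear])

lemma mem_tensor_map [lin]:
  "x \<in> carrier (V \<otimes> W) \<Longrightarrow> linear_map V V' f \<Longrightarrow> linear_map W W' g
    \<Longrightarrow> tensor_map V' W' f g x \<in> carrier (V' \<otimes> W')"
  by (rule linear_mapD(1)[OF tensor_map_linear])

lemma lin_tensor_assoc [lin]:
  "linear_map Z ((U \<otimes> V) \<otimes> W) h \<Longrightarrow> vspace W
    \<Longrightarrow> linear_map Z (U \<otimes> (V \<otimes> W)) (\<lambda>z. tensor_assoc U V W (h z))"
  by (rule lin_comp[OF tensor_assoc_linear])

lemma mem_tensor_assoc [lin]:
  "x \<in> carrier ((U \<otimes> V) \<otimes> W) \<Longrightarrow> vspace W \<Longrightarrow> tensor_assoc U V W x \<in> carrier (U \<otimes> (V \<otimes> W))"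
  by (rule linear_mapD(1)[OF tensor_assoc_linear])

lemma mult_linear:
  assumes "algebra V" "y \<in> carrier V"
  shows "linear_map V V (\<lambda>x. mult V x y)" "linear_map V V (mult V y)"
  using assms by (simp_all add: algebra_def bilinear_map_def)

lemma lin_mult_left [lin]:
  "algebra V \<Longrightarrow> linear_map U V f \<Longrightarrow> y \<in> carrier V \<Longrightarrow> linear_map U V (\<lambda>u. mult V (f u) y)"
  by (rule lin_comp[OF mult_linear(1)])

lemma lin_mult_right [lin]:
  "algebra V \<Longrightarrow> linear_map U V f \<Longrightarrow> y \<in> carrier V \<Longrightarrow> linear_map U V (\<lambda>u. mult V y (f u))"
  by (rule lin_comp[OF mult_linear(2)])

lemma mem_mult [lin, wf]:
  "algebra V \<Longrightarrow> x \<in> carrier V \<Longrightarrow> y \<in> carrier V \<Longrightarrow> mult V x y \<in> carrier V"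
  by (auto simp: algebra_def bilinear_map_def linear_map_def)

declare tensor_map_tensor [pure] tensor_assoc_tensor [pure]

lemma mult_tensor [pure]:
  assumes "algebra V" "algebra W" "v \<in> carrier V" "w \<in> carrier W" "v' \<in> carrier V" "w' \<in> carrier W"
  shows "mult (V \<otimes> W) (tensor V W v w) (tensor V W v' w') = tensor V W (mult V v v') (mult W w w')"
  using tensor_mult_tensor[OF assms] by (simp add: tensor_alg_simps(3))

lemma scl_tensor_left:
  fixes V :: "('k::field, 'v::ab_group_add, 'm) alg_scheme"
    and W :: "('k, 'w::ab_group_add, 'n) alg_scheme"
  assumes "v \<in> carrier V" "w \<in> carrier W"
  shows "tensor V W (scl V c v) w = tensor_scl c (tensor V W v w)"
  using linear_mapD(3)[OF lin_tensor_left[OF lin_ident assms(2)] assms(1)] by simp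

lemma scl_tensor_right:
  fixes V :: "('k::field, 'v::ab_group_add, 'm) alg_scheme"
    and W :: "('k, 'w::ab_group_add, 'n) alg_scheme"
  assumes "v \<in> carrier V" "w \<in> carrier W"
  shows "tensor V W v (scl W c w) = tensor_scl c (tensor V W v w)"
  using linear_mapD(3)[OF lin_tensor_right[OF lin_ident assms(1)] assms(2)] by simp

text \<open>
  Linear maps on a tensor product that agree on pure tensors agree. Quantifying over the argument
  leaves only one way to read a goal as an equation between values of two maps.
\<close>

lemma tensor_eqI:
  assumes "linear_map (V \<otimes> W) X f" "linear_map (V \<otimes> W) X g" "vspace X"
    and "\<And>v w. v \<in> carrier V \<Longrightarrow> w \<in> carrier W \<Longrightarrow> f (tensor V W v w) = g (tensor V W v w)"
  shows "\<forall>x\<in>carrier (V \<otimes> W). f x = g x"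
  using linear_map_tensor_eqI[OF assms] by blast

lemma mem_ground [lin, wf]: "c \<in> carrier ground"
  by simp

lemma linear_map_0:
  assumes "linear_map V W f" "vspace V" "vspace W"
  shows "f 0 = 0"
proof -
  interpret V: vector_space "scl V" using assms by (simp add: vspace_def)
  interpret W: vector_space "scl W" using assms by (simp add: vspace_def)
  have "f (scl V 0 0) = scl W 0 (f 0)"
    using linear_mapD(3)[OF assms(1) vspace_subspace(1)[OF assms(2)]] .
  then show ?thesis by simp
qed

lemma linear_map_comb:
  assumes "linear_map U V f" "linear_map U V g" "vspace V"
  shows "linear_map U V (\<lambda>u. scl V c (f u) + g u)"
proof -
  interpret V: vector_space "scl V" using assms by (simp add: vspace_def)
  show ?thesis using assms vspace_subspace[OF assms(3)]
    by (simp add: linear_map_def V.scale_right_distrib V.scale_left_commute algebra_simps)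
qed

lemma linear_map_zero: "vspace V \<Longrightarrow> linear_map U V (\<lambda>u. 0)"
proof -
  assume V: "vspace V"
  interpret V: vector_space "scl V" using V by (simp add: vspace_def)
  show ?thesis using vspace_subspace[OF V] by (simp add: linear_map_def)
qed

lemma linear_map_sum:
  assumes "linear_map U V h" "vspace U" "vspace V" "finite I" "\<And>i. i \<in> I \<Longrightarrow> x i \<in> carrier U"
  shows "h (\<Sum>i\<in>I. x i) = (\<Sum>i\<in>I. h (x i)) \<and> (\<Sum>i\<in>I. x i) \<in> carrier U"
  using assms(4,5)
proof (induction I rule: finite_induct)
  case empty
  then show ?case using linear_map_0[OF assms(1-3)] vspace_subspace(1)[OF assms(2)] by simp
next
  case (insert i I)
  then show ?case using linear_mapD(2)[OF assms(1)] vspace_subspace(2)[OF assms(2)] by simp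
qed

lemma linear_map_sum_fun:
  assumes "vspace V" "finite I" "\<And>i. i \<in> I \<Longrightarrow> linear_map U V (f i)"
  shows "linear_map U V (\<lambda>u. \<Sum>i\<in>I. f i u)"
  using assms(2,3)
proof (induction I rule: finite_induct)
  case empty
  then show ?case using linear_map_zero[OF assms(1)] by simp
next
  case (insert i I)
  interpret V: vector_space "scl V" using assms(1) by (simp add: vspace_def)
  show ?case using linear_map_comb[of U V "f i" "\<lambda>u. \<Sum>i\<in>I. f i u" 1] insert assms(1) by simp
qed

text \<open>Linearity in a parameter may be checked on pure tensors.\<close>

lemma linear_map_parameter:
  assumes U: "vspace U" and X: "vspace X" and t: "t \<in> carrier (V \<otimes> W)"
    and g: "\<And>u. u \<in> carrier U \<Longrightarrow> linear_map (V \<otimes> W) X (g u)"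
    and pure: "\<And>v w. v \<in> carrier V \<Longrightarrow> w \<in> carrier W \<Longrightarrow> linear_map U X (\<lambda>u. g u (tensor V W v w))"
  shows "linear_map U X (\<lambda>u. g u t)"
  using t
proof (induction rule: tensor_induct)
  case zero
  have "g u 0 = 0" if "u \<in> carrier U" for u
    by (rule linear_map_0[OF g[OF that] vspace_tensor X])
  then have "linear_map U X (\<lambda>u. g u 0) \<longleftrightarrow> linear_map U X (\<lambda>u. 0)"
    by (intro linear_map_cong U)
  then show ?case using linear_map_zero[OF X] by blast
next
  case (step c v w y)
  have t: "tensor V W v w \<in> carrier (V \<otimes> W)" by (rule tensor_in_carrier) fact+
  then have t': "tensor_scl c (tensor V W v w) \<in> carrier (V \<otimes> W)"
    using vspace_subspace(3)[OF vspace_tensor] by fastforce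
  have "g u (tensor_scl c (tensor V W v w) + y) = scl X c (g u (tensor V W v w)) + g u y"
    if "u \<in> carrier U" for u
    using linear_mapD(2)[OF g[OF that] t' step(3)] linear_mapD(3)[OF g[OF that] t, of c] by simp
  then have "linear_map U X (\<lambda>u. g u (tensor_scl c (tensor V W v w) + y)) \<longleftrightarrow>
      linear_map U X (\<lambda>u. scl X c (g u (tensor V W v w)) + g u y)"
    by (intro linear_map_cong U)
  then show ?case using linear_map_comb[OF pure[OF step(1,2)] step(4) X] by blast
qed

lemma bilinear_map_tensorI:
  assumes "vspace U" "vspace X" "\<And>u. u \<in> carrier U \<Longrightarrow> linear_map (V \<otimes> W) X (g u)"
    and "\<And>v w. v \<in> carrier V \<Longrightarrow> w \<in> carrier W \<Longrightarrow> linear_map U X (\<lambda>u. g u (tensor V W v w))"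
  shows "bilinear_map U (V \<otimes> W) X g"
  using assms linear_map_parameter[of U X _ V W g] by (simp add: bilinear_map_def)

lemma tensor_map_comp:
  assumes "linear_map V' V'' f'" "linear_map W' W'' g'"
  shows "tensor_map V'' W'' f' g' (tensor_map V' W' f g x)
    = tensor_map V'' W'' (\<lambda>v. f' (f v)) (\<lambda>w. g' (g w)) x"
proof -
  have "bilinear_map V' W' ground (\<lambda>v w. \<phi> (f' v) (g' w))" if "bilinear_map V'' W'' ground \<phi>" for \<phi>
    using that assms by (auto simp: bilinear_map_def linear_map_def)
  then show ?thesis by (auto simp: tensor_map_def)
qed

lemma tensor_map_cong:
  fixes V' :: "('k::field, 'v::ab_group_add, 'm) alg_scheme"
    and W' :: "('k, 'w::ab_group_add, 'n) alg_scheme"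
  assumes "x \<in> carrier (V \<otimes> W)" "linear_map V V' f" "linear_map W W' g"
    "\<And>v. v \<in> carrier V \<Longrightarrow> f v = f' v" "\<And>w. w \<in> carrier W \<Longrightarrow> g w = g' w" "vspace V" "vspace W"
  shows "tensor_map V' W' f g x = tensor_map V' W' f' g' x"
proof (rule linear_map_tensor_eqI[OF _ _ _ _ assms(1)])
  have f': "linear_map V V' f'" "linear_map W W' g'"
    using assms(2-) linear_map_cong by metis+
  show "linear_map (V \<otimes> W) (V' \<otimes> W') (tensor_map V' W' f g)"
    "linear_map (V \<otimes> W) (V' \<otimes> W') (tensor_map V' W' f' g')"
    by (rule tensor_map_linear; fact)+
  show "tensor_map V' W' f g (tensor V W v w) = tensor_map V' W' f' g' (tensor V W v w)"
    if "v \<in> carrier V" "w \<in> carrier W" for v w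
    using that assms(2-5) f' by (simp add: pure)
qed (rule vspace_tensor)

lemma tensor_map_ident:
  assumes "x \<in> carrier (V \<otimes> W)"
  shows "tensor_map V W (\<lambda>v. v) (\<lambda>w. w) x = x"
proof (rule linear_map_tensor_eqI[OF _ _ _ _ assms])
  show "tensor_map V W (\<lambda>v. v) (\<lambda>w. w) (tensor V W v w) = tensor V W v w"
    if "v \<in> carrier V" "w \<in> carrier W" for v w
    using that by (simp add: pure wf)
qed (rule lin)+

text \<open>Tensor products of split injections are injective.\<close>

lemma tensor_map_inj:
  fixes V :: "('k::field, 'v::ab_group_add, 'm) alg_scheme"
    and W :: "('k, 'w::ab_group_add, 'n) alg_scheme"
  assumes "linear_map V V' f" "linear_map V' V f'" "\<And>v. v \<in> carrier V \<Longrightarrow> f' (f v) = v"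
    and "linear_map W W' g" "linear_map W' W g'" "\<And>w. w \<in> carrier W \<Longrightarrow> g' (g w) = w"
    and "vspace V" "vspace W"
  shows "inj_on (tensor_map V' W' f g) (carrier (V \<otimes> W))"
proof (rule inj_on_inverseI)
  fix x assume x: "x \<in> carrier (V \<otimes> W)"
  have "tensor_map V W f' g' (tensor_map V' W' f g x) = tensor_map V W (\<lambda>v. f' (f v)) (\<lambda>w. g' (g w)) x"
    by (rule tensor_map_comp) fact+
  also have "\<dots> = tensor_map V W (\<lambda>v. v) (\<lambda>w. w) x"
    by (rule tensor_map_cong[OF x]) (use assms in \<open>auto intro: lin_comp\<close>)
  also have "\<dots> = x" by (rule tensor_map_ident[OF x])
  finally show "tensor_map V W f' g' (tensor_map V' W' f g x) = x" .
qed

lemma tensor_assoc_natural: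
  assumes x: "x \<in> carrier ((U \<otimes> V) \<otimes> W)" and W [lin, wf]: "vspace W" "vspace W'"
    and lf [lin, wf]: "linear_map U U' f" "linear_map V V' g" "linear_map W W' h"
  shows "tensor_assoc U' V' W' (tensor_map (U' \<otimes> V') W' (tensor_map U' V' f g) h x)
    = tensor_map U' (V' \<otimes> W') f (tensor_map V' W' g h) (tensor_assoc U V W x)"
proof (rule linear_map_tensor_eqI[OF _ _ _ _ x])
  fix t w assume t: "t \<in> carrier (U \<otimes> V)" and w [lin, wf]: "w \<in> carrier W"
  have h: "h w \<in> carrier W'" using w linear_mapD(1) lf by metis
  note h [lin, wf]
  show "tensor_assoc U' V' W' (tensor_map (U' \<otimes> V') W' (tensor_map U' V' f g) h (tensor (U \<otimes> V) W t w))
    = tensor_map U' (V' \<otimes> W') f (tensor_map V' W' g h) (tensor_assoc U V W (tensor (U \<otimes> V) W t w))"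
  proof (rule linear_map_tensor_eqI[OF _ _ _ _ t])
    fix u v assume uv [lin, wf]: "u \<in> carrier U" "v \<in> carrier V"
    have "f u \<in> carrier U'" "g v \<in> carrier V'" using uv linear_mapD(1) lf by metis+
    note this [lin, wf]
    show "tensor_assoc U' V' W' (tensor_map (U' \<otimes> V') W' (tensor_map U' V' f g) h
        (tensor (U \<otimes> V) W (tensor U V u v) w))
      = tensor_map U' (V' \<otimes> W') f (tensor_map V' W' g h) (tensor_assoc U V W
        (tensor (U \<otimes> V) W (tensor U V u v) w))"
      by (simp add: pure wf)
  qed (rule lin)+
qed (rule lin)+

subsection \<open>The inverse of the associativity isomorphism\<close>

text \<open>
  The map from \<open>U \<otimes> (V \<otimes> W)\<close> to \<open>(U \<otimes> V) \<otimes> W\<close>, obtained from the universal property of the two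
  tensor products one after the other.
\<close>

definition tensor_assoc_inv ::
  "('k::field, 'u::ab_group_add, 'm) alg_scheme \<Rightarrow> ('k, 'v::ab_group_add, 'n) alg_scheme
    \<Rightarrow> ('k, 'w::ab_group_add, 'o) alg_scheme
    \<Rightarrow> ('k, 'u, ('k, 'v, 'w) tensor) tensor \<Rightarrow> ('k, ('k, 'u, 'v) tensor, 'w) tensor" where
  "tensor_assoc_inv U V W = tensor_lift U (V \<otimes> W) ((U \<otimes> V) \<otimes> W)
     (\<lambda>u. tensor_lift V W ((U \<otimes> V) \<otimes> W) (\<lambda>v w. tensor (U \<otimes> V) W (tensor U V u v) w))"

context
  fixes U :: "('k::field, 'u::ab_group_add, 'm) alg_scheme"
    and V :: "('k, 'v::ab_group_add, 'n) alg_scheme"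
    and W :: "('k, 'w::ab_group_add, 'o) alg_scheme"
  assumes U [lin, wf]: "vspace U"
begin

lemma tensor_assoc_inv_inner:
  "u \<in> carrier U \<Longrightarrow> bilinear_map V W ((U \<otimes> V) \<otimes> W) (\<lambda>v w. tensor (U \<otimes> V) W (tensor U V u v) w)"
  unfolding bilinear_map_def by (intro conjI ballI; (assumption | rule lin)+)

lemma tensor_assoc_inv_outer:
  "bilinear_map U (V \<otimes> W) ((U \<otimes> V) \<otimes> W)
     (\<lambda>u. tensor_lift V W ((U \<otimes> V) \<otimes> W) (\<lambda>v w. tensor (U \<otimes> V) W (tensor U V u v) w))"
proof (rule bilinear_map_tensorI[OF U vspace_tensor])
  fix u assume "u \<in> carrier U"
  note tensor_lift(1)[OF vspace_tensor tensor_assoc_inv_inner[OF this]]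
  then show "linear_map (V \<otimes> W) ((U \<otimes> V) \<otimes> W)
     (tensor_lift V W ((U \<otimes> V) \<otimes> W) (\<lambda>v w. tensor (U \<otimes> V) W (tensor U V u v) w))" .
next
  fix v w assume vw: "v \<in> carrier V" "w \<in> carrier W"
  have "linear_map U ((U \<otimes> V) \<otimes> W) (\<lambda>u. tensor (U \<otimes> V) W (tensor U V u v) w)"
    using vw by - (assumption | rule lin)+
  then show "linear_map U ((U \<otimes> V) \<otimes> W) (\<lambda>u. tensor_lift V W ((U \<otimes> V) \<otimes> W)
      (\<lambda>v w. tensor (U \<otimes> V) W (tensor U V u v) w) (tensor V W v w))"
    using tensor_lift(2)[OF vspace_tensor tensor_assoc_inv_inner vw] U
    by (subst linear_map_cong) auto
qed

lemma tensor_assoc_inv_linear: "linear_map (U \<otimes> (V \<otimes> W)) ((U \<otimes> V) \<otimes> W) (tensor_assoc_inv U V W)"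
  unfolding tensor_assoc_inv_def
  by (rule tensor_lift(1)[OF vspace_tensor tensor_assoc_inv_outer])

lemma tensor_assoc_inv_tensor:
  assumes "u \<in> carrier U" "v \<in> carrier V" "w \<in> carrier W"
  shows "tensor_assoc_inv U V W (tensor U (V \<otimes> W) u (tensor V W v w))
      = tensor (U \<otimes> V) W (tensor U V u v) w"
  unfolding tensor_assoc_inv_def
  using assms tensor_lift(2)[OF vspace_tensor tensor_assoc_inv_outer, of u "tensor V W v w"]
    tensor_lift(2)[OF vspace_tensor tensor_assoc_inv_inner, of u v w]
  by (simp add: wf)

end

declare tensor_assoc_inv_tensor [pure] tensor_assoc_inv_linear [wf]

lemma lin_tensor_assoc_inv [lin]:
  "linear_map Z (U \<otimes> (V \<otimes> W)) h \<Longrightarrow> vspace U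
    \<Longrightarrow> linear_map Z ((U \<otimes> V) \<otimes> W) (\<lambda>z. tensor_assoc_inv U V W (h z))"
  by (rule lin_comp[OF tensor_assoc_inv_linear])

lemma mem_tensor_assoc_inv [lin]:
  "x \<in> carrier (U \<otimes> (V \<otimes> W)) \<Longrightarrow> vspace U \<Longrightarrow> tensor_assoc_inv U V W x \<in> carrier ((U \<otimes> V) \<otimes> W)"
  by (rule linear_mapD(1)[OF tensor_assoc_inv_linear])

lemma tensor_assoc_inv_assoc:
  assumes x: "x \<in> carrier ((U \<otimes> V) \<otimes> W)" and UW [lin, wf]: "vspace U" "vspace W"
  shows "tensor_assoc_inv U V W (tensor_assoc U V W x) = x"
proof (rule linear_map_tensor_eqI[OF _ _ _ _ x])
  fix t w assume t: "t \<in> carrier (U \<otimes> V)" and w [lin, wf]: "w \<in> carrier W"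
  show "tensor_assoc_inv U V W (tensor_assoc U V W (tensor (U \<otimes> V) W t w)) = tensor (U \<otimes> V) W t w"
    by (rule linear_map_tensor_eqI[OF _ _ _ _ t]) ((rule lin)+, simp add: pure wf)
qed (rule lin)+

lemma tensor_assoc_assoc_inv:
  assumes x: "x \<in> carrier (U \<otimes> (V \<otimes> W))" and UW [lin, wf]: "vspace U" "vspace W"
  shows "tensor_assoc U V W (tensor_assoc_inv U V W x) = x"
proof (rule linear_map_tensor_eqI[OF _ _ _ _ x])
  fix u t assume t: "t \<in> carrier (V \<otimes> W)" and u [lin, wf]: "u \<in> carrier U"
  show "tensor_assoc U V W (tensor_assoc_inv U V W (tensor U (V \<otimes> W) u t)) = tensor U (V \<otimes> W) u t"
    by (rule linear_map_tensor_eqI[OF _ _ _ _ t]) ((rule lin)+, simp add: pure wf)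
qed (rule lin)+

section \<open>Algebra homomorphisms on tensor products\<close>

lemma alg_hom_linear: "alg_hom V W f \<Longrightarrow> linear_map V W f"
  by (simp add: alg_hom_def)

lemma alg_hom_mult:
  "alg_hom V W f \<Longrightarrow> x \<in> carrier V \<Longrightarrow> y \<in> carrier V \<Longrightarrow> f (mult V x y) = mult W (f x) (f y)"
  by (simp add: alg_hom_def)

lemma alg_hom_mem: "alg_hom V W f \<Longrightarrow> x \<in> carrier V \<Longrightarrow> f x \<in> carrier W"
  using alg_hom_linear linear_mapD(1) by blast

lemma alg_hom_ident: "alg_hom V V (\<lambda>x. x)" and alg_hom_id: "alg_hom V V id"
  by (simp_all add: alg_hom_def wf)

lemma alg_hom_comp:
  assumes "alg_hom V W g" "alg_hom U V f"
  shows "alg_hom U W (\<lambda>x. g (f x))"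
  using lin_comp[OF assms[THEN alg_hom_linear]] alg_hom_mult[OF assms(1)] alg_hom_mult[OF assms(2)]
    alg_hom_mem[OF assms(2)]
  by (simp add: alg_hom_def)

text \<open>A linear map on \<open>V \<otimes> W\<close> is multiplicative if it is so on pure tensors.\<close>

lemma alg_hom_tensorI:
  assumes [lin, wf]: "algebra V" "algebra W" "algebra X" and f: "linear_map (V \<otimes> W) X f"
    and pure: "\<And>v w v' w'. \<lbrakk>v \<in> carrier V; w \<in> carrier W; v' \<in> carrier V; w' \<in> carrier W\<rbrakk>
      \<Longrightarrow> f (tensor V W (mult V v v') (mult W w w')) = mult X (f (tensor V W v w)) (f (tensor V W v' w'))"
  shows "alg_hom (V \<otimes> W) X f"
proof -
  note [lin] = lin_comp[OF f] linear_mapD(1)[OF f]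
  have "f (mult (V \<otimes> W) x y) = mult X (f x) (f y)"
    if x: "x \<in> carrier (V \<otimes> W)" and y [lin]: "y \<in> carrier (V \<otimes> W)" for x y
  proof (rule linear_map_tensor_eqI[OF _ _ _ _ x])
    fix v w assume vw [lin, wf]: "v \<in> carrier V" "w \<in> carrier W"
    show "f (mult (V \<otimes> W) (tensor V W v w) y) = mult X (f (tensor V W v w)) (f y)"
      by (rule linear_map_tensor_eqI[OF _ _ _ _ y]) ((rule lin)+, simp add: mult_tensor wf pure)
  qed (rule lin)+
  then show ?thesis using f by (simp add: alg_hom_def)
qed

lemma tensor_map_alg_hom:
  assumes [wf]: "algebra V" "algebra V'" "algebra W" "algebra W'"
    and f: "alg_hom V V' f" and g: "alg_hom W W' g"
  shows "alg_hom (V \<otimes> W) (V' \<otimes> W') (tensor_map V' W' f g)"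
proof (rule alg_hom_tensorI)
  note [wf] = alg_hom_linear[OF f] alg_hom_linear[OF g] alg_hom_mem[OF f] alg_hom_mem[OF g]
  show "linear_map (V \<otimes> W) (V' \<otimes> W') (tensor_map V' W' f g)"
    by (simp add: wf)
  show "tensor_map V' W' f g (tensor V W (mult V v v') (mult W w w')) =
     mult (V' \<otimes> W') (tensor_map V' W' f g (tensor V W v w)) (tensor_map V' W' f g (tensor V W v' w'))"
    if "v \<in> carrier V" "w \<in> carrier W" "v' \<in> carrier V" "w' \<in> carrier W" for v w v' w'
    using that by (simp add: pure wf alg_hom_mult[OF f] alg_hom_mult[OF g])
qed (simp_all add: wf)

lemma tensor_assoc_alg_hom:
  assumes [lin, wf]: "algebra U" "algebra V" "algebra W"
  shows "alg_hom ((U \<otimes> V) \<otimes> W) (U \<otimes> (V \<otimes> W)) (tensor_assoc U V W)"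
proof (rule alg_hom_tensorI)
  let ?a = "\<lambda>t w. tensor_assoc U V W (tensor (U \<otimes> V) W t w)"
  fix t w t' w'
  assume t: "t \<in> carrier (U \<otimes> V)" and [lin, wf]: "w \<in> carrier W"
    and t' [lin]: "t' \<in> carrier (U \<otimes> V)" and [lin, wf]: "w' \<in> carrier W"
  show "?a (mult (U \<otimes> V) t t') (mult W w w') = mult (U \<otimes> (V \<otimes> W)) (?a t w) (?a t' w')"
  proof (rule linear_map_tensor_eqI[OF _ _ _ _ t])
    fix u v assume [lin, wf]: "u \<in> carrier U" "v \<in> carrier V"
    show "?a (mult (U \<otimes> V) (tensor U V u v) t') (mult W w w')
        = mult (U \<otimes> (V \<otimes> W)) (?a (tensor U V u v) w) (?a t' w')"
      by (rule linear_map_tensor_eqI[OF _ _ _ _ t']) ((rule lin)+, simp add: pure wf)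
  qed (rule lin)+
qed (simp_all add: wf)

lemma tensor_assoc_inv_alg_hom:
  assumes [lin, wf]: "algebra U" "algebra V" "algebra W"
  shows "alg_hom (U \<otimes> (V \<otimes> W)) ((U \<otimes> V) \<otimes> W) (tensor_assoc_inv U V W)"
proof -
  have "tensor_assoc_inv U V W (mult (U \<otimes> (V \<otimes> W)) x y)
      = mult ((U \<otimes> V) \<otimes> W) (tensor_assoc_inv U V W x) (tensor_assoc_inv U V W y)"
    if [lin]: "x \<in> carrier (U \<otimes> (V \<otimes> W))" "y \<in> carrier (U \<otimes> (V \<otimes> W))" for x y
  proof -
    let ?x = "tensor_assoc_inv U V W x" and ?y = "tensor_assoc_inv U V W y"
    have xy [lin]: "?x \<in> carrier ((U \<otimes> V) \<otimes> W)" "?y \<in> carrier ((U \<otimes> V) \<otimes> W)"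
      by (rule lin)+
    have "mult (U \<otimes> (V \<otimes> W)) x y = mult (U \<otimes> (V \<otimes> W)) (tensor_assoc U V W ?x) (tensor_assoc U V W ?y)"
      using that by (simp add: tensor_assoc_assoc_inv wf)
    also have "\<dots> = tensor_assoc U V W (mult ((U \<otimes> V) \<otimes> W) ?x ?y)"
      using alg_hom_mult[OF tensor_assoc_alg_hom xy] by (simp add: wf)
    finally show ?thesis
      using tensor_assoc_inv_assoc[of "mult ((U \<otimes> V) \<otimes> W) ?x ?y" U V W] xy by (simp add: wf)
  qed
  then show ?thesis by (simp add: alg_hom_def wf)
qed

lemma alg_hom_tensor_one:
  assumes "unital_algebra U" "algebra V"
  shows "alg_hom V (V \<otimes> U) (\<lambda>v. tensor V U v (one U))"
    and "alg_hom V (U \<otimes> V) (tensor U V (one U))"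
  using assms by (auto simp: alg_hom_def mult_tensor unital_algebra_def tensor_linear wf)

lemma tensor_one_mult:
  assumes "unital_algebra U" "unital_algebra V"
  shows "\<forall>y\<in>carrier (U \<otimes> V). mult (U \<otimes> V) (tensor U V (one U) (one V)) y = y"
    and "\<forall>y\<in>carrier (U \<otimes> V). mult (U \<otimes> V) y (tensor U V (one U) (one V)) = y"
proof -
  have [lin, wf]: "algebra U" "algebra V" "one U \<in> carrier U" "one V \<in> carrier V"
    using assms by (simp_all add: unital_algebra_def)
  have one: "mult U (one U) u = u" "mult U u (one U) = u" if "u \<in> carrier U" for u
    using assms that by (simp_all add: unital_algebra_def)
  have one': "mult V (one V) v = v" "mult V v (one V) = v" if "v \<in> carrier V" for v
    using assms that by (simp_all add: unital_algebra_def)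
  show "\<forall>y\<in>carrier (U \<otimes> V). mult (U \<otimes> V) (tensor U V (one U) (one V)) y = y"
    by (rule tensor_eqI) ((rule lin)+, simp add: pure wf one one')
  show "\<forall>y\<in>carrier (U \<otimes> V). mult (U \<otimes> V) y (tensor U V (one U) (one V)) = y"
    by (rule tensor_eqI) ((rule lin)+, simp add: pure wf one one')
qed

lemma tensor_ground_cancel:
  fixes V :: "('k::field, 'v::ab_group_add, 'm) alg_scheme"
  assumes V: "vspace V" and xy: "x \<in> carrier V" "y \<in> carrier V"
  shows "tensor ground V 1 x = tensor ground V 1 y \<Longrightarrow> x = y"
    and "tensor V ground x 1 = tensor V ground y 1 \<Longrightarrow> x = y"
proof -
  interpret vector_space "scl V" using V by (simp add: vspace_def)
  have 1: "bilinear_map ground V V (scl V)" and 2: "bilinear_map V ground V (\<lambda>v c. scl V c v)"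
    using vspace_subspace[OF V]
    by (simp_all add: bilinear_map_def linear_map_def scale_left_distrib
        scale_right_distrib mult.commute)
  show "x = y" if eq: "tensor ground V 1 x = tensor ground V 1 y"
    using arg_cong[OF eq, of "tensor_lift ground V V (scl V)"] xy by (simp add: tensor_lift(2)[OF V 1])
  show "x = y" if eq: "tensor V ground x 1 = tensor V ground y 1"
    using arg_cong[OF eq, of "tensor_lift V ground V (\<lambda>v c. scl V c v)"] xy
        by (simp add: tensor_lift(2)[OF V 2])
qed

section \<open>Comodule algebras\<close>

text \<open>
  The conditions that one or both coactions of a bicomodule algebra satisfy, stated separately from
  each other; the algebra is not required to be unital.
\<close>

definition right_coaction ::
  "('k::field, 'h::ab_group_add) hopf \<Rightarrow> ('k, 'b::ab_group_add, 'm) alg_scheme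
    \<Rightarrow> ('b \<Rightarrow> ('k, 'b, 'h) tensor) \<Rightarrow> bool" where
  "right_coaction H B rho \<longleftrightarrow> alg_hom B (B \<otimes> H) rho \<and>
     (\<forall>b\<in>carrier B. tensor_map B ground id (counit H) (rho b) = tensor B ground b 1) \<and>
     (\<forall>b\<in>carrier B.
        tensor_assoc B H H (tensor_map (B \<otimes> H) H rho id (rho b))
          = tensor_map B (H \<otimes> H) id (comult H) (rho b))"

definition left_coaction ::
  "('k::field, 'h::ab_group_add) hopf \<Rightarrow> ('k, 'b::ab_group_add, 'm) alg_scheme
    \<Rightarrow> ('b \<Rightarrow> ('k, 'h, 'b) tensor) \<Rightarrow> bool" where
  "left_coaction H B lam \<longleftrightarrow> alg_hom B (H \<otimes> B) lam \<and>
     (\<forall>b\<in>carrier B. tensor_map ground B (counit H) id (lam b) = tensor ground B 1 b) \<and>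
     (\<forall>b\<in>carrier B.
        tensor_map H (H \<otimes> B) id lam (lam b)
          = tensor_assoc H H B (tensor_map (H \<otimes> H) B (comult H) id (lam b)))"

definition coactions_commute ::
  "('k::field, 'h::ab_group_add) hopf \<Rightarrow> ('b \<Rightarrow> ('k, 'h, 'b) tensor)
    \<Rightarrow> ('k, 'b::ab_group_add, 'm) alg_scheme \<Rightarrow> ('b \<Rightarrow> ('k, 'b, 'h) tensor) \<Rightarrow> bool" where
  "coactions_commute H lam B rho \<longleftrightarrow> (\<forall>b\<in>carrier B.
        tensor_map H (B \<otimes> H) id rho (lam b)
          = tensor_assoc H B H (tensor_map (H \<otimes> B) H lam id (rho b)))"

lemma bicomodule_algebra_iff:
  "bicomodule_algebra H lam B rho \<longleftrightarrow>
     algebra B \<and> right_coaction H B rho \<and> left_coaction H B lam \<and> coactions_commute H lam B rho"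
  unfolding bicomodule_algebra_def right_coaction_def left_coaction_def coactions_commute_def by blast

text \<open>The left coaction of \<open>H\<close> on \<open>H \<otimes> X\<close> by comultiplication on the first factor.\<close>

definition left_cofree ::
  "('k::field, 'h::ab_group_add) hopf \<Rightarrow> ('k, 'x::ab_group_add, 'm) alg_scheme
    \<Rightarrow> ('k, 'h, 'x) tensor \<Rightarrow> ('k, 'h, ('k, 'h, 'x) tensor) tensor" where
  "left_cofree H X y = tensor_assoc H H X (tensor_map (H \<otimes> H) X (comult H) id y)"

text \<open>The right coaction of \<open>H\<close> on \<open>X \<otimes> H\<close> by comultiplication on the second factor.\<close>

definition right_cofree ::
  "('k::field, 'h::ab_group_add) hopf \<Rightarrow> ('k, 'x::ab_group_add, 'm) alg_scheme
    \<Rightarrow> ('k, 'x, 'h) tensor \<Rightarrow> ('k, ('k, 'x, 'h) tensor, 'h) tensor" where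
  "right_cofree H X y = tensor_assoc_inv X H H (tensor_map X (H \<otimes> H) id (comult H) y)"

text \<open>A right coaction on \<open>X\<close> extends to \<open>H \<otimes> X\<close> by acting on the second factor.\<close>

definition right_extended ::
  "('k::field, 'h::ab_group_add) hopf \<Rightarrow> ('k, 'x::ab_group_add, 'm) alg_scheme
    \<Rightarrow> ('x \<Rightarrow> ('k, 'x, 'h) tensor)
    \<Rightarrow> ('k, 'h, 'x) tensor \<Rightarrow> ('k, ('k, 'h, 'x) tensor, 'h) tensor" where
  "right_extended H X r y = tensor_assoc_inv H X H (tensor_map H (X \<otimes> H) id r y)"

locale hopf =
  fixes H :: "('k::field, 'h::ab_group_add) hopf"
  assumes hopf: "hopf_algebra H"
begin

lemma unital_H: "unital_algebra H"
  and comult_hom: "alg_hom H (H \<otimes> H) (comult H)"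
  and comult_one: "comult H (one H) = tensor H H (one H) (one H)"
  and counit_hom: "alg_hom H ground (counit H)"
  and antipode_linear [lin, wf]: "linear_map H H (antipode H)"
  using hopf by (simp_all add: hopf_algebra_def)

lemma algebra_H [lin, wf]: "algebra H"
  using unital_H by (simp add: unital_algebra_def)

lemma one_H [lin, wf]: "one H \<in> carrier H"
  using unital_H by (simp add: unital_algebra_def)

lemmas comult_linear [lin, wf] = alg_hom_linear[OF comult_hom]
  and counit_linear [lin, wf] = alg_hom_linear[OF counit_hom]

lemmas lin_comult [lin] = lin_comp[OF comult_linear]
  and mem_comult [lin, wf] = linear_mapD(1)[OF comult_linear]
  and mem_antipode [lin, wf] = linear_mapD(1)[OF antipode_linear]
  and lin_antipode [lin] = lin_comp[OF antipode_linear]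

lemma comult_coassoc:
  "h \<in> carrier H \<Longrightarrow> tensor_assoc H H H (tensor_map (H \<otimes> H) H (comult H) id (comult H h))
          = tensor_map H (H \<otimes> H) id (comult H) (comult H h)"
  using hopf by (simp add: hopf_algebra_def)

lemma comult_counit:
  "h \<in> carrier H \<Longrightarrow> tensor_map ground H (counit H) id (comult H h) = tensor ground H 1 h"
  "h \<in> carrier H \<Longrightarrow> tensor_map H ground id (counit H) (comult H h) = tensor H ground h 1"
  using hopf by (simp_all add: hopf_algebra_def)

subsection \<open>Cofree coactions\<close>

context
  fixes X :: "('k, 'x::ab_group_add, 'm) alg_scheme"
  assumes X [lin, wf]: "algebra X"
begin

lemma left_cofree_hom: "alg_hom (H \<otimes> X) (H \<otimes> (H \<otimes> X)) (left_cofree H X)"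
  unfolding left_cofree_def
  by (rule alg_hom_comp[OF tensor_assoc_alg_hom tensor_map_alg_hom])
    (simp_all add: wf comult_hom alg_hom_id)

lemma right_cofree_hom: "alg_hom (X \<otimes> H) ((X \<otimes> H) \<otimes> H) (right_cofree H X)"
  unfolding right_cofree_def
  by (rule alg_hom_comp[OF tensor_assoc_inv_alg_hom tensor_map_alg_hom])
    (simp_all add: wf comult_hom alg_hom_id)

lemmas left_cofree_linear [lin, wf] = alg_hom_linear[OF left_cofree_hom]
  and right_cofree_linear [lin, wf] = alg_hom_linear[OF right_cofree_hom]
lemmas lin_left_cofree [lin] = lin_comp[OF left_cofree_linear]
  and lin_right_cofree [lin] = lin_comp[OF right_cofree_linear]

lemma left_cofree_tensor [pure]:
  "h \<in> carrier H \<Longrightarrow> x \<in> carrier X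
    \<Longrightarrow> left_cofree H X (tensor H X h x) = tensor_assoc H H X (tensor (H \<otimes> H) X (comult H h) x)"
  by (simp add: left_cofree_def pure wf)

lemma right_cofree_tensor [pure]:
  "h \<in> carrier H \<Longrightarrow> x \<in> carrier X
    \<Longrightarrow> right_cofree H X (tensor X H x h) = tensor_assoc_inv X H H (tensor X (H \<otimes> H) x (comult H h))"
  by (simp add: right_cofree_def pure wf)

lemma left_coaction_left_cofree: "left_coaction H (H \<otimes> X) (left_cofree H X)"
proof -
  let ?F = "H \<otimes> X" and ?l = "left_cofree H X"
  have counit: "\<forall>b\<in>carrier ?F. tensor_map ground ?F (counit H) id (?l b) = tensor ground ?F 1 b"
  proof (rule tensor_eqI)
    fix h x assume [lin, wf]: "h \<in> carrier H" "x \<in> carrier X"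
    have "\<forall>t\<in>carrier (H \<otimes> H). tensor_map ground ?F (counit H) id
        (tensor_assoc H H X (tensor (H \<otimes> H) X t x))
        = tensor_assoc ground H X (tensor (ground \<otimes> H) X (tensor_map ground H (counit H) id t) x)"
      by (rule tensor_eqI) ((rule lin)+, simp add: pure wf)
    from bspec[OF this, of "comult H h"]
    show "tensor_map ground ?F (counit H) id (?l (tensor H X h x))
        = tensor ground ?F 1 (tensor H X h x)"
      by (simp add: pure wf comult_counit)
  qed (rule lin)+
  have coassoc: "\<forall>b\<in>carrier ?F. tensor_map H (H \<otimes> ?F) id ?l (?l b)
      = tensor_assoc H H ?F (tensor_map (H \<otimes> H) ?F (comult H) id (?l b))"
  proof (rule tensor_eqI)
    fix h x assume [lin, wf]: "h \<in> carrier H" "x \<in> carrier X"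
    \<comment> \<open>Both sides are images under \<open>K\<close> of the two sides of coassociativity of \<open>H\<close> at \<open>h\<close>.\<close>
    let ?a = "\<lambda>t. tensor_assoc H H X (tensor (H \<otimes> H) X t x)"
    let ?K = "tensor_map H (H \<otimes> ?F) id ?a"
    have a [lin, wf]: "linear_map (H \<otimes> H) (H \<otimes> ?F) ?a" by (rule lin)+
    have 1: "\<forall>t\<in>carrier (H \<otimes> H). tensor_map H (H \<otimes> ?F) id ?l (?a t)
        = ?K (tensor_map H (H \<otimes> H) id (comult H) t)"
      by (rule tensor_eqI) ((rule lin)+, simp add: pure wf)
    have 3: "\<forall>s\<in>carrier (H \<otimes> H). tensor_assoc H H ?F (tensor (H \<otimes> H) ?F s (tensor H X q x))
        = ?K (tensor_assoc H H H (tensor (H \<otimes> H) H s q))"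
      if [lin, wf]: "q \<in> carrier H" for q
      by (rule tensor_eqI) ((rule lin)+, simp add: pure wf)
    have 2: "\<forall>t\<in>carrier (H \<otimes> H). tensor_assoc H H ?F (tensor_map (H \<otimes> H) ?F (comult H) id (?a t))
        = ?K (tensor_assoc H H H (tensor_map (H \<otimes> H) H (comult H) id t))"
      by (rule tensor_eqI) ((rule lin)+, simp add: pure wf 3)
    show "tensor_map H (H \<otimes> ?F) id ?l (?l (tensor H X h x))
      = tensor_assoc H H ?F (tensor_map (H \<otimes> H) ?F (comult H) id (?l (tensor H X h x)))"
      by (simp add: left_cofree_tensor wf 1 2 comult_coassoc)
  qed (rule lin)+
  show ?thesis
    using counit coassoc by (simp add: left_coaction_def left_cofree_hom)
qed

lemma right_coaction_right_cofree [lin, wf]: "right_coaction H (X \<otimes> H) (right_cofree H X)"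
proof -
  let ?F = "X \<otimes> H" and ?r = "right_cofree H X"
  have counit: "\<forall>b\<in>carrier ?F. tensor_map ?F ground id (counit H) (?r b) = tensor ?F ground b 1"
  proof (rule tensor_eqI)
    fix x h assume [lin, wf]: "h \<in> carrier H" "x \<in> carrier X"
    have "\<forall>t\<in>carrier (H \<otimes> H). tensor_map ?F ground id (counit H)
        (tensor_assoc_inv X H H (tensor X (H \<otimes> H) x t))
        = tensor_assoc_inv X H ground (tensor X (H \<otimes> ground) x (tensor_map H ground id (counit H) t))"
      by (rule tensor_eqI) ((rule lin)+, simp add: pure wf)
    from bspec[OF this, of "comult H h"]
    show "tensor_map ?F ground id (counit H) (?r (tensor X H x h))
        = tensor ?F ground (tensor X H x h) 1"
      by (simp add: pure wf comult_counit)
  qed (rule lin)+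
  have coassoc: "\<forall>b\<in>carrier ?F. tensor_assoc ?F H H (tensor_map (?F \<otimes> H) H ?r id (?r b))
      = tensor_map ?F (H \<otimes> H) id (comult H) (?r b)"
  proof (rule tensor_eqI)
    fix x h assume [lin, wf]: "h \<in> carrier H" "x \<in> carrier X"
    \<comment> \<open>Both sides are images under \<open>K\<close> of the two sides of coassociativity of \<open>H\<close> at \<open>h\<close>.\<close>
    let ?K = "\<lambda>y. tensor_assoc_inv X H (H \<otimes> H) (tensor X (H \<otimes> (H \<otimes> H)) x y)"
    let ?a = "\<lambda>t. tensor_assoc_inv X H H (tensor X (H \<otimes> H) x t)"
    have 1: "\<forall>t\<in>carrier (H \<otimes> H). tensor_map ?F (H \<otimes> H) id (comult H) (?a t)
        = ?K (tensor_map H (H \<otimes> H) id (comult H) t)"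
      by (rule tensor_eqI) ((rule lin)+, simp add: pure wf)
    have 3: "\<forall>s\<in>carrier (H \<otimes> H). tensor_assoc ?F H H (tensor (?F \<otimes> H) H (?a s) q)
        = ?K (tensor_assoc H H H (tensor (H \<otimes> H) H s q))"
      if [lin, wf]: "q \<in> carrier H" for q
      by (rule tensor_eqI) ((rule lin)+, simp add: pure wf)
    have 2: "\<forall>t\<in>carrier (H \<otimes> H). tensor_assoc ?F H H (tensor_map (?F \<otimes> H) H ?r id (?a t))
        = ?K (tensor_assoc H H H (tensor_map (H \<otimes> H) H (comult H) id t))"
      by (rule tensor_eqI) ((rule lin)+, simp add: pure wf 3)
    show "tensor_assoc ?F H H (tensor_map (?F \<otimes> H) H ?r id (?r (tensor X H x h)))
      = tensor_map ?F (H \<otimes> H) id (comult H) (?r (tensor X H x h))"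
      by (simp add: right_cofree_tensor wf 1 2 comult_coassoc)
  qed (rule lin)+
  show ?thesis
    using counit coassoc by (simp add: right_coaction_def right_cofree_hom)
qed

context
  fixes r
  assumes r: "right_coaction H X r"
begin

lemma right_coaction_hom: "alg_hom X (X \<otimes> H) r"
  using r by (simp add: right_coaction_def)

lemmas right_coaction_linear = alg_hom_linear[OF right_coaction_hom]
lemmas right_coaction_lin = right_coaction_linear lin_comp[OF right_coaction_linear]
    linear_mapD(1)[OF right_coaction_linear]

lemma right_extended_hom: "alg_hom (H \<otimes> X) ((H \<otimes> X) \<otimes> H) (right_extended H X r)"
  unfolding right_extended_def
  by (rule alg_hom_comp[OF tensor_assoc_inv_alg_hom tensor_map_alg_hom])
    (simp_all add: wf right_coaction_hom alg_hom_id)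

lemmas right_extended_linear [lin, wf] = alg_hom_linear[OF right_extended_hom]
lemmas lin_right_extended [lin] = lin_comp[OF right_extended_linear]

lemma right_extended_tensor [pure]:
  "h \<in> carrier H \<Longrightarrow> x \<in> carrier X
    \<Longrightarrow> right_extended H X r (tensor H X h x) = tensor_assoc_inv H X H (tensor H (X \<otimes> H) h (r x))"
  by (simp add: right_extended_def pure wf right_coaction_lin)

lemma right_coaction_right_extended: "right_coaction H (H \<otimes> X) (right_extended H X r)"
proof -
  note right_coaction_lin [lin, wf]
  let ?F = "H \<otimes> X" and ?r = "right_extended H X r"
  have counit: "\<forall>b\<in>carrier ?F. tensor_map ?F ground id (counit H) (?r b) = tensor ?F ground b 1"
  proof (rule tensor_eqI)
    fix x h assume [lin, wf]: "h \<in> carrier H" and x [lin, wf]: "x \<in> carrier X"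
    have "\<forall>t\<in>carrier (X \<otimes> H). tensor_map ?F ground id (counit H)
        (tensor_assoc_inv H X H (tensor H (X \<otimes> H) h t))
        = tensor_assoc_inv H X ground (tensor H (X \<otimes> ground) h (tensor_map X ground id (counit H) t))"
      by (rule tensor_eqI) ((rule lin)+, simp add: pure wf)
    from bspec[OF this, of "r x"]
    show "tensor_map ?F ground id (counit H) (?r (tensor H X h x))
        = tensor ?F ground (tensor H X h x) 1"
      using r x by (simp add: pure wf right_coaction_def)
  qed (rule lin)+
  have coassoc: "\<forall>b\<in>carrier ?F. tensor_assoc ?F H H (tensor_map (?F \<otimes> H) H ?r id (?r b))
      = tensor_map ?F (H \<otimes> H) id (comult H) (?r b)"
  proof (rule tensor_eqI)
    fix x h assume [lin, wf]: "h \<in> carrier H" and x [lin, wf]: "x \<in> carrier X"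
    \<comment> \<open>Both sides are images under \<open>K\<close> of the two sides of coassociativity of \<open>r\<close> at \<open>x\<close>.\<close>
    let ?K = "\<lambda>y. tensor_assoc_inv H X (H \<otimes> H) (tensor H (X \<otimes> (H \<otimes> H)) h y)"
    let ?a = "\<lambda>t. tensor_assoc_inv H X H (tensor H (X \<otimes> H) h t)"
    have 1: "\<forall>t\<in>carrier (X \<otimes> H). tensor_map ?F (H \<otimes> H) id (comult H) (?a t)
        = ?K (tensor_map X (H \<otimes> H) id (comult H) t)"
      by (rule tensor_eqI) ((rule lin)+, simp add: pure wf)
    have 3: "\<forall>s\<in>carrier (X \<otimes> H). tensor_assoc ?F H H (tensor (?F \<otimes> H) H (?a s) q)
        = ?K (tensor_assoc X H H (tensor (X \<otimes> H) H s q))"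
      if [lin, wf]: "q \<in> carrier H" for q
      by (rule tensor_eqI) ((rule lin)+, simp add: pure wf)
    have 2: "\<forall>t\<in>carrier (X \<otimes> H). tensor_assoc ?F H H (tensor_map (?F \<otimes> H) H ?r id (?a t))
        = ?K (tensor_assoc X H H (tensor_map (X \<otimes> H) H r id t))"
      by (rule tensor_eqI) ((rule lin)+, simp add: pure wf 3)
    show "tensor_assoc ?F H H (tensor_map (?F \<otimes> H) H ?r id (?r (tensor H X h x)))
      = tensor_map ?F (H \<otimes> H) id (comult H) (?r (tensor H X h x))"
      using r x by (simp add: right_extended_tensor wf 1 2 right_coaction_def)
  qed (rule lin)+
  show ?thesis
    using counit coassoc by (simp add: right_coaction_def right_extended_hom)
qed

lemma coactions_commute_cofree_extended:
  "coactions_commute H (left_cofree H X) (H \<otimes> X) (right_extended H X r)"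
  unfolding coactions_commute_def
proof -
  let ?F = "H \<otimes> X" and ?l = "left_cofree H X" and ?r = "right_extended H X r"
  note right_coaction_lin [lin, wf]
  show "\<forall>b\<in>carrier ?F. tensor_map H (?F \<otimes> H) id ?r (?l b)
      = tensor_assoc H ?F H (tensor_map (H \<otimes> ?F) H ?l id (?r b))"
  proof (rule tensor_eqI)
    fix x h assume [lin, wf]: "h \<in> carrier H" "x \<in> carrier X"
    \<comment> \<open>Both sides equal \<open>G\<close> at the comultiplication of \<open>h\<close> and the coaction of \<open>x\<close>, where
      \<open>G(p \<otimes> q, y \<otimes> k) = p \<otimes> ((q \<otimes> y) \<otimes> k)\<close>.\<close>
    let ?G = "\<lambda>t s. tensor_map H (?F \<otimes> H) id (tensor_assoc_inv H X H)
      (tensor_assoc H H (X \<otimes> H) (tensor (H \<otimes> H) (X \<otimes> H) t s))"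
    have 1: "\<forall>t\<in>carrier (H \<otimes> H). tensor_map H (?F \<otimes> H) id ?r
        (tensor_assoc H H X (tensor (H \<otimes> H) X t x)) = ?G t (r x)"
      by (rule tensor_eqI) ((rule lin)+, simp add: pure wf)
    have 3: "\<forall>t\<in>carrier (H \<otimes> H). tensor_assoc H ?F H (tensor (H \<otimes> ?F) H
        (tensor_assoc H H X (tensor (H \<otimes> H) X t y)) k)
        = ?G t (tensor X H y k)"
      if [lin, wf]: "y \<in> carrier X" "k \<in> carrier H" for y k
      by (rule tensor_eqI) ((rule lin)+, simp add: pure wf)
    have 2: "\<forall>s\<in>carrier (X \<otimes> H). tensor_assoc H ?F H (tensor_map (H \<otimes> ?F) H ?l id
        (tensor_assoc_inv H X H (tensor H (X \<otimes> H) h s))) = ?G (comult H h) s"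
    proof (rule tensor_eqI)
      fix y k assume [lin, wf]: "y \<in> carrier X" "k \<in> carrier H"
      show "tensor_assoc H ?F H (tensor_map (H \<otimes> ?F) H ?l id
          (tensor_assoc_inv H X H (tensor H (X \<otimes> H) h (tensor X H y k))))
              = ?G (comult H h) (tensor X H y k)"
        by (simp add: pure wf 3)
    qed (rule lin)+
    show "tensor_map H (?F \<otimes> H) id ?r (?l (tensor H X h x))
      = tensor_assoc H ?F H (tensor_map (H \<otimes> ?F) H ?l id (?r (tensor H X h x)))"
      by (simp add: right_extended_tensor left_cofree_tensor wf 1 2)
  qed (rule lin)+
qed

end

end

subsection \<open>Multiplication through the antipode\<close>

text \<open>The map \<open>h \<otimes> k \<otimes> x \<mapsto> S(h) k \<otimes> x\<close>, where \<open>S\<close> is the antipode.\<close>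

definition antipode_mult ::
  "('k, 'x::ab_group_add, 'm) alg_scheme
    \<Rightarrow> ('k, 'h, ('k, 'h, 'x) tensor) tensor \<Rightarrow> ('k, 'h, 'x) tensor" where
  "antipode_mult X = tensor_lift H (H \<otimes> X) (H \<otimes> X)
     (\<lambda>h. tensor_map H X (mult H (antipode H h)) id)"

lemma antipode_mult_bilinear:
  "bilinear_map H (H \<otimes> X) (H \<otimes> X) (\<lambda>h. tensor_map H X (mult H (antipode H h)) id)"
proof (rule bilinear_map_tensorI)
  fix k x assume [lin, wf]: "k \<in> carrier H" "x \<in> carrier X"
  have "linear_map H (H \<otimes> X) (\<lambda>h. tensor H X (mult H (antipode H h) k) x)"
    by (rule lin)+
  then show "linear_map H (H \<otimes> X)
      (\<lambda>h. tensor_map H X (mult H (antipode H h)) id (tensor H X k x))"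
    by (subst linear_map_cong) (auto simp: pure wf mult_linear)
qed (rule lin | assumption)+

lemmas antipode_mult_linear [lin, wf] =
  tensor_lift(1)[OF vspace_tensor antipode_mult_bilinear, folded antipode_mult_def]
lemmas antipode_mult_tensor =
  tensor_lift(2)[OF vspace_tensor antipode_mult_bilinear, folded antipode_mult_def]
lemmas lin_antipode_mult [lin] = lin_comp[OF antipode_mult_linear]
  and mem_antipode_mult [lin, wf] = linear_mapD(1)[OF antipode_mult_linear]

lemma antipode_mult_pure [pure]:
  assumes [wf]: "h \<in> carrier H" "k \<in> carrier H" "x \<in> carrier X"
  shows "antipode_mult X (tensor H (H \<otimes> X) h (tensor H X k x)) = tensor H X (mult H (antipode H h) k) x"
  by (simp add: antipode_mult_tensor pure wf mult_linear)

lemma antipode_mult_natural: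
  assumes [lin, wf]: "linear_map X Y f"
  shows "\<forall>y\<in>carrier (H \<otimes> (H \<otimes> X)). antipode_mult Y (tensor_map H (H \<otimes> Y) id (tensor_map H Y id f) y)
    = tensor_map H Y id f (antipode_mult X y)"
proof (rule tensor_eqI)
  fix h t assume [lin, wf]: "h \<in> carrier H" and t: "t \<in> carrier (H \<otimes> X)"
  note [wf] = linear_mapD(1)[OF assms]
  have "\<forall>t\<in>carrier (H \<otimes> X). antipode_mult Y (tensor_map H (H \<otimes> Y) id
      (tensor_map H Y id f) (tensor H (H \<otimes> X) h t))
      = tensor_map H Y id f (antipode_mult X (tensor H (H \<otimes> X) h t))"
    by (rule tensor_eqI) ((rule lin)+, simp add: pure wf)
  with t show "antipode_mult Y (tensor_map H (H \<otimes> Y) id (tensor_map H Y id f) (tensor H (H \<otimes> X) h t))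
      = tensor_map H Y id f (antipode_mult X (tensor H (H \<otimes> X) h t))" by blast
qed (rule lin)+

context
  fixes X :: "('k, 'x::ab_group_add, 'm) alg_scheme"
  assumes X [lin, wf]: "algebra X"
begin

text \<open>The antipode axiom, tensored with \<open>X\<close>: \<open>h \<otimes> x\<close> is mapped to \<open>\<epsilon>(h) 1 \<otimes> x\<close>.\<close>

lemma antipode_mult_left_cofree:
  "\<forall>y\<in>carrier (H \<otimes> X). antipode_mult X (left_cofree H X y)
    = tensor_map H X (\<lambda>c. scl H c (one H)) id (tensor_map ground X (counit H) id y)"
proof -
  have scl_linear [lin, wf]: "linear_map ground H (\<lambda>c. scl H c (one H))"
  proof -
    interpret vector_space "scl H" using algebra_H by (simp add: algebra_def vspace_def)
    show ?thesis using vspace_subspace[OF algebra_vspace[OF algebra_H]]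
      by (simp add: linear_map_def one_H scale_left_distrib)
  qed
  have mult: "bilinear_map H H H (mult H)"
    using algebra_H by (simp add: algebra_def)
  note H = algebra_vspace[OF algebra_H]
  note [lin, wf] = tensor_lift(1)[OF H mult] and [lin] = lin_comp[OF tensor_lift(1)[OF H mult]]
  note [pure] = tensor_lift(2)[OF H mult]
  show ?thesis
  proof (rule tensor_eqI)
    fix h x assume [lin, wf]: "h \<in> carrier H" "x \<in> carrier X"
    have "\<forall>t\<in>carrier (H \<otimes> H). antipode_mult X (tensor_assoc H H X (tensor (H \<otimes> H) X t x))
        = tensor H X (tensor_lift H H H (mult H) (tensor_map H H (antipode H) id t)) x"
      by (rule tensor_eqI) ((rule lin)+, simp add: pure wf)
    from bspec[OF this, of "comult H h"]
    have "antipode_mult X (left_cofree H X (tensor H X h x))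
        = tensor H X (scl H (counit H h) (one H)) x"
      using hopf by (simp add: pure wf hopf_algebra_def)
    then show "antipode_mult X (left_cofree H X (tensor H X h x))
      = tensor_map H X (\<lambda>c. scl H c (one H)) id (tensor_map ground X (counit H) id (tensor H X h x))"
      by (simp add: pure wf)
  qed (rule lin)+
qed

text \<open>The map is a homomorphism of right \<open>H \<otimes> X\<close>-modules.\<close>

lemma antipode_mult_mult:
  assumes [lin]: "z \<in> carrier (H \<otimes> X)" and y: "y \<in> carrier (H \<otimes> (H \<otimes> X))"
  shows "antipode_mult X (mult (H \<otimes> (H \<otimes> X)) y (tensor H (H \<otimes> X) (one H) z))
    = mult (H \<otimes> X) (antipode_mult X y) z"
proof -
  have one: "mult H h (one H) = h" if "h \<in> carrier H" for h
    using unital_H that by (simp add: unital_algebra_def)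
  have "\<forall>y\<in>carrier (H \<otimes> (H \<otimes> X)). antipode_mult X (mult (H \<otimes> (H \<otimes> X)) y (tensor H (H \<otimes> X) (one H) z))
    = mult (H \<otimes> X) (antipode_mult X y) z"
  proof (rule tensor_eqI)
    fix h t assume h [lin, wf]: "h \<in> carrier H" and t: "t \<in> carrier (H \<otimes> X)"
    have "\<forall>t\<in>carrier (H \<otimes> X). \<forall>z\<in>carrier (H \<otimes> X).
        antipode_mult X (tensor H (H \<otimes> X) h (mult (H \<otimes> X) t z))
        = mult (H \<otimes> X) (antipode_mult X (tensor H (H \<otimes> X) h t)) z"
    proof (intro ballI)
      fix t z assume t: "t \<in> carrier (H \<otimes> X)" and [lin]: "z \<in> carrier (H \<otimes> X)"
      have "\<forall>t\<in>carrier (H \<otimes> X). antipode_mult X (tensor H (H \<otimes> X) h (mult (H \<otimes> X) t z))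
        = mult (H \<otimes> X) (antipode_mult X (tensor H (H \<otimes> X) h t)) z"
      proof (rule tensor_eqI)
        fix k x assume [lin, wf]: "k \<in> carrier H" "x \<in> carrier X"
        have "\<forall>z\<in>carrier (H \<otimes> X). antipode_mult X (tensor H (H \<otimes> X) h (mult (H \<otimes> X) (tensor H X k x) z))
          = mult (H \<otimes> X) (antipode_mult X (tensor H (H \<otimes> X) h (tensor H X k x))) z"
          by (rule tensor_eqI) ((rule lin)+, simp add: pure wf algebra_mult_assoc)
        then show "antipode_mult X (tensor H (H \<otimes> X) h (mult (H \<otimes> X) (tensor H X k x) z))
          = mult (H \<otimes> X) (antipode_mult X (tensor H (H \<otimes> X) h (tensor H X k x))) z"
          by (rule bspec) fact
      qed (rule lin)+
      then show "antipode_mult X (tensor H (H \<otimes> X) h (mult (H \<otimes> X) t z))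
        = mult (H \<otimes> X) (antipode_mult X (tensor H (H \<otimes> X) h t)) z"
        by (rule bspec) fact
    qed
    then show "antipode_mult X (mult (H \<otimes> (H \<otimes> X)) (tensor H (H \<otimes> X) h t) (tensor H (H \<otimes> X) (one H) z))
      = mult (H \<otimes> X) (antipode_mult X (tensor H (H \<otimes> X) h t)) z"
      using t assms by (simp add: pure wf one)
  qed (rule lin)+
  then show ?thesis by (rule bspec) fact
qed

end

end

section \<open>The embedding of a partial bicomodule algebra\<close>

locale partial_bicomodule = hopf H for H :: "('k::field, 'h::ab_group_add) hopf" +
  fixes lam :: "'a::ab_group_add \<Rightarrow> ('k, 'h, 'a) tensor"
    and A :: "('k, 'a) ualg"
    and rho :: "'a \<Rightarrow> ('k, 'a, 'h) tensor"
  assumes partial: "partial_bicomodule_algebra H lam A rho"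
begin

lemma unital_A: "unital_algebra A"
  and lam_hom: "alg_hom A (H \<otimes> A) lam"
  and rho_hom: "alg_hom A (A \<otimes> H) rho"
  using partial by (simp_all add: partial_bicomodule_algebra_def right_partial_comodule_algebra_def
    left_partial_comodule_algebra_def)

text \<open>
  The axioms of a partial bicomodule algebra. In the coassociativity axiom of the left coaction, the
  comultiplication is written as \<^const>\<open>left_cofree\<close>.
\<close>

lemma lam_counit: "a \<in> carrier A \<Longrightarrow> tensor_map ground A (counit H) id (lam a) = tensor ground A 1 a"
  and rho_counit: "a \<in> carrier A \<Longrightarrow> tensor_map A ground id (counit H) (rho a) = tensor A ground a 1"
  and lam_coassoc: "a \<in> carrier A \<Longrightarrow> tensor_map H (H \<otimes> A) id lam (lam a)
    = mult (H \<otimes> (H \<otimes> A)) (left_cofree H A (lam a)) (tensor H (H \<otimes> A) (one H) (lam (one A)))"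
  and rho_coassoc: "a \<in> carrier A \<Longrightarrow> tensor_assoc A H H (tensor_map (A \<otimes> H) H rho id (rho a))
    = mult (A \<otimes> (H \<otimes> H)) (tensor_assoc A H H (tensor (A \<otimes> H) H (rho (one A)) (one H)))
        (tensor_map A (H \<otimes> H) id (comult H) (rho a))"
  and lam_rho: "a \<in> carrier A \<Longrightarrow> tensor_map H (A \<otimes> H) id rho (lam a)
    = tensor_assoc H A H (tensor_map (H \<otimes> A) H lam id (rho a))"
  using partial by (simp_all add: partial_bicomodule_algebra_def right_partial_comodule_algebra_def
    left_partial_comodule_algebra_def left_cofree_def)

lemma algebra_A [lin, wf]: "algebra A"
  and one_A [lin, wf]: "one A \<in> carrier A"
  using unital_A by (simp_all add: unital_algebra_def)

lemma mult_one:
  "h \<in> carrier H \<Longrightarrow> mult H (one H) h = h" "h \<in> carrier H \<Longrightarrow> mult H h (one H) = h"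
  "a \<in> carrier A \<Longrightarrow> mult A (one A) a = a" "a \<in> carrier A \<Longrightarrow> mult A a (one A) = a"
  using unital_A unital_H by (simp_all add: unital_algebra_def)

lemmas lam_linear [lin, wf] = alg_hom_linear[OF lam_hom]
  and rho_linear [lin, wf] = alg_hom_linear[OF rho_hom]
lemmas lin_lam [lin] = lin_comp[OF lam_linear]
  and mem_lam [lin, wf] = linear_mapD(1)[OF lam_linear]
  and lin_rho [lin] = lin_comp[OF rho_linear]
  and mem_rho [lin, wf] = linear_mapD(1)[OF rho_linear]

text \<open>The bicomodule algebra \<open>F\<close> in which the globalization is found.\<close>

abbreviation "F \<equiv> H \<otimes> A \<otimes> H"
abbreviation "lamF \<equiv> left_cofree H (A \<otimes> H)"
abbreviation "rhoF \<equiv> right_extended H (A \<otimes> H) (right_cofree H A)"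

text \<open>The embedding of \<open>A\<close> into \<open>F\<close>.\<close>

definition emb :: "'a \<Rightarrow> ('k, 'h, ('k, 'a, 'h) tensor) tensor" where
  "emb a = tensor_map H (A \<otimes> H) id rho (lam a)"

text \<open>The left coaction of \<open>A\<close> on the first factor of \<open>A \<otimes> H\<close>.\<close>

definition lamH :: "('k, 'a, 'h) tensor \<Rightarrow> ('k, 'h, ('k, 'a, 'h) tensor) tensor" where
  "lamH y = tensor_assoc H A H (tensor_map (H \<otimes> A) H lam id y)"

lemma emb_eq: "a \<in> carrier A \<Longrightarrow> emb a = lamH (rho a)"
  by (simp add: emb_def lamH_def lam_rho)

lemma id_rho_hom: "alg_hom (H \<otimes> A) F (tensor_map H (A \<otimes> H) id rho)"
  by (rule tensor_map_alg_hom) (simp_all add: wf alg_hom_id rho_hom)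

lemma emb_hom: "alg_hom A F emb"
  unfolding emb_def by (rule alg_hom_comp[OF id_rho_hom lam_hom])

lemma lamH_hom: "alg_hom (A \<otimes> H) F lamH"
  unfolding lamH_def
  by (rule alg_hom_comp[OF tensor_assoc_alg_hom tensor_map_alg_hom])
    (simp_all add: wf alg_hom_id lam_hom)

lemmas emb_linear [lin, wf] = alg_hom_linear[OF emb_hom]
  and lamH_linear [lin, wf] = alg_hom_linear[OF lamH_hom]
lemmas lin_emb [lin] = lin_comp[OF emb_linear]
  and mem_emb [lin, wf] = linear_mapD(1)[OF emb_linear]
  and lin_lamH [lin] = lin_comp[OF lamH_linear]
  and mem_lamH [lin, wf] = linear_mapD(1)[OF lamH_linear]

lemma emb_inj: "inj_on emb (carrier A)"
proof (rule inj_onI)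
  fix a b assume ab: "a \<in> carrier A" "b \<in> carrier A" "emb a = emb b"
  \<comment> \<open>The left counit recovers \<open>\<rho>(a)\<close> from the image of \<open>a\<close>, and the right counit then recovers \<open>a\<close>.\<close>
  have *: "tensor_map ground (A \<otimes> H) (counit H) id (emb a) = tensor ground (A \<otimes> H) 1 (rho a)"
    if [wf]: "a \<in> carrier A" for a
  proof -
    have "\<forall>y\<in>carrier (H \<otimes> A). tensor_map ground (A \<otimes> H) (counit H) id (tensor_map H (A \<otimes> H) id rho y)
        = tensor_map ground (A \<otimes> H) id rho (tensor_map ground A (counit H) id y)"
      by (rule tensor_eqI) ((rule lin)+, simp add: pure wf)
    then show ?thesis by (simp add: emb_def lam_counit wf pure)
  qed
  have "rho a = rho b"
    by (rule tensor_ground_cancel(1)[of "A \<otimes> H"]) (use ab *[of a] *[of b] in \<open>simp_all add: wf\<close>)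
  then show "a = b"
    using ab rho_counit[of a] rho_counit[of b]
        by (intro tensor_ground_cancel(2)[of A]) (simp_all add: wf)
qed

text \<open>The elements \<open>1 \<otimes> \<rho>(1)\<close> and \<open>\<lambda>(1) \<otimes> 1\<close> of \<open>F\<close>, whose product is the image of the unit of \<open>A\<close>.\<close>

abbreviation "e_rho \<equiv> tensor H (A \<otimes> H) (one H) (rho (one A))"
abbreviation "e_lam \<equiv> tensor_assoc H A H (tensor (H \<otimes> A) H (lam (one A)) (one H))"

text \<open>
  In Sweedler notation \<open>S(b\<^sub>-\<^sub>1) \<lambda>(b\<^sub>0) = (1 \<otimes> b) \<lambda>(1)\<close>: by partial coassociativity the left side is
  the image of \<open>(\<Delta> \<otimes> I)\<lambda>(b) (1 \<otimes> \<lambda>(1))\<close> under multiplication through the antipode.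
\<close>

lemma antipode_mult_lam:
  assumes [lin, wf]: "b \<in> carrier A"
  shows "antipode_mult A (tensor_map H (H \<otimes> A) id lam (lam b))
    = mult (H \<otimes> A) (tensor H A (one H) b) (lam (one A))"
proof -
  interpret vector_space "scl H" using algebra_H by (simp add: algebra_def vspace_def)
  have [wf]: "linear_map ground H (\<lambda>c. scl H c (one H))"
    using vspace_subspace[OF algebra_vspace[OF algebra_H]]
    by (simp add: linear_map_def one_H scale_left_distrib)
  have "antipode_mult A (left_cofree H A (lam b)) = tensor H A (one H) b"
    using antipode_mult_left_cofree[OF algebra_A] by (simp add: wf lam_counit pure)
  then show ?thesis
    using antipode_mult_mult[OF algebra_A mem_lam[OF one_A], of "left_cofree H A (lam b)"]
      linear_mapD(1)[OF left_cofree_linear[OF algebra_A]]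
    by (simp add: lam_coassoc wf)
qed

text \<open>The same identity for elements \<open>y\<close> of \<open>A \<otimes> H\<close>, with \<open>\<lambda>\<close> acting on the first factor.\<close>

lemma antipode_mult_lamH:
  "\<forall>y\<in>carrier (A \<otimes> H). antipode_mult (A \<otimes> H) (tensor_map H F id lamH (lamH y))
    = mult F (tensor H (A \<otimes> H) (one H) y) e_lam"
proof (rule tensor_eqI)
  fix b k assume [lin, wf]: "b \<in> carrier A" "k \<in> carrier H"
  have 1: "\<forall>s\<in>carrier (H \<otimes> A). antipode_mult (A \<otimes> H) (tensor H F p
      (tensor_assoc H A H (tensor (H \<otimes> A) H s k)))
      = tensor_assoc H A H (tensor (H \<otimes> A) H (antipode_mult A (tensor H (H \<otimes> A) p s)) k)"
    if [lin, wf]: "p \<in> carrier H" for p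
    by (rule tensor_eqI) ((rule lin)+, simp add: pure wf)
  have 2: "\<forall>t\<in>carrier (H \<otimes> A). antipode_mult (A \<otimes> H)
      (tensor_map H F id lamH (tensor_assoc H A H (tensor (H \<otimes> A) H t k)))
      = tensor_assoc H A H (tensor (H \<otimes> A) H (antipode_mult A (tensor_map H (H \<otimes> A) id lam t)) k)"
  proof (rule tensor_eqI)
    fix p c assume [lin, wf]: "p \<in> carrier H" "c \<in> carrier A"
    show "antipode_mult (A \<otimes> H) (tensor_map H F id lamH
        (tensor_assoc H A H (tensor (H \<otimes> A) H (tensor H A p c) k)))
      = tensor_assoc H A H (tensor (H \<otimes> A) H (antipode_mult A
          (tensor_map H (H \<otimes> A) id lam (tensor H A p c))) k)"
      by (simp add: pure wf lamH_def 1)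
  qed (rule lin)+
  have "mult F (tensor H (A \<otimes> H) (one H) (tensor A H b k)) e_lam
    = mult F (tensor_assoc H A H (tensor (H \<otimes> A) H (tensor H A (one H) b) k)) e_lam"
    by (simp add: pure wf)
  also have "\<dots> = tensor_assoc H A H (mult ((H \<otimes> A) \<otimes> H) (tensor (H \<otimes> A) H (tensor H A (one H) b) k)
      (tensor (H \<otimes> A) H (lam (one A)) (one H)))"
    by (subst alg_hom_mult[OF tensor_assoc_alg_hom]) (simp_all add: wf)
  also have "\<dots> = tensor_assoc H A H (tensor (H \<otimes> A) H
      (mult (H \<otimes> A) (tensor H A (one H) b) (lam (one A))) k)"
    by (simp add: mult_tensor wf mult_one)
  also have "\<dots> = antipode_mult (A \<otimes> H) (tensor_map H F id lamH (lamH (tensor A H b k)))"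
    by (simp add: lamH_def[of "tensor A H b k"] pure wf 2 antipode_mult_lam)
  finally show "antipode_mult (A \<otimes> H) (tensor_map H F id lamH (lamH (tensor A H b k)))
    = mult F (tensor H (A \<otimes> H) (one H) (tensor A H b k)) e_lam"
    by simp
qed (rule lin)+

text \<open>
  The unit of \<open>A\<close> is mapped to \<open>(1 \<otimes> \<rho>(1)) (\<lambda>(1) \<otimes> 1)\<close>. The previous identity at \<open>y = \<rho>(1)\<close>
  expresses this product through \<open>S\<close>; commutation of the coactions moves \<open>\<rho>\<close> to the
  outside, where the identity for \<open>b = 1\<close> applies.
\<close>

lemma emb_one:
  "emb (one A) = mult F e_rho e_lam"
proof -
  have "tensor_map H F id lamH (lamH (rho (one A)))
      = tensor_map H F id lamH (tensor_map H (A \<otimes> H) id rho (lam (one A)))"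
    by (simp add: lamH_def lam_rho wf)
  also have "\<dots> = tensor_map H F (\<lambda>h. id (id h)) (\<lambda>a. lamH (rho a)) (lam (one A))"
    by (rule tensor_map_comp) (rule lin)+
  also have "\<dots> = tensor_map H F (\<lambda>h. id (id h)) (\<lambda>a. tensor_map H (A \<otimes> H) id rho (lam a)) (lam (one A))"
    by (rule tensor_map_cong) ((rule lin)+ | simp add: wf lamH_def lam_rho)+
  also have "\<dots> = tensor_map H F id (tensor_map H (A \<otimes> H) id rho)
      (tensor_map H (H \<otimes> A) id lam (lam (one A)))"
    by (rule tensor_map_comp[symmetric]) (rule lin)+
  finally have "antipode_mult (A \<otimes> H) (tensor_map H F id lamH (lamH (rho (one A))))
      = tensor_map H (A \<otimes> H) id rho (antipode_mult A (tensor_map H (H \<otimes> A) id lam (lam (one A))))"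
    using antipode_mult_natural[OF rho_linear]
    by (simp add: mem_tensor_map[OF mem_lam lin_id lam_linear] one_A)
  also have "\<dots> = emb (one A)"
    using tensor_one_mult(1)[OF unital_H unital_A] by (simp add: antipode_mult_lam emb_def wf)
  finally show ?thesis using antipode_mult_lamH by (simp add: wf)
qed

subsection \<open>Comparison with the coactions on \<open>H \<otimes> A \<otimes> H\<close>\<close>

text \<open>
  Partial coassociativity of \<open>\<lambda>\<close>, transported by \<open>I \<otimes> I \<otimes> \<rho>\<close>: the map \<open>I \<otimes> \<rho>\<close> from \<open>H \<otimes> A\<close> to \<open>F\<close> is
  colinear for the coactions by comultiplication on the left.
\<close>

lemma emb_lam:
  assumes [lin, wf]: "a \<in> carrier A"
  shows "tensor_map H F id emb (lam a) = mult (H \<otimes> F) (lamF (emb a)) (tensor H F (one H) (emb (one A)))"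
proof -
  let ?r = "tensor_map H (A \<otimes> H) id rho"
  have "tensor_map H F id ?r (left_cofree H A (tensor H A h b)) = lamF (?r (tensor H A h b))"
    if [lin, wf]: "h \<in> carrier H" "b \<in> carrier A" for h b
  proof -
    have "\<forall>t\<in>carrier (H \<otimes> H). tensor_map H F id ?r (tensor_assoc H H A (tensor (H \<otimes> H) A t b))
        = tensor_assoc H H (A \<otimes> H) (tensor (H \<otimes> H) (A \<otimes> H) t (rho b))"
      by (rule tensor_eqI) ((rule lin)+, simp add: pure wf)
    then show ?thesis by (simp add: pure wf)
  qed
  then have nat: "\<forall>y\<in>carrier (H \<otimes> A). tensor_map H F id ?r (left_cofree H A y) = lamF (?r y)"
    by (intro tensor_eqI) ((rule lin)+, simp)
  have hom: "alg_hom (H \<otimes> (H \<otimes> A)) (H \<otimes> F) (tensor_map H F id ?r)"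
    by (rule tensor_map_alg_hom) (simp_all add: wf alg_hom_id id_rho_hom)
  have l: "left_cofree H A (lam a) \<in> carrier (H \<otimes> (H \<otimes> A))"
    using linear_mapD(1)[OF left_cofree_linear[OF algebra_A]] by (simp add: wf)
  have "tensor_map H F id emb (lam a) = tensor_map H F (\<lambda>h. id (id h)) (\<lambda>a. ?r (lam a)) (lam a)"
    by (simp add: emb_def[abs_def] id_def)
  also have "\<dots> = tensor_map H F id ?r (tensor_map H (H \<otimes> A) id lam (lam a))"
    by (rule tensor_map_comp[symmetric]) (rule lin)+
  also have "\<dots> = mult (H \<otimes> F) (tensor_map H F id ?r (left_cofree H A (lam a)))
      (tensor_map H F id ?r (tensor H (H \<otimes> A) (one H) (lam (one A))))"
    using alg_hom_mult[OF hom l] by (simp add: lam_coassoc wf)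
  also have "\<dots> = mult (H \<otimes> F) (lamF (emb a)) (tensor H F (one H) (emb (one A)))"
    using nat by (simp add: pure wf emb_def)
  finally show ?thesis .
qed

text \<open>
  The map \<open>\<lambda> \<otimes> I\<close> from \<open>A \<otimes> H\<close> to \<open>F\<close> is colinear for the coactions by comultiplication on the
  right.
\<close>

lemma lamH_right_cofree:
  "\<forall>y\<in>carrier (A \<otimes> H). tensor_map F H lamH id (right_cofree H A y) = rhoF (lamH y)"
proof (rule tensor_eqI)
  fix a k assume [lin, wf]: "a \<in> carrier A" "k \<in> carrier H"
  \<comment> \<open>Both sides equal \<open>G\<close> at \<open>\<lambda>(a)\<close> and the comultiplication of \<open>k\<close>, where
    \<open>G(h \<otimes> c, p \<otimes> q) = (h \<otimes> (c \<otimes> p)) \<otimes> q\<close>.\<close>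
  let ?G = "\<lambda>s t. tensor_assoc_inv H (A \<otimes> H) H (tensor_map H ((A \<otimes> H) \<otimes> H) id (tensor_assoc_inv A H H)
    (tensor_assoc H A (H \<otimes> H) (tensor (H \<otimes> A) (H \<otimes> H) s t)))"
  have 1: "\<forall>s\<in>carrier (H \<otimes> A). rhoF (tensor_assoc H A H (tensor (H \<otimes> A) H s k)) = ?G s (comult H k)"
    by (rule tensor_eqI) ((rule lin)+, simp add: pure wf)
  have 3: "\<forall>s\<in>carrier (H \<otimes> A). tensor F H (tensor_assoc H A H (tensor (H \<otimes> A) H s p)) q
      = ?G s (tensor H H p q)" if [lin, wf]: "p \<in> carrier H" "q \<in> carrier H" for p q
    by (rule tensor_eqI) ((rule lin)+, simp add: pure wf)
  have 2: "\<forall>t\<in>carrier (H \<otimes> H). tensor_map F H lamH id (tensor_assoc_inv A H H (tensor A (H \<otimes> H) a t))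
      = ?G (lam a) t"
    by (rule tensor_eqI) ((rule lin)+, simp add: pure wf lamH_def 3)
  have l: "lamH (tensor A H a k) = tensor_assoc H A H (tensor (H \<otimes> A) H (lam a) k)"
    by (simp add: lamH_def pure wf)
  show "tensor_map F H lamH id (right_cofree H A (tensor A H a k)) = rhoF (lamH (tensor A H a k))"
    by (simp add: l right_cofree_tensor wf 1 2)
qed (rule lin)+

lemma mem_right_cofree: "y \<in> carrier (A \<otimes> H) \<Longrightarrow> right_cofree H A y \<in> carrier ((A \<otimes> H) \<otimes> H)"
  using linear_mapD(1)[OF right_cofree_linear[OF algebra_A]] .

text \<open>
  The mirror image of \<open>emb_lam\<close>. The partial coassociativity of \<open>\<rho>\<close> is stated in
  \<open>A \<otimes> (H \<otimes> H)\<close> and has to be moved to \<open>(A \<otimes> H) \<otimes> H\<close> first.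
\<close>

lemma emb_rho:
  assumes [lin, wf]: "b \<in> carrier A"
  shows "tensor_map F H emb id (rho b) = mult (F \<otimes> H) (tensor F H (emb (one A)) (one H)) (rhoF (emb b))"
proof -
  let ?e = "tensor_map (A \<otimes> H) H rho id (rho b)" and ?i = "tensor_assoc_inv A H H"
  have hom: "alg_hom ((A \<otimes> H) \<otimes> H) (F \<otimes> H) (tensor_map F H lamH id)"
    by (rule tensor_map_alg_hom) (simp_all add: wf alg_hom_id lamH_hom)
  have "?e = ?i (tensor_assoc A H H ?e)"
    by (rule tensor_assoc_inv_assoc[symmetric]) (rule lin)+
  also have "\<dots> = mult ((A \<otimes> H) \<otimes> H) (?i (tensor_assoc A H H (tensor (A \<otimes> H) H (rho (one A)) (one H))))
     (right_cofree H A (rho b))"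
    unfolding rho_coassoc[OF assms] right_cofree_def
    by (rule alg_hom_mult[OF tensor_assoc_inv_alg_hom]) (rule lin)+
  also have "?i (tensor_assoc A H H (tensor (A \<otimes> H) H (rho (one A)) (one H)))
      = tensor (A \<otimes> H) H (rho (one A)) (one H)"
    by (rule tensor_assoc_inv_assoc) (rule lin)+
  finally have e: "?e = mult ((A \<otimes> H) \<otimes> H) (tensor (A \<otimes> H) H (rho (one A)) (one H))
      (right_cofree H A (rho b))" .
  have "tensor_map F H emb id (rho b) = tensor_map F H (\<lambda>a. lamH (rho a)) (\<lambda>h. id (id h)) (rho b)"
    by (rule tensor_map_cong) ((rule lin)+ | simp add: emb_eq)+
  also have "\<dots> = tensor_map F H lamH id ?e"
    by (rule tensor_map_comp[symmetric]) (rule lin)+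
  also have "\<dots> = mult (F \<otimes> H) (tensor_map F H lamH id (tensor (A \<otimes> H) H (rho (one A)) (one H)))
      (tensor_map F H lamH id (right_cofree H A (rho b)))"
    unfolding e by (rule alg_hom_mult[OF hom]) (simp_all add: wf mem_right_cofree)
  also have "\<dots> = mult (F \<otimes> H) (tensor F H (emb (one A)) (one H)) (rhoF (emb b))"
    by (simp add: pure wf emb_eq lamH_right_cofree)
  finally show ?thesis .
qed

lemma right_coaction_rhoF: "right_coaction H F rhoF"
  by (rule right_coaction_right_extended) (simp_all add: wf)

lemma left_coaction_lamF: "left_coaction H F lamF"
  by (rule left_coaction_left_cofree) (simp add: wf)

lemma lamF_hom: "alg_hom F (H \<otimes> F) lamF"
  using left_coaction_lamF by (simp add: left_coaction_def)

lemma rhoF_hom: "alg_hom F (F \<otimes> H) rhoF"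
  using right_coaction_rhoF by (simp add: right_coaction_def)

lemmas mem_lamF [lin, wf] = alg_hom_mem[OF lamF_hom]
  and mem_rhoF [lin, wf] = alg_hom_mem[OF rhoF_hom]

text \<open>
  The image of \<open>A\<close> is fixed by multiplication with \<open>1 \<otimes> \<rho>(1)\<close> from the right and with
  \<open>\<lambda>(1) \<otimes> 1\<close> from the left, because \<open>I \<otimes> \<rho>\<close> and \<open>\<lambda> \<otimes> I\<close> are multiplicative. The
  coactions of \<open>F\<close> carry this over.
\<close>

lemma lamF_emb:
  assumes [wf]: "a \<in> carrier A"
  shows "lamF (emb a) = mult (H \<otimes> F) (lamF (emb a)) (tensor H F (one H) e_rho)"
proof -
  have "lam a = mult (H \<otimes> A) (lam a) (tensor H A (one H) (one A))"
    using tensor_one_mult(2)[OF unital_H unital_A] by (simp add: wf)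
  from arg_cong[OF this, of "tensor_map H (A \<otimes> H) id rho"]
  have "emb a = mult F (emb a) e_rho"
    by (simp add: emb_def alg_hom_mult[OF id_rho_hom] wf pure)
  from arg_cong[OF this, of lamF]
  have "lamF (emb a) = mult (H \<otimes> F) (lamF (emb a)) (lamF e_rho)"
    by (simp add: alg_hom_mult[OF lamF_hom] wf)
  then show ?thesis
    by (simp add: pure wf comult_one)
qed

lemma rhoF_emb:
  assumes [wf]: "b \<in> carrier A"
  shows "rhoF (emb b) = mult (F \<otimes> H) (tensor F H e_lam (one H)) (rhoF (emb b))"
proof -
  let ?one = "tensor A H (one A) (one H)"
  have lamH_one: "lamH ?one = e_lam"
    by (simp add: lamH_def pure wf)
  have "rho b = mult (A \<otimes> H) ?one (rho b)"
    using tensor_one_mult(1)[OF unital_A unital_H] by (simp add: wf)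
  from arg_cong[OF this, of lamH]
  have "emb b = mult F (lamH ?one) (emb b)"
    by (simp add: emb_eq alg_hom_mult[OF lamH_hom] wf)
  from arg_cong[OF this, of rhoF]
  have "rhoF (emb b) = mult (F \<otimes> H) (rhoF (lamH ?one)) (rhoF (emb b))"
    by (simp add: alg_hom_mult[OF rhoF_hom] wf)
  moreover have "rhoF (lamH ?one) = tensor F H e_lam (one H)"
    using bspec[OF lamH_right_cofree, of ?one] lamH_one by (simp add: pure wf comult_one)
  ultimately show ?thesis by simp
qed

text \<open>
  The compatibility condition of a globalization, for \<open>F\<close> in place of the subalgebra generated by
  the image of \<open>A\<close>.
\<close>

lemma emb_condition:
  assumes [lin, wf]: "a \<in> carrier A" "b \<in> carrier A"
  shows "mult (H \<otimes> (F \<otimes> H))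
          (tensor_assoc H F H (tensor (H \<otimes> F) H (lamF (emb a)) (one H)))
          (tensor H (F \<otimes> H) (one H) (rhoF (emb b)))
        = tensor_map H (F \<otimes> H) id (tensor_map F H emb id)
            (mult (H \<otimes> (A \<otimes> H))
               (tensor_assoc H A H (tensor (H \<otimes> A) H (lam a) (one H)))
               (tensor H (A \<otimes> H) (one H) (rho b)))"
proof -
  \<comment> \<open>The embeddings \<open>x \<mapsto> x \<otimes> 1\<close> and \<open>y \<mapsto> 1 \<otimes> y\<close> into \<open>H \<otimes> (F \<otimes> H)\<close>.\<close>
  define L where "L x = tensor_assoc H F H (tensor (H \<otimes> F) H x (one H))" for x
  define R where "R y = tensor H (F \<otimes> H) (one H) y" for y
  let ?T = "H \<otimes> (F \<otimes> H)" and ?P = "tensor_map H (F \<otimes> H) id (tensor_map F H emb id)"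
  have L: "alg_hom (H \<otimes> F) ?T L"
    unfolding L_def
    by (rule alg_hom_comp[OF tensor_assoc_alg_hom alg_hom_tensor_one(1)[OF unital_H]])
        (simp_all add: wf)
  have R: "alg_hom (F \<otimes> H) ?T R"
    unfolding R_def by (rule alg_hom_tensor_one(2)[OF unital_H]) (simp add: wf)
  have P: "alg_hom F ?T ?P"
    by (rule tensor_map_alg_hom) (simp_all add: wf alg_hom_id emb_hom tensor_map_alg_hom)
  have LR: "L (tensor H F (one H) f) = R (tensor F H f (one H))" if "f \<in> carrier F" for f
    using that by (simp add: L_def R_def pure wf)
  have PL: "?P (tensor_assoc H A H (tensor (H \<otimes> A) H x (one H))) = L (tensor_map H F id emb x)"
    if [lin, wf]: "x \<in> carrier (H \<otimes> A)" for x
    using tensor_assoc_natural[of "tensor (H \<otimes> A) H x (one H)" H A H H H id F emb id]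
    by (simp add: L_def wf pure)
  have PR: "?P (tensor H (A \<otimes> H) (one H) y) = R (tensor_map F H emb id y)"
    if "y \<in> carrier (A \<otimes> H)" for y
    using that by (simp add: R_def pure wf)
  note [wf] = alg_hom_mem[OF L] alg_hom_mem[OF R]
  let ?l = "lamF (emb a)" and ?r = "rhoF (emb b)" and ?e = "R (tensor F H (emb (one A)) (one H))"
  have e_mem [wf]: "tensor H F (one H) e_rho \<in> carrier (H \<otimes> F)" "tensor F H e_lam (one H)
      \<in> carrier (F \<otimes> H)"
    "e_lam \<in> carrier F" "tensor_assoc H A H (tensor (H \<otimes> A) H (lam a) (one H)) \<in> carrier F"
    by (rule lin)+
  have mult_F: "mult (F \<otimes> H) (tensor F H f (one H)) (tensor F H g (one H))
      = tensor F H (mult F f g) (one H)"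
    if "f \<in> carrier F" "g \<in> carrier F" for f g
    using that by (simp add: mult_tensor wf mult_one)
  have idem: "mult ?T ?e ?e = ?e"
    using alg_hom_mult[OF R, symmetric] alg_hom_mult[OF emb_hom, symmetric]
        by (simp add: wf mult_F mult_one)
  \<comment> \<open>The factors \<open>1 \<otimes> 1 \<otimes> \<rho>(1) \<otimes> 1\<close> and \<open>1 \<otimes> \<lambda>(1) \<otimes> 1 \<otimes> 1\<close> split off from the two sides of
    the product, and they multiply to the idempotent \<open>1 \<otimes> \<theta>(1) \<otimes> 1\<close>.\<close>
  have l_split: "L ?l = mult ?T (L ?l) (R (tensor F H e_rho (one H)))"
    using arg_cong[OF lamF_emb, of a L] by (simp add: alg_hom_mult[OF L] wf LR)
  have r_split: "R ?r = mult ?T (R (tensor F H e_lam (one H))) (R ?r)"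
    using arg_cong[OF rhoF_emb, of b R] by (simp add: alg_hom_mult[OF R] wf)
  have e_split: "mult ?T (R (tensor F H e_rho (one H))) (R (tensor F H e_lam (one H))) = ?e"
    using alg_hom_mult[OF R, symmetric] by (simp add: wf mult_F emb_one)
  have "mult ?T (L ?l) (R ?r) = mult ?T (mult ?T (L ?l) (R (tensor F H e_rho (one H))))
      (mult ?T (R (tensor F H e_lam (one H))) (R ?r))"
    using l_split r_split by (rule arg_cong2)
  also have "\<dots> = mult ?T (mult ?T (L ?l)
      (mult ?T (R (tensor F H e_rho (one H))) (R (tensor F H e_lam (one H))))) (R ?r)"
    by (simp add: algebra_mult_assoc wf)
  also have "\<dots> = mult ?T (mult ?T (L ?l) ?e) (R ?r)"
    unfolding e_split ..
  also have "\<dots> = mult ?T (mult ?T (L ?l) ?e) (mult ?T ?e (R ?r))"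
    by (subst idem[symmetric]) (simp add: algebra_mult_assoc wf)
  also have "\<dots> = mult ?T (L (tensor_map H F id emb (lam a))) (R (tensor_map F H emb id (rho b)))"
    by (simp add: emb_lam emb_rho alg_hom_mult[OF L] alg_hom_mult[OF R] wf LR)
  also have "\<dots> = ?P (mult F (tensor_assoc H A H (tensor (H \<otimes> A) H (lam a) (one H)))
               (tensor H (A \<otimes> H) (one H) (rho b)))"
    by (subst alg_hom_mult[OF P]) (simp_all add: wf PL PR)
  finally show ?thesis by (simp add: L_def R_def)
qed

end

section \<open>Restriction to a stable subalgebra\<close>

lemma linear_projection:
  assumes V: "vspace V" and M: "module.subspace (scl V) M" "M \<subseteq> carrier V"
  obtains \<pi> where "linear_map V (V\<lparr>carrier := M\<rparr>) \<pi>" "\<And>m. m \<in> M \<Longrightarrow> \<pi> m = m"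
proof -
  interpret vector_space "scl V" using V by (simp add: vspace_def)
  interpret P: vector_space_pair "scl V" "scl V" ..
  have id: "Vector_Spaces.linear (scl V) (scl V) (\<lambda>x. x)"
    by unfold_locales auto
  obtain g where g: "range g \<subseteq> M" "Vector_Spaces.linear (scl V) (scl V) g" "\<forall>m\<in>M. g m = m"
    using P.linear_exists_left_inverse_on[OF id M(1)] by auto
  interpret g: Vector_Spaces.linear "scl V" "scl V" g by (rule g)
  have "linear_map V (V\<lparr>carrier := M\<rparr>) g"
    using g(1) by (auto simp: linear_map_def g.add g.scale)
  with g(3) that show ?thesis by blast
qed

text \<open>A map is a homomorphism if its composite with some injective homomorphism is one.\<close>

lemma alg_hom_factor:
  assumes [wf]: "vspace V" "algebra W" and \<iota>: "alg_hom W X \<iota>" "inj_on \<iota> (carrier W)"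
      and g: "alg_hom V X g"
    and f: "\<And>v. v \<in> carrier V \<Longrightarrow> f v \<in> carrier W" "\<And>v. v \<in> carrier V \<Longrightarrow> \<iota> (f v) = g v"
    and mult: "\<And>x y. x \<in> carrier V \<Longrightarrow> y \<in> carrier V \<Longrightarrow> mult V x y \<in> carrier V"
  shows "alg_hom V W f"
proof -
  note V = vspace_subspace[of V, OF assms(1)]
  note W = vspace_subspace[of W, OF algebra_vspace[OF assms(2)]]
  note \<iota>lin = linear_mapD[OF alg_hom_linear[OF \<iota>(1)]] and glin = linear_mapD[OF alg_hom_linear[OF g]]
  have "f (x + y) = f x + f y" if "x \<in> carrier V" "y \<in> carrier V" for x y
    by (rule inj_onD[OF \<iota>(2)]) (use that in \<open>simp_all add: V W f \<iota>lin glin\<close>)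
  moreover have "f (scl V c x) = scl W c (f x)" if "x \<in> carrier V" for x c
    by (rule inj_onD[OF \<iota>(2)]) (use that in \<open>simp_all add: V W f \<iota>lin glin\<close>)
  moreover have "f (mult V x y) = mult W (f x) (f y)" if "x \<in> carrier V" "y \<in> carrier V" for x y
    by (rule inj_onD[OF \<iota>(2)]) (use that in \<open>simp_all add: mult f wf alg_hom_mult[OF \<iota>(1)]
        alg_hom_mult[OF g]\<close>)
  ultimately show ?thesis using f(1) by (simp add: alg_hom_def linear_map_def)
qed

text \<open>
  Let \<open>p\<close> and \<open>q\<close> be linear projections of \<open>V\<close> and \<open>W\<close> onto \<open>V'\<close> and \<open>W'\<close>. They map tensors over \<open>V\<close>
  and \<open>W\<close> to tensors over \<open>V'\<close> and \<open>W'\<close>; on the span of the pure tensors of elements of \<open>V'\<close> and \<open>W'\<close>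
  this is inverted by the inclusion.
\<close>

lemma tensor_map_retract:
  fixes V :: "('k::field, 'v::ab_group_add, 'm) alg_scheme"
    and W :: "('k, 'w::ab_group_add, 'n) alg_scheme"
  assumes V: "linear_map V' V (\<lambda>x. x)" "linear_map V V' p" "\<And>v. v \<in> carrier V' \<Longrightarrow> p v = v"
    and W: "linear_map W' W (\<lambda>x. x)" "linear_map W W' q" "\<And>w. w \<in> carrier W' \<Longrightarrow> q w = w"
    and x: "x \<in> tensor_span V W (carrier V') (carrier W')"
  shows "tensor_map V W (\<lambda>x. x) (\<lambda>x. x) (tensor_map V' W' p q x) = x"
proof -
  let ?f = "\<lambda>x. tensor_map V W (\<lambda>x. x) (\<lambda>x. x) (tensor_map V' W' p q x)"
  have add: "?f (x + y) = ?f x + ?f y" and scl: "?f (tensor_scl c x) = tensor_scl c (?f x)" for x y c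
    by (auto simp: tensor_map_def tensor_scl_def fun_eq_iff)
  have pure: "?f (tensor V W v w) = tensor V W v w" if "v \<in> carrier V'" "w \<in> carrier W'" for v w
    using that tensor_map_tensor[OF V(2) W(2), of v w] tensor_map_tensor[OF V(1) W(1), of v w]
      linear_mapD(1)[OF V(1)] linear_mapD(1)[OF W(1)] V(3) W(3) by simp
  show ?thesis
    using x unfolding tensor_span_def
  proof (induction rule: tensor_vs.span_induct_alt)
    case base
    show ?case by (auto simp: tensor_map_def fun_eq_iff)
  next
    case (step c x y)
    then show ?case using pure by (auto simp only: add scl)
  qed
qed

text \<open>
  A subalgebra \<open>M\<close> of a bicomodule algebra \<open>F\<close> that is stable under both coactions, together with a
  linear projection of \<open>F\<close> onto \<open>M\<close>. Tensors over \<open>F\<close> are functionals on forms on \<open>F\<close>, so the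
  coactions do not restrict to \<open>M\<close> literally; the projection converts their values to
  tensors over \<open>M\<close>.
\<close>

locale stable_subalgebra = hopf H for H :: "('k::field, 'h::ab_group_add) hopf" +
  fixes lamF :: "'f::ab_group_add \<Rightarrow> ('k, 'h, 'f) tensor"
    and F :: "('k, 'f) alg"
    and rhoF :: "'f \<Rightarrow> ('k, 'f, 'h) tensor"
    and M :: "'f set" and \<pi> :: "'f \<Rightarrow> 'f"
  assumes F: "bicomodule_algebra H lamF F rhoF"
    and M: "subalgebra F M"
    and rhoF_M: "rhoF ` M \<subseteq> tensor_span F H M (carrier H)"
    and lamF_M: "lamF ` M \<subseteq> tensor_span H F (carrier H) M"
    and \<pi>_linear': "linear_map F (F\<lparr>carrier := M\<rparr>) \<pi>" and \<pi>: "\<And>m. m \<in> M \<Longrightarrow> \<pi> m = m"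
begin

text \<open>The algebra \<open>M\<close> and its two coactions.\<close>

definition B :: "('k, 'f) alg" where "B = F\<lparr>carrier := M\<rparr>"
definition rhoB :: "'f \<Rightarrow> ('k, 'f, 'h) tensor" where "rhoB b = tensor_map B H \<pi> id (rhoF b)"
definition lamB :: "'f \<Rightarrow> ('k, 'h, 'f) tensor" where "lamB b = tensor_map H B id \<pi> (lamF b)"

lemma B_simps: "carrier B = M" "scl B = scl F" "mult B = mult F"
  by (simp_all add: B_def)

lemma algebra_F [lin, wf]: "algebra F"
  using F by (simp add: bicomodule_algebra_iff)

lemma M_subset_F: "M \<subseteq> carrier F"
  using M by (simp add: subalgebra_def)

lemma algebra_B [lin, wf]: "algebra B"
  using M algebra_F
  by (auto simp: algebra_def B_simps subalgebra_def vspace_def bilinear_map_def linear_map_def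
      module.subspace_def vector_space_def subset_iff module_iff_vector_space)

lemma incl_hom: "alg_hom B F (\<lambda>x. x)"
  using M_subset_F by (auto simp: alg_hom_def linear_map_def B_simps)

lemmas incl_linear [lin, wf] = alg_hom_linear[OF incl_hom]

lemma \<pi>_linear [lin, wf]: "linear_map F B \<pi>"
  using \<pi>_linear' by (simp add: B_def)

lemma \<pi>_B: "linear_map B B \<pi>"
  by (rule lin_comp[OF \<pi>_linear incl_linear])

lemma right_F: "right_coaction H F rhoF" and left_F: "left_coaction H F lamF"
  and commute_F: "coactions_commute H lamF F rhoF"
  using F by (simp_all add: bicomodule_algebra_iff)

lemma rhoF_hom: "alg_hom F (F \<otimes> H) rhoF" and lamF_hom: "alg_hom F (H \<otimes> F) lamF"
  using right_F left_F by (simp_all add: right_coaction_def left_coaction_def)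

lemmas rhoF_linear [lin, wf] = alg_hom_linear[OF rhoF_hom]
  and lamF_linear [lin, wf] = alg_hom_linear[OF lamF_hom]
lemmas lin_rhoF [lin] = lin_comp[OF rhoF_linear]
  and lin_lamF [lin] = lin_comp[OF lamF_linear]
  and mem_rhoF [lin, wf] = linear_mapD(1)[OF rhoF_linear]
  and mem_lamF [lin, wf] = linear_mapD(1)[OF lamF_linear]

text \<open>The inclusions of \<open>B \<otimes> H\<close> into \<open>F \<otimes> H\<close> and of \<open>H \<otimes> B\<close> into \<open>H \<otimes> F\<close>.\<close>

abbreviation "incR \<equiv> tensor_map F H (\<lambda>x. x) (\<lambda>x. x)"
abbreviation "incL \<equiv> tensor_map H F (\<lambda>x. x) (\<lambda>x. x)"

lemma B_in_F [wf]: "b \<in> carrier B \<Longrightarrow> b \<in> carrier F"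
  using M_subset_F by (auto simp: B_simps)

lemma incR_rhoB: "b \<in> carrier B \<Longrightarrow> incR (rhoB b) = rhoF b"
  using rhoF_M unfolding rhoB_def
  by (intro tensor_map_retract) (auto simp: wf B_simps \<pi>)

lemma incL_lamB: "b \<in> carrier B \<Longrightarrow> incL (lamB b) = lamF b"
  using lamF_M unfolding lamB_def
  by (intro tensor_map_retract) (auto simp: wf B_simps \<pi>)

lemma inc_inj:
  "inj_on incR (carrier (B \<otimes> H))" "inj_on incL (carrier (H \<otimes> B))"
  by (rule tensor_map_inj[where f'=\<pi> and g'="\<lambda>x. x"] tensor_map_inj[where f'="\<lambda>x. x" and g'=\<pi>];
      simp add: wf \<pi> B_simps(1))+

lemma inc_hom:
  "alg_hom (B \<otimes> H) (F \<otimes> H) incR" "alg_hom (H \<otimes> B) (H \<otimes> F) incL"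
  by (rule tensor_map_alg_hom; simp add: wf alg_hom_ident incl_hom)+

lemma mem_rhoB: "b \<in> carrier F \<Longrightarrow> rhoB b \<in> carrier (B \<otimes> H)"
  unfolding rhoB_def by (assumption | rule lin)+

lemma mem_lamB: "b \<in> carrier F \<Longrightarrow> lamB b \<in> carrier (H \<otimes> B)"
  unfolding lamB_def by (assumption | rule lin)+

lemma rhoB_hom: "alg_hom B (B \<otimes> H) rhoB"
  by (rule alg_hom_factor[OF _ _ inc_hom(1) inc_inj(1) alg_hom_comp[OF rhoF_hom incl_hom]])
    (simp_all add: wf mem_rhoB incR_rhoB)

lemma lamB_hom: "alg_hom B (H \<otimes> B) lamB"
  by (rule alg_hom_factor[OF _ _ inc_hom(2) inc_inj(2) alg_hom_comp[OF lamF_hom incl_hom]])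
    (simp_all add: wf mem_lamB incL_lamB)

lemmas rhoB_linear [lin, wf] = alg_hom_linear[OF rhoB_hom]
  and lamB_linear [lin, wf] = alg_hom_linear[OF lamB_hom]
declare linear_mapD(1)[OF rhoB_linear, lin, wf] linear_mapD(1)[OF lamB_linear, lin, wf]

text \<open>
  Each axiom is an equation in a tensor product that involves \<open>B\<close>. It is verified after applying the
  injective map into the corresponding tensor product that involves \<open>F\<close>.
\<close>

lemma right_coaction_B: "right_coaction H B rhoB"
proof -
  have "tensor_map B ground id (counit H) (rhoB b) = tensor B ground b 1"
      if b [lin, wf]: "b \<in> carrier B" for b
  proof (rule inj_onD[OF tensor_map_inj[where f="\<lambda>x. x" and f'=\<pi> and g="\<lambda>x. x" and g'="\<lambda>x. x"
        and V'=F and W'=ground]])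
    have "tensor_map F ground (\<lambda>x. x) (\<lambda>x. x) (tensor_map B ground id (counit H) (rhoB b))
        = tensor_map F ground id (counit H) (incR (rhoB b))"
      by (simp add: tensor_map_comp wf id_def)
    also have "\<dots> = tensor F ground b 1"
      using right_F by (simp add: incR_rhoB wf right_coaction_def)
    finally show "tensor_map F ground (\<lambda>x. x) (\<lambda>x. x) (tensor_map B ground id (counit H) (rhoB b))
        = tensor_map F ground (\<lambda>x. x) (\<lambda>x. x) (tensor B ground b 1)"
      by (simp add: pure wf)
  qed ((rule lin)+ | simp add: \<pi> B_simps(1))+
  moreover have "tensor_assoc B H H (tensor_map (B \<otimes> H) H rhoB id (rhoB b))
          = tensor_map B (H \<otimes> H) id (comult H) (rhoB b)" if b [lin, wf]: "b \<in> carrier B" for b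
  proof (rule inj_onD[OF tensor_map_inj[where f="\<lambda>x. x" and f'=\<pi> and g="tensor_map H H (\<lambda>x. x) (\<lambda>x. x)"
        and g'="\<lambda>x. x" and V'=F and W'="H \<otimes> H"]])
    let ?\<iota> = "tensor_map F (H \<otimes> H) (\<lambda>x. x) (tensor_map H H (\<lambda>x. x) (\<lambda>x. x))"
    let ?z = "tensor_map (B \<otimes> H) H rhoB id (rhoB b)"
    have "?\<iota> (tensor_assoc B H H ?z) = tensor_assoc F H H (tensor_map (F \<otimes> H) H incR (\<lambda>x. x) ?z)"
      by (rule tensor_assoc_natural[symmetric]) (rule lin)+
    also have "tensor_map (F \<otimes> H) H incR (\<lambda>x. x) ?z
        = tensor_map (F \<otimes> H) H (\<lambda>b. incR (rhoB b)) (\<lambda>h. id h) (rhoB b)"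
      by (rule tensor_map_comp) (rule lin)+
    also have "\<dots> = tensor_map (F \<otimes> H) H (\<lambda>b. rhoF b) (\<lambda>h. id h) (rhoB b)"
      by (rule tensor_map_cong) ((rule lin)+ | simp add: incR_rhoB)+
    also have "\<dots> = tensor_map (F \<otimes> H) H rhoF id (incR (rhoB b))"
      by (rule tensor_map_comp[symmetric]) (rule lin)+
    also have "tensor_assoc F H H \<dots> = tensor_map F (H \<otimes> H) id (comult H) (rhoF b)"
      using right_F by (simp add: incR_rhoB wf right_coaction_def)
    also have "\<dots> = tensor_map F (H \<otimes> H) id (comult H) (incR (rhoB b))"
      by (simp add: incR_rhoB wf)
    also have "\<dots> = tensor_map F (H \<otimes> H) (\<lambda>x. id x) (\<lambda>h. comult H h) (rhoB b)"
      by (rule tensor_map_comp) (rule lin)+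
    also have "\<dots> = tensor_map F (H \<otimes> H) (\<lambda>x. id x)
        (\<lambda>h. tensor_map H H (\<lambda>x. x) (\<lambda>x. x) (comult H h)) (rhoB b)"
      by (rule tensor_map_cong) ((rule lin)+ | simp add: tensor_map_ident wf)+
    also have "\<dots> = ?\<iota> (tensor_map B (H \<otimes> H) id (comult H) (rhoB b))"
      by (rule tensor_map_comp[symmetric]) (rule lin)+
    finally show "?\<iota> (tensor_assoc B H H ?z) = ?\<iota> (tensor_map B (H \<otimes> H) id (comult H) (rhoB b))" .
  qed ((rule lin)+ | simp add: \<pi> B_simps(1) tensor_map_ident)+
  ultimately show ?thesis by (simp add: right_coaction_def rhoB_hom)
qed

lemma left_coaction_B: "left_coaction H B lamB"
proof -
  have "tensor_map ground B (counit H) id (lamB b) = tensor ground B 1 b"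
      if b [lin, wf]: "b \<in> carrier B" for b
  proof (rule inj_onD[OF tensor_map_inj[where f="\<lambda>x. x" and f'="\<lambda>x. x" and g="\<lambda>x. x" and g'=\<pi>
        and V'=ground and W'=F]])
    have "tensor_map ground F (\<lambda>x. x) (\<lambda>x. x) (tensor_map ground B (counit H) id (lamB b))
        = tensor_map ground F (counit H) id (incL (lamB b))"
      by (simp add: tensor_map_comp wf id_def)
    also have "\<dots> = tensor ground F 1 b"
      using left_F by (simp add: incL_lamB wf left_coaction_def)
    finally show "tensor_map ground F (\<lambda>x. x) (\<lambda>x. x) (tensor_map ground B (counit H) id (lamB b))
        = tensor_map ground F (\<lambda>x. x) (\<lambda>x. x) (tensor ground B 1 b)"
      by (simp add: pure wf)
  qed ((rule lin)+ | simp add: \<pi> B_simps(1))+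
  moreover have "tensor_map H (H \<otimes> B) id lamB (lamB b)
          = tensor_assoc H H B (tensor_map (H \<otimes> H) B (comult H) id (lamB b))"
              if b [lin, wf]: "b \<in> carrier B" for b
  proof (rule inj_onD[OF tensor_map_inj[where f="\<lambda>x. x" and f'="\<lambda>x. x" and g=incL
        and g'="tensor_map H B (\<lambda>x. x) \<pi>" and V'=H and W'="H \<otimes> F"]])
    let ?\<iota> = "tensor_map H (H \<otimes> F) (\<lambda>x. x) incL"
    let ?z = "tensor_map (H \<otimes> H) B (comult H) id (lamB b)"
    have "?\<iota> (tensor_assoc H H B ?z)
        = tensor_assoc H H F (tensor_map (H \<otimes> H) F (tensor_map H H (\<lambda>x. x) (\<lambda>x. x)) (\<lambda>x. x) ?z)"
      by (rule tensor_assoc_natural[symmetric]) (rule lin)+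
    also have "tensor_map (H \<otimes> H) F (tensor_map H H (\<lambda>x. x) (\<lambda>x. x)) (\<lambda>x. x) ?z
        = tensor_map (H \<otimes> H) F (\<lambda>h. tensor_map H H (\<lambda>x. x) (\<lambda>x. x) (comult H h)) (\<lambda>x. id x) (lamB b)"
      by (rule tensor_map_comp) (rule lin)+
    also have "\<dots> = tensor_map (H \<otimes> H) F (\<lambda>h. comult H h) (\<lambda>x. id x) (lamB b)"
      by (rule tensor_map_cong) ((rule lin)+ | simp add: tensor_map_ident wf)+
    also have "\<dots> = tensor_map (H \<otimes> H) F (comult H) id (incL (lamB b))"
      by (rule tensor_map_comp[symmetric]) (rule lin)+
    also have "tensor_assoc H H F \<dots> = tensor_map H (H \<otimes> F) id lamF (incL (lamB b))"
      using left_F by (simp add: incL_lamB wf left_coaction_def)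
    also have "\<dots> = tensor_map H (H \<otimes> F) (\<lambda>h. id h) (\<lambda>x. lamF x) (lamB b)"
      by (rule tensor_map_comp) (rule lin)+
    also have "\<dots> = tensor_map H (H \<otimes> F) (\<lambda>h. id h) (\<lambda>x. incL (lamB x)) (lamB b)"
      by (rule tensor_map_cong) ((rule lin)+ | simp add: incL_lamB)+
    also have "\<dots> = ?\<iota> (tensor_map H (H \<otimes> B) id lamB (lamB b))"
      by (rule tensor_map_comp[symmetric]) (rule lin)+
    finally show "?\<iota> (tensor_map H (H \<otimes> B) id lamB (lamB b)) = ?\<iota> (tensor_assoc H H B ?z)" by (rule sym)
  next
    fix w assume w: "w \<in> carrier (H \<otimes> B)"
    have "tensor_map H B (\<lambda>x. x) \<pi> (incL w) = tensor_map H B (\<lambda>x. x) (\<lambda>x. \<pi> x) w"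
      by (rule tensor_map_comp) (rule lin)+
    also have "\<dots> = tensor_map H B (\<lambda>x. x) (\<lambda>x. x) w"
      by (rule tensor_map_cong[OF w]) ((rule lin \<pi>_B)+ | simp add: \<pi> B_simps(1))+
    finally show "tensor_map H B (\<lambda>x. x) \<pi> (incL w) = w" using w by (simp add: tensor_map_ident)
  qed ((rule lin)+ | simp)+
  ultimately show ?thesis by (simp add: left_coaction_def lamB_hom)
qed

text \<open>The inclusion of \<open>H \<otimes> B \<otimes> H\<close> into \<open>H \<otimes> F \<otimes> H\<close>.\<close>

abbreviation "incLR \<equiv> tensor_map H (F \<otimes> H) (\<lambda>x. x) incR"

lemma incLR_inj: "inj_on incLR (carrier (H \<otimes> (B \<otimes> H)))"
proof (rule tensor_map_inj[where f'="\<lambda>x. x" and g'="tensor_map B H \<pi> (\<lambda>x. x)"])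
  fix w assume w: "w \<in> carrier (B \<otimes> H)"
  have "tensor_map B H \<pi> (\<lambda>x. x) (incR w) = tensor_map B H (\<lambda>x. \<pi> x) (\<lambda>x. x) w"
    by (rule tensor_map_comp) (rule lin)+
  also have "\<dots> = tensor_map B H (\<lambda>x. x) (\<lambda>x. x) w"
    by (rule tensor_map_cong[OF w]) ((rule lin \<pi>_B)+ | simp add: \<pi> B_simps(1))+
  finally show "tensor_map B H \<pi> (\<lambda>x. x) (incR w) = w" using w by (simp add: tensor_map_ident)
qed ((rule lin)+ | simp)+

lemma incLR_hom: "alg_hom (H \<otimes> (B \<otimes> H)) (H \<otimes> (F \<otimes> H)) incLR"
  by (rule tensor_map_alg_hom; simp add: wf alg_hom_ident inc_hom)

lemma incLR_assoc:
  assumes [lin]: "z \<in> carrier ((H \<otimes> B) \<otimes> H)"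
  shows "incLR (tensor_assoc H B H z) = tensor_assoc H F H (tensor_map (H \<otimes> F) H incL (\<lambda>x. x) z)"
  by (rule tensor_assoc_natural[symmetric]) (rule lin)+

lemma coactions_commute_B: "coactions_commute H lamB B rhoB"
  unfolding coactions_commute_def
proof
  fix b assume b [lin, wf]: "b \<in> carrier B"
  show "tensor_map H (B \<otimes> H) id rhoB (lamB b)
          = tensor_assoc H B H (tensor_map (H \<otimes> B) H lamB id (rhoB b))"
  proof (rule inj_onD[OF incLR_inj])
    let ?z = "tensor_map (H \<otimes> B) H lamB id (rhoB b)"
    have "incLR (tensor_map H (B \<otimes> H) id rhoB (lamB b))
        = tensor_map H (F \<otimes> H) (\<lambda>h. id h) (\<lambda>b. incR (rhoB b)) (lamB b)"
      by (rule tensor_map_comp) (rule lin)+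
    also have "\<dots> = tensor_map H (F \<otimes> H) (\<lambda>h. id h) (\<lambda>b. rhoF b) (lamB b)"
      by (rule tensor_map_cong) ((rule lin)+ | simp add: incR_rhoB)+
    also have "\<dots> = tensor_map H (F \<otimes> H) id rhoF (incL (lamB b))"
      by (rule tensor_map_comp[symmetric]) (rule lin)+
    also have "\<dots> = tensor_assoc H F H (tensor_map (H \<otimes> F) H lamF id (incR (rhoB b)))"
      using commute_F by (simp add: incL_lamB incR_rhoB wf coactions_commute_def)
    also have "tensor_map (H \<otimes> F) H lamF id (incR (rhoB b))
        = tensor_map (H \<otimes> F) H (\<lambda>b. lamF b) (\<lambda>h. id h) (rhoB b)"
      by (rule tensor_map_comp) (rule lin)+
    also have "\<dots> = tensor_map (H \<otimes> F) H (\<lambda>b. incL (lamB b)) (\<lambda>h. id h) (rhoB b)"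
      by (rule tensor_map_cong) ((rule lin)+ | simp add: incL_lamB)+
    also have "\<dots> = tensor_map (H \<otimes> F) H incL (\<lambda>x. x) ?z"
      by (rule tensor_map_comp[symmetric]) (rule lin)+
    also have "tensor_assoc H F H \<dots> = incLR (tensor_assoc H B H ?z)"
      by (rule incLR_assoc[symmetric]) (rule lin)+
    finally show "incLR (tensor_map H (B \<otimes> H) id rhoB (lamB b)) = incLR (tensor_assoc H B H ?z)" .
  qed (rule lin)+
qed

lemma bicomodule_algebra_B: "bicomodule_algebra H lamB B rhoB"
  by (simp add: bicomodule_algebra_iff wf right_coaction_B left_coaction_B coactions_commute_B)

end

section \<open>Slices of tensors\<close>

text \<open>
  The exchange of the two factors. No test for bilinearity is needed, since a form is bilinear if and
  only if the form with exchanged arguments is.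
\<close>

definition tensor_swap :: "('k::field, 'v, 'w) tensor \<Rightarrow> ('k, 'w, 'v) tensor" where
  "tensor_swap x = (\<lambda>\<phi>. x (\<lambda>v w. \<phi> w v))"

lemma tensor_swap_tensor: "tensor_swap (tensor V W v w) = tensor W V w v"
  by (auto simp: tensor_swap_def tensor_def bilinear_map_def fun_eq_iff)

lemma tensor_swap_swap: "tensor_swap (tensor_swap x) = x"
  by (simp add: tensor_swap_def)

lemma tensor_swap_add: "tensor_swap (x + y) = tensor_swap x + tensor_swap y"
  and tensor_swap_scl: "tensor_swap (tensor_scl c x) = tensor_scl c (tensor_swap x)"
  and tensor_swap_zero: "tensor_swap 0 = 0"
  by (auto simp: tensor_swap_def tensor_scl_def)

lemma tensor_swap_span:
  assumes "x \<in> tensor_span V W S T"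
  shows "tensor_swap x \<in> tensor_span W V T S"
  using assms unfolding tensor_span_def
proof (induction rule: tensor_vs.span_induct_alt)
  case base
  show ?case by (simp only: tensor_swap_zero tensor_vs.span_zero)
next
  case (step c x y)
  have "tensor_swap x \<in> {tensor W V w v |w v. w \<in> T \<and> v \<in> S}"
    using step(1) tensor_swap_tensor by blast
  from tensor_vs.span_scale[OF tensor_vs.span_base[OF this]] step(2)
  show ?case by (simp only: tensor_swap_add tensor_swap_scl tensor_vs.span_add)
qed

text \<open>
  The slices \<open>(I \<otimes> f)x\<close> and \<open>(f \<otimes> I)x\<close> of a tensor by a linear functional \<open>f\<close> on one of the
  factors, after identification of \<open>V\<close> and \<open>W\<close> with their tensor products with the base field.
\<close>

definition slice_right ::
  "('k::field, 'v::ab_group_add, 'm) alg_scheme \<Rightarrow> ('k, 'w::ab_group_add, 'n) alg_scheme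
    \<Rightarrow> ('w \<Rightarrow> 'k) \<Rightarrow> ('k, 'v, 'w) tensor \<Rightarrow> 'v" where
  "slice_right V W f = tensor_lift V W V (\<lambda>v w. scl V (f w) v)"

definition slice_left ::
  "('k::field, 'v::ab_group_add, 'm) alg_scheme \<Rightarrow> ('k, 'w::ab_group_add, 'n) alg_scheme
    \<Rightarrow> ('v \<Rightarrow> 'k) \<Rightarrow> ('k, 'v, 'w) tensor \<Rightarrow> 'w" where
  "slice_left V W f x = slice_right W V f (tensor_swap x)"

lemma slice_right:
  assumes V: "vspace V" and f: "linear_map W ground f"
  shows slice_right_linear: "linear_map (V \<otimes> W) V (slice_right V W f)"
    and slice_right_tensor: "\<And>v w. v \<in> carrier V \<Longrightarrow> w \<in> carrier W
      \<Longrightarrow> slice_right V W f (tensor V W v w) = scl V (f w) v"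
proof -
  interpret V: vector_space "scl V" using V by (simp add: vspace_def)
  have "bilinear_map V W V (\<lambda>v w. scl V (f w) v)"
    using f vspace_subspace[OF V]
    by (simp add: bilinear_map_def linear_map_def V.scale_left_distrib
        V.scale_right_distrib mult.commute)
  note tensor_lift[OF V this, folded slice_right_def]
  then show "linear_map (V \<otimes> W) V (slice_right V W f)" "\<And>v w. v \<in> carrier V \<Longrightarrow> w \<in> carrier W
      \<Longrightarrow> slice_right V W f (tensor V W v w) = scl V (f w) v" by blast+
qed

text \<open>
  A tensor is the sum of its slices by the coordinate functionals of a basis of the second factor,
  tensored with the corresponding basis vectors.
\<close>

lemma tensor_eq_sum_slices:
  assumes V [lin]: "vspace V" and W: "vspace W" and x: "x \<in> carrier (V \<otimes> W)"
  shows "\<exists>T f. finite T \<and> T \<subseteq> carrier W \<and> (\<forall>b\<in>T. linear_map W ground (f b)) \<and>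
    x = (\<Sum>b\<in>T. tensor V W (slice_right V W (f b) x) b)"
proof -
  interpret W: vector_space "scl W" using W by (simp add: vspace_def)
  have sub: "W.subspace (carrier W)" using W by (simp add: vspace_def)
  obtain E where E: "E \<subseteq> carrier W" "W.independent E" "carrier W \<subseteq> W.span E"
    using W.basis_exists[of "carrier W"] by metis
  have span: "w \<in> W.span E" if "w \<in> carrier W" for w using E that by blast
  \<comment> \<open>With \<open>G T\<close> the sum over the basis vectors in \<open>T\<close>, the equation \<open>G T x = x\<close> is linear in \<open>x\<close> once
    it is claimed for all sufficiently large \<open>T\<close>.\<close>
  define c where "c b w = W.representation E w b" for b w
  have c: "linear_map W ground (c b)" for b
    by (simp add: linear_map_def c_def W.representation_add W.representation_scale E(2) span)
  define G where "G T x = (\<Sum>b\<in>T. tensor V W (slice_right V W (c b) x) b)" for T x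
  have G: "linear_map (V \<otimes> W) (V \<otimes> W) (G T)" if "finite T" "T \<subseteq> E" for T
    unfolding G_def
    by (rule linear_map_sum_fun[OF vspace_tensor that(1)])
      (use that E(1) in \<open>auto intro!: lin_tensor_left slice_right_linear V c\<close>)
  have "\<exists>T. finite T \<and> T \<subseteq> E \<and> (\<forall>T'. finite T' \<longrightarrow> T \<subseteq> T' \<longrightarrow> T' \<subseteq> E \<longrightarrow> G T' x = x)"
    using x
  proof (induction rule: tensor_induct)
    case zero
    have "G T' 0 = 0" if "finite T'" "T' \<subseteq> E" for T'
      by (rule linear_map_0[OF G[OF that] vspace_tensor vspace_tensor])
    then show ?case by blast
  next
    case (step k v w y)
    then obtain T where T: "finite T" "T \<subseteq> E" "\<And>T'. finite T' \<Longrightarrow> T \<subseteq> T' \<Longrightarrow> T' \<subseteq> E \<Longrightarrow> G T' y = y"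
      by blast
    define S where "S = {b. c b w \<noteq> 0}"
    have S: "finite S" "S \<subseteq> E" "(\<Sum>b\<in>S. scl W (c b w) b) = w"
      using W.finite_representation[of E w] W.representation_ne_zero[of E w]
        W.sum_nonzero_representation_eq[OF E(2) span[OF step(2)]]
      by (auto simp: S_def c_def)
    have "G T' (tensor_scl k (tensor V W v w) + y) = tensor_scl k (tensor V W v w) + y"
      if T': "finite T'" "S \<union> T \<subseteq> T'" "T' \<subseteq> E" for T'
    proof -
      have t: "tensor V W v w \<in> carrier (V \<otimes> W)" by (rule tensor_in_carrier) fact+
      have t': "tensor_scl k (tensor V W v w) \<in> carrier (V \<otimes> W)"
        using vspace_subspace(3)[OF vspace_tensor t, of k] by simp
      have T'W: "b \<in> carrier W" if "b \<in> T'" for b using T' E(1) that by blast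
      have "G T' (tensor V W v w) = (\<Sum>b\<in>T'. tensor V W v (scl W (c b w) b))"
        unfolding G_def
        by (rule sum.cong) (simp_all add: slice_right_tensor V c step(1,2)
            T'W scl_tensor_left scl_tensor_right)
      also have "\<dots> = tensor V W v (\<Sum>b\<in>T'. scl W (c b w) b)"
        using linear_map_sum[OF tensor_linear(2)[OF step(1)] W vspace_tensor T'(1)]
          T'W vspace_subspace(3)[OF W] by simp
      also have "(\<Sum>b\<in>T'. scl W (c b w) b) = (\<Sum>b\<in>S. scl W (c b w) b)"
        using T' by (intro sum.mono_neutral_right) (auto simp: S_def)
      finally have "G T' (tensor V W v w) = tensor V W v w" using S(3) by simp
      moreover have "G T' y = y" using T(3)[of T'] T' by blast
      ultimately show ?thesis
        using linear_mapD(2)[OF G[OF T'(1,3)] t' step(3)] linear_mapD(3)[OF G[OF T'(1,3)] t, of k]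
        by (simp only: tensor_alg_simps(2))
    qed
    moreover have "finite (S \<union> T)" "S \<union> T \<subseteq> E" using S T by auto
    ultimately show ?case by blast
  qed
  then obtain T where T: "finite T" "T \<subseteq> E" "G T x = x" by blast
  show ?thesis
    by (rule exI[of _ T], rule exI[of _ c]) (use T c E(1) in \<open>auto simp: G_def\<close>)
qed

text \<open>Through this criterion, stability under a coaction passes to intersections of subspaces.\<close>

lemma mem_tensor_span_iff_slices:
  assumes V: "vspace V" and W: "vspace W" and x: "x \<in> carrier (V \<otimes> W)"
    and M: "module.subspace (scl V) M" "M \<subseteq> carrier V"
  shows "x \<in> tensor_span V W M (carrier W) \<longleftrightarrow>
    (\<forall>f. linear_map W ground f \<longrightarrow> slice_right V W f x \<in> M)"
proof (intro iffI allI impI)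
  fix f assume x_span: "x \<in> tensor_span V W M (carrier W)" and f: "linear_map W ground f"
  interpret V: vector_space "scl V" using V by (simp add: vspace_def)
  note sl = slice_right_linear[OF V f]
  from x_span have "x \<in> carrier (V \<otimes> W) \<and> slice_right V W f x \<in> M"
    unfolding tensor_span_def
  proof (induction rule: tensor_vs.span_induct_alt)
    case base
    have "slice_right V W f 0 = 0" by (rule linear_map_0[OF sl vspace_tensor V])
    then show ?case using vspace_subspace(1)[OF vspace_tensor] V.subspace_0[OF M(1)] by metis
  next
    case (step c t y)
    then obtain v w where t: "t = tensor V W v w" "v \<in> M" "w \<in> carrier W" by blast
    then have v: "v \<in> carrier V" using M by blast
    have t': "t \<in> carrier (V \<otimes> W)" unfolding t by (rule tensor_in_carrier) fact+
    have ct: "tensor_scl c t \<in> carrier (V \<otimes> W)"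
        using vspace_subspace(3)[OF vspace_tensor t', of c] by simp
    have "slice_right V W f (tensor_scl c t + y) = scl V c (scl V (f w) v) + slice_right V W f y"
      using linear_mapD(2)[OF sl ct, of y] linear_mapD(3)[OF sl t', of c] step(2)
      by (simp add: t slice_right_tensor V f v)
    moreover have "scl V c (scl V (f w) v) + slice_right V W f y \<in> M"
      using step(2) t(2) by (intro V.subspace_add V.subspace_scale M) auto
    ultimately show ?case
      using vspace_subspace(2)[OF vspace_tensor ct conjunct1[OF step(2)]] by metis
  qed
  then show "slice_right V W f x \<in> M" ..
next
  assume *: "\<forall>f. linear_map W ground f \<longrightarrow> slice_right V W f x \<in> M"
  obtain T f where T: "T \<subseteq> carrier W" "\<forall>b\<in>T. linear_map W ground (f b)"
    "x = (\<Sum>b\<in>T. tensor V W (slice_right V W (f b) x) b)"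
    using tensor_eq_sum_slices[OF V W x] by blast
  have "(\<Sum>b\<in>T. tensor V W (slice_right V W (f b) x) b) \<in> tensor_span V W M (carrier W)"
    unfolding tensor_span_def
    by (rule tensor_vs.span_sum, rule tensor_vs.span_base) (use T(1,2) * in blast)
  then show "x \<in> tensor_span V W M (carrier W)" using T(3) by simp
qed

lemma mem_tensor_span_iff_slices_left:
  assumes V: "vspace V" and W: "vspace W" and x: "x \<in> carrier (V \<otimes> W)"
    and M: "module.subspace (scl W) M" "M \<subseteq> carrier W"
  shows "x \<in> tensor_span V W (carrier V) M \<longleftrightarrow>
    (\<forall>f. linear_map V ground f \<longrightarrow> slice_left V W f x \<in> M)"
proof -
  have "tensor_swap x \<in> carrier (W \<otimes> V)"
    using x tensor_swap_span unfolding tensor_alg_simps by blast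
  moreover have "x \<in> tensor_span V W (carrier V) M \<longleftrightarrow> tensor_swap x \<in> tensor_span W V M (carrier V)"
    using tensor_swap_span[of x V W] tensor_swap_span[of "tensor_swap x" W V]
        by (auto simp: tensor_swap_swap)
  ultimately show ?thesis
    using mem_tensor_span_iff_slices[OF W V _ M] by (simp add: slice_left_def)
qed

lemma tensor_map_span:
  assumes f: "linear_map V V' f" "S \<subseteq> carrier V" "f ` S \<subseteq> S'"
    and g: "linear_map W W' g" "T \<subseteq> carrier W" "g ` T \<subseteq> T'"
    and x: "x \<in> tensor_span V W S T"
  shows "tensor_map V' W' f g x \<in> tensor_span V' W' S' T'"
  using x unfolding tensor_span_def
proof (induction rule: tensor_vs.span_induct_alt)
  case base
  have "tensor_map V' W' f g 0 = 0" by (auto simp: tensor_map_def fun_eq_iff)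
  then show ?case by (simp only: tensor_vs.span_zero)
next
  case (step c t y)
  have eq: "tensor_map V' W' f g (tensor_scl c t + y)
      = tensor_scl c (tensor_map V' W' f g t) + tensor_map V' W' f g y"
    by (auto simp: tensor_map_def tensor_scl_def fun_eq_iff)
  obtain v w where t: "t = tensor V W v w" "v \<in> S" "w \<in> T" using step(1) by blast
  then have "tensor_map V' W' f g t = tensor V' W' (f v) (g w)"
    using tensor_map_tensor[OF f(1) g(1)] f(2) g(2) by blast
  then have "tensor_map V' W' f g t \<in> {tensor V' W' v w |v w. v \<in> S' \<and> w \<in> T'}"
    using t(2,3) f(3) g(3) by blast
  then show ?case
    unfolding eq by (intro tensor_vs.span_add tensor_vs.span_scale tensor_vs.span_base step(2))
qed

section \<open>The globalization\<close>

context partial_bicomodule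
begin

text \<open>
  The subalgebras of \<open>F\<close> that contain the image of \<open>A\<close> and are stable under both coactions. Stability is
  expressed by slices, so that it passes to intersections; \<open>stableD\<close> and \<open>stableI\<close> relate
  this to the tensor products of the subalgebra with \<open>H\<close>.
\<close>

definition stable :: "('k, 'h, ('k, 'a, 'h) tensor) tensor set \<Rightarrow> bool" where
  "stable N \<longleftrightarrow> subalgebra F N \<and> emb ` carrier A \<subseteq> N \<and>
     (\<forall>f. linear_map H ground f \<longrightarrow>
        (\<forall>n\<in>N. slice_right F H f (rhoF n) \<in> N \<and> slice_left H F f (lamF n) \<in> N))"

lemma stableD:
  assumes "stable N"
  shows "rhoF ` N \<subseteq> tensor_span F H N (carrier H)" "lamF ` N \<subseteq> tensor_span H F (carrier H) N"
proof -
  have N: "module.subspace (scl F) N" "N \<subseteq> carrier F"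
    using assms by (simp_all only: stable_def subalgebra_def)
  have H: "vspace H" and F: "vspace F" by (simp_all add: wf)
  show "rhoF ` N \<subseteq> tensor_span F H N (carrier H)"
  proof
    fix y assume "y \<in> rhoF ` N"
    then obtain n where n: "y = rhoF n" "n \<in> N" by blast
    have "rhoF n \<in> carrier (F \<otimes> H)" using n(2) N(2) by (intro mem_rhoF) blast
    from mem_tensor_span_iff_slices[OF F H this N] show "y \<in> tensor_span F H N (carrier H)"
      using assms n unfolding stable_def by blast
  qed
  show "lamF ` N \<subseteq> tensor_span H F (carrier H) N"
  proof
    fix y assume "y \<in> lamF ` N"
    then obtain n where n: "y = lamF n" "n \<in> N" by blast
    have "lamF n \<in> carrier (H \<otimes> F)" using n(2) N(2) by (intro mem_lamF) blast
    from mem_tensor_span_iff_slices_left[OF H F this N] show "y \<in> tensor_span H F (carrier H) N"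
      using assms n unfolding stable_def by blast
  qed
qed

lemma stableI:
  assumes N: "subalgebra F N" "emb ` carrier A \<subseteq> N"
    and rho: "rhoF ` N \<subseteq> tensor_span F H N (carrier H)"
    and lam: "lamF ` N \<subseteq> tensor_span H F (carrier H) N"
  shows "stable N"
  unfolding stable_def
proof (intro conjI allI impI ballI N)
  have N': "module.subspace (scl F) N" "N \<subseteq> carrier F"
    using N(1) by (simp_all only: subalgebra_def)
  have H: "vspace H" and F: "vspace F" by (simp_all add: wf)
  fix f n assume f: "linear_map H ground f" and n: "n \<in> N"
  have "rhoF n \<in> carrier (F \<otimes> H)" using n N'(2) by (intro mem_rhoF) blast
  from mem_tensor_span_iff_slices[OF F H this N'] show "slice_right F H f (rhoF n) \<in> N"
    using rho f n by blast
  have "lamF n \<in> carrier (H \<otimes> F)" using n N'(2) by (intro mem_lamF) blast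
  from mem_tensor_span_iff_slices_left[OF H F this N'] show "slice_left H F f (lamF n) \<in> N"
    using lam f n by blast
qed

lemma stable_carrier: "stable (carrier F)"
proof (rule stableI)
  have F: "vspace F" by (simp add: wf)
  then show "subalgebra F (carrier F)"
    by (simp add: subalgebra_def vspace_def mem_mult wf)
  show "emb ` carrier A \<subseteq> carrier F" using mem_emb by blast
  show "rhoF ` carrier F \<subseteq> tensor_span F H (carrier F) (carrier H)"
    using mem_rhoF tensor_alg_simps(1)[of F H] by blast
  show "lamF ` carrier F \<subseteq> tensor_span H F (carrier H) (carrier F)"
    using mem_lamF tensor_alg_simps(1)[of H F] by blast
qed

text \<open>The underlying space of the globalization.\<close>

definition M where "M = \<Inter> {N. stable N}"

lemma M_least: "stable N \<Longrightarrow> M \<subseteq> N"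
  by (auto simp: M_def)

lemma stable_M: "stable M"
proof -
  interpret F: vector_space "scl F" using vspace_tensor[of H "A \<otimes> H"] by (simp only: vspace_def)
  have sub: "subalgebra F N" if "stable N" for N using that by (simp only: stable_def)
  have "F.subspace M" unfolding M_def
    by (rule F.subspace_Inter) (use sub in \<open>simp add: subalgebra_def\<close>)
  moreover have "mult F x y \<in> M" if "x \<in> M" "y \<in> M" for x y
    using that sub unfolding M_def subalgebra_def by blast
  ultimately have "subalgebra F M"
    using M_least[OF stable_carrier] by (simp add: subalgebra_def)
  moreover have "emb ` carrier A \<subseteq> M" unfolding M_def stable_def by blast
  moreover have "slice_right F H f (rhoF n) \<in> M" "slice_left H F f (lamF n) \<in> M"
    if "linear_map H ground f" "n \<in> M" for f n
    using that unfolding M_def stable_def by blast+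
  ultimately show ?thesis by (simp add: stable_def)
qed

theorem globalization_exists:
  "\<exists>(B :: ('k, ('k, 'h, ('k, 'a, 'h) tensor) tensor) alg) lamB rhoB
      . globalization H lam A rho lamB B rhoB emb"
proof -
  have M: "subalgebra F M" "emb ` carrier A \<subseteq> M"
    using stable_M by (simp_all only: stable_def)
  have M': "module.subspace (scl F) M" "M \<subseteq> carrier F"
    using M(1) by (simp_all only: subalgebra_def)
  obtain \<pi> where \<pi>: "linear_map F (F\<lparr>carrier := M\<rparr>) \<pi>" "\<And>m. m \<in> M \<Longrightarrow> \<pi> m = m"
    using linear_projection[OF vspace_tensor M'] by blast
  have "bicomodule_algebra H lamF F rhoF"
    by (simp add: bicomodule_algebra_iff wf right_coaction_rhoF left_coaction_lamF
        coactions_commute_cofree_extended)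
  then interpret S: stable_subalgebra H lamF F rhoF M \<pi>
    using M(1) \<pi> stableD[OF stable_M] by unfold_locales
  let ?B = "S.B"
  have emb_B: "emb a \<in> carrier ?B" if "a \<in> carrier A" for a
    using M(2) that by (auto simp: S.B_simps)
  have hom: "alg_hom A ?B emb"
    using emb_hom emb_B by (simp add: alg_hom_def linear_map_def S.B_simps)
  note [lin, wf] = alg_hom_linear[OF hom]
  have minimal: "N = carrier ?B" if N: "subalgebra ?B N" "emb ` carrier A \<subseteq> N"
    "S.rhoB ` N \<subseteq> tensor_span ?B H N (carrier H)" "S.lamB ` N \<subseteq> tensor_span H ?B (carrier H) N" for N
  proof -
    have NB: "N \<subseteq> carrier ?B" using N(1) by (simp add: subalgebra_def)
    have "stable N"
    proof (rule stableI)
      show "subalgebra F N" using N(1) M'(2) by (auto simp: subalgebra_def S.B_simps)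
      show "rhoF ` N \<subseteq> tensor_span F H N (carrier H)"
      proof
        fix y assume "y \<in> rhoF ` N"
        then obtain n where n: "n \<in> N" "y = rhoF n" by blast
        have "n \<in> carrier ?B" using n(1) NB by blast
        then have y: "y = S.incR (S.rhoB n)" using n(2) by (simp only: S.incR_rhoB)
        show "y \<in> tensor_span F H N (carrier H)"
          unfolding y by (rule tensor_map_span[OF S.incl_linear NB _ lin_ident]) (use N(3) n in auto)
      qed
      show "lamF ` N \<subseteq> tensor_span H F (carrier H) N"
      proof
        fix y assume "y \<in> lamF ` N"
        then obtain n where n: "n \<in> N" "y = lamF n" by blast
        have "n \<in> carrier ?B" using n(1) NB by blast
        then have y: "y = S.incL (S.lamB n)" using n(2) by (simp only: S.incL_lamB)
        show "y \<in> tensor_span H F (carrier H) N"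
          unfolding y by (rule tensor_map_span[OF lin_ident _ _ S.incl_linear NB]) (use N(4) n in auto)
      qed
    qed fact
    from M_least[OF this] NB show "N = carrier ?B" by (auto simp: S.B_simps)
  qed
  have condition: "mult (H \<otimes> (?B \<otimes> H))
          (tensor_assoc H ?B H (tensor (H \<otimes> ?B) H (S.lamB (emb a)) (one H)))
          (tensor H (?B \<otimes> H) (one H) (S.rhoB (emb b)))
        = tensor_map H (?B \<otimes> H) id (tensor_map ?B H emb id)
            (mult (H \<otimes> (A \<otimes> H))
               (tensor_assoc H A H (tensor (H \<otimes> A) H (lam a) (one H)))
               (tensor H (A \<otimes> H) (one H) (rho b)))" (is "mult _ ?l ?r = tensor_map _ _ _ _ ?z")
    if [lin, wf]: "a \<in> carrier A" "b \<in> carrier A" for a b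
  proof (rule inj_onD[OF S.incLR_inj])
    note emb_B [lin, wf]
    have mem: "?l \<in> carrier (H \<otimes> (?B \<otimes> H))" "?r \<in> carrier (H \<otimes> (?B \<otimes> H))" "?z \<in> carrier F"
      by (rule lin)+
    show "mult (H \<otimes> (?B \<otimes> H)) ?l ?r \<in> carrier (H \<otimes> (?B \<otimes> H))"
      using mem by (simp add: wf)
    show "tensor_map H (?B \<otimes> H) id (tensor_map ?B H emb id) ?z \<in> carrier (H \<otimes> (?B \<otimes> H))"
      using mem(3) by (rule mem_tensor_map) (rule lin)+
    have l: "S.incLR ?l = tensor_assoc H F H (tensor (H \<otimes> F) H (lamF (emb a)) (one H))"
      by (subst S.incLR_assoc) (simp_all add: wf pure S.incL_lamB)
    have r: "S.incLR ?r = tensor H (F \<otimes> H) (one H) (rhoF (emb b))"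
      by (simp add: pure wf S.incR_rhoB)
    have z: "S.incLR (tensor_map H (?B \<otimes> H) id (tensor_map ?B H emb id) ?z)
        = tensor_map H (F \<otimes> H) id (tensor_map F H emb id) ?z"
      by (simp add: tensor_map_comp wf id_def)
    have "S.incLR (mult (H \<otimes> (?B \<otimes> H)) ?l ?r) = mult (H \<otimes> (F \<otimes> H)) (S.incLR ?l) (S.incLR ?r)"
      by (rule alg_hom_mult[OF S.incLR_hom mem(1,2)])
    also have "\<dots> = tensor_map H (F \<otimes> H) id (tensor_map F H emb id) ?z"
      unfolding l r by (rule emb_condition) fact+
    finally show "S.incLR (mult (H \<otimes> (?B \<otimes> H)) ?l ?r)
        = S.incLR (tensor_map H (?B \<otimes> H) id (tensor_map ?B H emb id) ?z)"
      unfolding z .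
  qed
  have "globalization H lam A rho S.lamB ?B S.rhoB emb"
    unfolding globalization_def
    by (intro conjI allI impI ballI S.bicomodule_algebra_B hom emb_inj minimal condition) simp_all
  then show ?thesis by blast
qed

end

theorem theorem3p18:
  fixes H :: "('k::field, 'h::ab_group_add) hopf"
    and A :: "('k, 'a::ab_group_add) ualg"
    and lamA :: "'a \<Rightarrow> ('k, 'h, 'a) tensor"
    and rhoA :: "'a \<Rightarrow> ('k, 'a, 'h) tensor"
  assumes "hopf_algebra H"
    and "partial_bicomodule_algebra H lamA A rhoA"
  shows "\<exists>(B :: ('k, ('k, 'h, ('k, 'a, 'h) tensor) tensor) alg) lamB rhoB \<theta>.
           globalization H lamA A rhoA lamB B rhoB \<theta>"
proof -
  interpret partial_bicomodule H lamA A rhoA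
    using assms by unfold_locales
  show ?thesis using globalization_exists by (elim exE) (intro exI)
qed

end
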